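(* In the setting below, fix $0\le k\le g$ with $N_k>1$, and let $B_0:=(0,\dots,0,N_k)\in\mathcal{B}$. Then the boundary polynomial $\bar H_k$ of $H_k$ (w.r.t. its Newton polygon $\mathcal{N}(H_k)$) equals $$\bar H_k=\sum_{(i,w_i)\in\mathcal{N}(H_k)}\Big(\sum_{B\in\mathcal{B}(i,w_i+v_k(F))}f_B\Lambda^{B-B_0}\Big)x^{w_i}y^i.$$
   Context: Setting. $\mathbb{K}$ perfect, $F\in\mathbb{K}[[x]][y]$ monic of degree $d$, $\mathrm{char}\,\mathbb{K}=0$ or $>d$. Newton polygon of $H=\sum h_i(x)y^i$: lower convex hull of $(i,\mathrm{val}_x h_i)$; principal Newton polygon: its edges of negative slope; boundary polynomial: sum of terms $h_{ij}x^jy^i$ with $(i,j)$ on the polygon. $H$ degenerated: polygon straight of slope $-m/q$ ($\gcd(q,m)=1$, $q>0$) and boundary polynomial $c(P(y^q/x^m)x^{\varepsilon m\deg P})^N$ with $c\ne0$, $P$ monic irreducible, $\varepsilon=1$ if $m\ge0$, else $0$; edge data $(q,m,P,N)$, $\ell=\deg P$. Procedure: $\mathbb{K}_0=\mathbb{K}$, $N_0=d$, $\tau_0(x,y)=(x,y-a_{d-1}(x)/d)$ ($a_{d-1}$ coefficient of $y^{d-1}$), $H_0=F\circ\tau_0$. For $k\ge0$: if $N_k=1$ or $H_k$ not degenerated over $\mathbb{K}_k$ (w.r.t. Newton polygon if $k=0$, principal Newton polygon if $k\ge1$), stop with $g=k$; else with edge data $(q_{k+1},m_{k+1},P_{k+1},N_{k+1})$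 let $\mathbb{K}_{k+1}=\mathbb{K}_k[Z]/(P_{k+1})$, $z_{k+1}$ the class of $Z$, $q_{k+1}s_{k+1}-m_{k+1}t_{k+1}=1$, $0\le t_{k+1}<q_{k+1}$, $\sigma_{k+1}(x,y)=(z_{k+1}^{t_{k+1}}x^{q_{k+1}},x^{m_{k+1}}(y+z_{k+1}^{s_{k+1}}))$, write $H_k\circ\sigma_{k+1}=x^aUG$ ($U(0,0)\ne0$, $G$ Weierstrass of degree $N_{k+1}$), $\tau_{k+1}(x,y)=(x,y+c_{k+1}(x))$ with $c_{k+1}=-(\text{coefficient of }y^{N_{k+1}-1}\text{ in }G)/N_{k+1}$, $H_{k+1}=G\circ\tau_{k+1}$. $\pi_0=\tau_0$, $\pi_k=\pi_{k-1}\circ\sigma_k\circ\tau_k$, so $\pi_k(x,y)=(\mu_kx^{e_k},\alpha_kx^{r_k}y+S_k(x))$ with $\mu_k,\alpha_k\in\mathbb{K}_k^\times$, $e_k=q_1\cdots q_k$; $f_k=\ell_1\cdots\ell_k$. $\phi_i$ ($0\le i\le g$) is the unique monic irreducible polynomial in $\mathbb{K}[[x]][y]$ with $\phi_i(\mu_ix^{e_i},S_i(x))=0$; $\phi_{-1}=x$. For $H\in\mathbb{K}[[x]][y]$: $v_k(H)=\mathrm{val}_x(H\circ\pi_k)$ and $\lambda_k(H)\in\mathbb{K}_k$ is the trailing coefficient in $y$ of $\big((H\circ\pi_k)/x^{v_k(H)}\big)|_{x=0}$ ($\lambda_k(0)=0$). $\Phi=(\phi_{-1},\dots,\phi_k)$,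 $\mathcal{B}=\{B\in\mathbb{N}^{k+2}: b_{i-1}<q_i\ell_i,\ 1\le i\le k\}$, $\Phi^B=\prod\phi_i^{b_i}$; $F=\sum_{B\in\mathcal{B}}f_B\Phi^B$ uniquely with $f_B\in\mathbb{K}$. $V=(v_k(\phi_i))_{i=-1}^k$, $\Lambda=(\lambda_k(\phi_i))_{i=-1}^k$ (nonzero, invertible entries), $\Lambda^B=\prod\lambda_k(\phi_i)^{b_i}$ (for integer vectors). $\mathcal{B}(i,w)=\{B\in\mathcal{B}: b_k=i,\ \langle B,V\rangle=w\}$, empty for $w=\infty$. $w_i=\min\{\langle B,V\rangle: b_k=i,\ f_B\ne0\}-v_k(F)$ ($\infty$ if empty). *)

theory Defs
  imports "HOL-Analysis.Analysis" "HOL-Computational_Algebra.Computational_Algebra"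
begin

text \<open>The base field K is a subfield (given as a set) of an ambient field 'a.
  Elements of K[[x]][y] are elements of type 'a fps poly whose coefficients all lie in K.
  The extension fields K_k are realised as subfields of 'a obtained by adjoining a root
  z_k of P_k (isomorphic to K_{k-1}[Z]/(P_k) since P_k is irreducible over K_{k-1}).\<close>

definition is_subfield :: "'a::field set \<Rightarrow> bool" where
  "is_subfield L \<longleftrightarrow> 0 \<in> L \<and> 1 \<in> L \<and>
     (\<forall>a\<in>L. \<forall>b\<in>L. a + b \<in> L \<and> a * b \<in> L) \<and>
     (\<forall>a\<in>L. - a \<in> L \<and> inverse a \<in> L)"

definition adjoin :: "'a::field set \<Rightarrow> 'a \<Rightarrow> 'a set" where
  "adjoin L z = \<Inter> {M. is_subfield M \<and> L \<subseteq> M \<and> z \<in> M}"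

primrec tower :: "'a::field set \<Rightarrow> (nat \<Rightarrow> 'a) \<Rightarrow> nat \<Rightarrow> 'a set" where
  "tower K z 0 = K"
| "tower K z (Suc j) = adjoin (tower K z j) (z (Suc j))"

definition perfect_subfield :: "'a::field set \<Rightarrow> bool" where
  "perfect_subfield K \<longleftrightarrow> CHAR('a) = 0 \<or> (\<forall>a\<in>K. \<exists>b\<in>K. b ^ CHAR('a) = a)"

definition irred_over :: "'a::field set \<Rightarrow> 'a poly \<Rightarrow> bool" where
  "irred_over L p \<longleftrightarrow> (\<forall>i. coeff p i \<in> L) \<and> degree p > 0 \<and>
     (\<forall>A B. (\<forall>i. coeff A i \<in> L) \<and> (\<forall>i. coeff B i \<in> L) \<and> p = A * B
        \<longrightarrow> degree A = 0 \<or> degree B = 0)"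

definition ps_poly_ring :: "'a::field set \<Rightarrow> 'a fps poly set" where
  "ps_poly_ring K = {H. \<forall>i n. coeff H i $ n \<in> K}"

definition unit_in :: "'b::comm_ring_1 set \<Rightarrow> 'b \<Rightarrow> bool" where
  "unit_in R u \<longleftrightarrow> (\<exists>v\<in>R. u * v = 1)"

definition irreducible_in :: "'b::comm_ring_1 set \<Rightarrow> 'b \<Rightarrow> bool" where
  "irreducible_in R p \<longleftrightarrow> p \<in> R \<and> p \<noteq> 0 \<and> \<not> unit_in R p \<and>
     (\<forall>A\<in>R. \<forall>B\<in>R. p = A * B \<longrightarrow> unit_in R A \<or> unit_in R B)"

definition np_points :: "'a::zero fps poly \<Rightarrow> (real \<times> real) set" where
  "np_points H = {(real i, real (subdegree (coeff H i))) | i. coeff H i \<noteq> 0}"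

definition newton_polygon :: "'a::zero fps poly \<Rightarrow> (real \<times> real) set" where
  "newton_polygon H = {p \<in> convex hull (np_points H).
      \<forall>p' \<in> convex hull (np_points H). fst p' = fst p \<longrightarrow> snd p \<le> snd p'}"

text \<open>Principal Newton polygon: union of the edges of negative slope.\<close>
definition principal_polygon :: "'a::zero fps poly \<Rightarrow> (real \<times> real) set" where
  "principal_polygon H = {p \<in> newton_polygon H. \<exists>p' \<in> newton_polygon H. p' \<noteq> p \<and>
      closed_segment p p' \<subseteq> newton_polygon H \<and>
      (snd p' - snd p) / (fst p' - fst p) < 0}"

definition boundary_poly :: "(real \<times> real) set \<Rightarrow> 'a::comm_ring_1 fps poly \<Rightarrow> 'a fps poly" where
  "boundary_poly E H = (\<Sum>i\<le>degree H.
      monom (Abs_fps (\<lambda>j. if (real i, real j) \<in> E then coeff H i $ j else 0)) i)"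

definition straight_of_slope :: "(real \<times> real) set \<Rightarrow> nat \<Rightarrow> int \<Rightarrow> bool" where
  "straight_of_slope E q m \<longleftrightarrow> (\<exists>p1 p2. E = closed_segment p1 p2 \<and> fst p1 < fst p2 \<and>
      (snd p2 - snd p1) / (fst p2 - fst p1) = - (real_of_int m / real q))"

text \<open>P(y^q/x^m) x^(eps m deg P), eps = 1 if m >= 0 and 0 otherwise, written out termwise.\<close>
definition edge_poly :: "nat \<Rightarrow> int \<Rightarrow> 'a::comm_ring_1 poly \<Rightarrow> 'a fps poly" where
  "edge_poly q m P = (\<Sum>j\<le>degree P.
      monom (fps_const (coeff P j) *
             fps_X ^ nat (if m \<ge> 0 then m * int (degree P - j) else - m * int j)) (q * j))"

definition degenerate ::
  "(real \<times> real) set \<Rightarrow> 'a::field set \<Rightarrow> 'a fps poly \<Rightarrow> nat \<Rightarrow> int \<Rightarrow> 'a poly \<Rightarrow> nat \<Rightarrow> bool" where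
  "degenerate E L H q m P N \<longleftrightarrow> q > 0 \<and> coprime (int q) m \<and> straight_of_slope E q m \<and>
     lead_coeff P = 1 \<and> irred_over L P \<and>
     (\<exists>c. c \<noteq> 0 \<and> boundary_poly E H = [:fps_const c:] * (edge_poly q m P) ^ N)"

section \<open>Substitution maps (x,y) \<mapsto> (X(x), Y(x,y))\<close>

type_synonym 'a pmap = "'a fps \<times> 'a fps poly"

definition subs :: "'a::field fps poly \<Rightarrow> 'a pmap \<Rightarrow> 'a fps poly" where
  "subs H A = pcompose (map_poly (\<lambda>h. h oo fst A) H) (snd A)"

definition mcomp :: "'a::field pmap \<Rightarrow> 'a pmap \<Rightarrow> 'a pmap" where
  "mcomp A B = (fst A oo fst B, pcompose (map_poly (\<lambda>h. h oo fst B) (snd A)) (snd B))"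

definition tau_map :: "'a::field fps \<Rightarrow> 'a pmap" where
  "tau_map c = (fps_X, [:c, 1:])"

text \<open>sigma(x,y) = (z^t x^q, x^m (y + z^s)); here m \<ge> 0 always holds along the procedure.\<close>
definition sigma_map :: "'a::field \<Rightarrow> nat \<Rightarrow> nat \<Rightarrow> int \<Rightarrow> int \<Rightarrow> 'a pmap" where
  "sigma_map z t q m s = (fps_const (z ^ t) * fps_X ^ q,
      [: fps_X ^ nat m * fps_const (z powi s), fps_X ^ nat m :])"

fun pi_map :: "(nat \<Rightarrow> 'a::field pmap) \<Rightarrow> (nat \<Rightarrow> 'a pmap) \<Rightarrow> nat \<Rightarrow> 'a pmap" where
  "pi_map sg ta 0 = ta 0"
| "pi_map sg ta (Suc k) = mcomp (mcomp (pi_map sg ta k) (sg (Suc k))) (ta (Suc k))"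

definition weierstrass :: "'a::field fps poly \<Rightarrow> nat \<Rightarrow> bool" where
  "weierstrass G n \<longleftrightarrow> degree G = n \<and> lead_coeff G = 1 \<and> (\<forall>i<n. coeff G i $ 0 = 0)"

definition valx :: "'a::zero fps poly \<Rightarrow> nat" where
  "valx H = Min {subdegree (coeff H i) | i. coeff H i \<noteq> 0}"

text \<open>Trailing coefficient in y of (H / x^{val_x H}) at x = 0.\<close>
definition trail_lc :: "'a::zero fps poly \<Rightarrow> 'a" where
  "trail_lc H = (let v = valx H in coeff H (LEAST i. coeff H i $ v \<noteq> 0) $ v)"

definition procedure_upto ::
  "'a::field set \<Rightarrow> 'a fps poly \<Rightarrow> nat \<Rightarrow> (nat \<Rightarrow> 'a fps poly) \<Rightarrow> (nat \<Rightarrow> nat) \<Rightarrow> (nat \<Rightarrow> int)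
   \<Rightarrow> (nat \<Rightarrow> 'a poly) \<Rightarrow> (nat \<Rightarrow> nat) \<Rightarrow> (nat \<Rightarrow> 'a) \<Rightarrow> (nat \<Rightarrow> int) \<Rightarrow> (nat \<Rightarrow> nat)
   \<Rightarrow> (nat \<Rightarrow> nat) \<Rightarrow> (nat \<Rightarrow> 'a fps poly) \<Rightarrow> (nat \<Rightarrow> 'a fps poly) \<Rightarrow> (nat \<Rightarrow> 'a fps) \<Rightarrow> bool" where
  "procedure_upto K F k H q m P N z s t a U G c \<longleftrightarrow>
     c 0 = - coeff F (degree F - 1) * fps_const (1 / of_nat (degree F)) \<and>
     H 0 = subs F (tau_map (c 0)) \<and>
     N 0 = degree F \<and>
     (\<forall>j<k. N j \<noteq> 1 \<and>
        degenerate (if j = 0 then newton_polygon (H j) else principal_polygon (H j))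
                   (tower K z j) (H j) (q (Suc j)) (m (Suc j)) (P (Suc j)) (N (Suc j)) \<and>
        poly (P (Suc j)) (z (Suc j)) = 0 \<and>
        int (q (Suc j)) * s (Suc j) - m (Suc j) * int (t (Suc j)) = 1 \<and>
        t (Suc j) < q (Suc j) \<and>
        subs (H j) (sigma_map (z (Suc j)) (t (Suc j)) (q (Suc j)) (m (Suc j)) (s (Suc j)))
          = [:fps_X ^ a (Suc j):] * U (Suc j) * G (Suc j) \<and>
        coeff (U (Suc j)) 0 $ 0 \<noteq> 0 \<and>
        weierstrass (G (Suc j)) (N (Suc j)) \<and>
        c (Suc j) = - coeff (G (Suc j)) (N (Suc j) - 1) * fps_const (1 / of_nat (N (Suc j))) \<and>
        H (Suc j) = subs (G (Suc j)) (tau_map (c (Suc j))))"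

definition the_pi ::
  "(nat \<Rightarrow> nat) \<Rightarrow> (nat \<Rightarrow> int) \<Rightarrow> (nat \<Rightarrow> 'a::field) \<Rightarrow> (nat \<Rightarrow> int) \<Rightarrow> (nat \<Rightarrow> nat)
   \<Rightarrow> (nat \<Rightarrow> 'a fps) \<Rightarrow> nat \<Rightarrow> 'a pmap" where
  "the_pi q m z s t c = pi_map (\<lambda>j. sigma_map (z j) (t j) (q j) (m j) (s j)) (\<lambda>j. tau_map (c j))"

text \<open>Index vectors B = (b_{-1},...,b_k) are encoded as B :: nat \<Rightarrow> nat with
  B j = b_{j-1} for j \<le> k+1 and B j = 0 for j > k+1.  Accordingly
  Phi j = phi_{j-1}, Phi 0 = x.\<close>
definition Phi_vec :: "(nat \<Rightarrow> 'a::comm_ring_1 fps poly) \<Rightarrow> nat \<Rightarrow> 'a fps poly" where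
  "Phi_vec phi j = (if j = 0 then [:fps_X:] else phi (j - 1))"

definition Bset :: "nat \<Rightarrow> (nat \<Rightarrow> nat) \<Rightarrow> (nat \<Rightarrow> 'a::zero poly) \<Rightarrow> (nat \<Rightarrow> nat) set" where
  "Bset k q P = {B. (\<forall>j>Suc k. B j = 0) \<and> (\<forall>i\<in>{1..k}. B i < q i * degree (P i))}"

text \<open>F = sum over B in Bset of f_B Phi^B, the x-adic sum over b_{-1} being assembled
  into power series coefficients (finite in the remaining indices).\<close>
definition phi_expansion ::
  "'a::field set \<Rightarrow> nat \<Rightarrow> (nat \<Rightarrow> nat) \<Rightarrow> (nat \<Rightarrow> 'a poly) \<Rightarrow> (nat \<Rightarrow> 'a fps poly)
   \<Rightarrow> 'a fps poly \<Rightarrow> ((nat \<Rightarrow> nat) \<Rightarrow> 'a) \<Rightarrow> bool" where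
  "phi_expansion K k q P phi F f \<longleftrightarrow>
     (\<forall>B. f B \<in> K) \<and> (\<forall>B. f B \<noteq> 0 \<longrightarrow> B \<in> Bset k q P) \<and>
     finite {B'. B' 0 = 0 \<and> (\<exists>n. f (B'(0 := n)) \<noteq> 0)} \<and>
     F = (\<Sum>B' \<in> {B'. B' 0 = 0 \<and> (\<exists>n. f (B'(0 := n)) \<noteq> 0)}.
            [:Abs_fps (\<lambda>n. f (B'(0 := n))):] * (\<Prod>j\<in>{1..Suc k}. Phi_vec phi j ^ B' j))"

end

theory Submission
  imports Defs
begin

text \<open>Every monomial \<open>\<Phi>\<^sup>B\<close> pulled back along \<open>\<pi>\<^sub>k\<close> is \<open>\<Lambda>\<^sup>B x\<^bsup>\<langle>B,V\<rangle>\<^esup> y\<^bsup>b\<^esup>\<close>, \<open>b\<close> the last entry of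
  \<open>B\<close>, times a series with constant term \<open>1\<close>. For fixed \<open>b\<close> and fixed weight \<open>\<langle>B,V\<rangle>\<close> the \<open>\<Lambda>\<^sup>B\<close> are linearly
  independent over \<open>K\<close>: at each stage \<open>q s - m t = 1\<close> makes the power of \<open>z\<close> determine the new entry
  of \<open>B\<close>. Hence no cancellation occurs among the terms of minimal weight. Applied below degree
  \<open>e\<^sub>k f\<^sub>k\<close>, this shows that no such polynomial vanishes along \<open>\<pi>\<^sub>k\<close>; as \<open>K\<^sub>k[[x]]\<close> is
  generated by \<open>e\<^sub>k f\<^sub>k\<close> elements over \<open>K[[\<mu> x\<^bsup>e\<^esup>]]\<close>, the degree of \<open>\<phi>\<^sub>k\<close> is exactly \<open>e\<^sub>k f\<^sub>k\<close>, and the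
  leading form of \<open>\<phi>\<^sub>k\<close> along \<open>\<pi>\<^sub>k\<close> follows by differentiating in \<open>y\<close>. Finally \<open>F \<circ> \<pi>\<^sub>k = x\<^sup>v u H\<^sub>k\<close> with
  \<open>u(0,0) \<noteq> 0\<close>, and a supporting line of slope \<open>< 0\<close> at a point of the polygon isolates the
  coefficients of \<open>H\<^sub>k\<close> there. The exponent \<open>N\<^sub>k\<close> has coefficient \<open>1\<close> in the
  \<open>\<phi>\<^sub>k\<close>-adic expansion of the monic \<open>F\<close>, so \<open>u(0,0) = \<Lambda>\<^bsup>B\<^sub>0\<^esup>\<close>.\<close>

text \<open>The facts about one level depend on each other in a cycle: independence of the
  \<Lambda>-products at level j yields the degree of phi_j, the degree yields its leading form, and
  that leading form is what independence at level j+1 requires. One induction therefore carries them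
  together. The first stage is the obstacle. H_0 is monic but need not be Weierstrass, so m_1 = 0 is
  possible; the substitution then moves the origin, and a series that is a unit there need not stay
  one. At level 0, however, phi_{-1} and phi_0 pull back to x and y exactly and F pulls back to H_0
  with cofactor 1, so no unit has to be transported. For k = 0 the final comparison is likewise made
  exactly, since a supporting line of negative slope may not exist. Counting generators needs every
  series to have coefficients in K_j, whereas the factorisation x^a U G is only given over the
  ambient field; the Weierstrass shape of G brings it back to K_j. K[[x]] is not a field, so
  elimination and division are done without inverting coefficients.\<close>

unbundle no vec_syntax

section \<open>Subrings as sets, with polynomials and power series over them\<close>

text \<open>All fields K_j lie in one ambient field, so coefficient rings are sets closed under the
  operations rather than types.\<close>

definition is_subring :: "'b::comm_ring_1 set \<Rightarrow> bool" where
  "is_subring S \<longleftrightarrow> 0 \<in> S \<and> 1 \<in> S \<and> (\<forall>a\<in>S. \<forall>b\<in>S. a + b \<in> S \<and> a * b \<in> S) \<and> (\<forall>a\<in>S. - a \<in> S)"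

lemma is_subringD:
  assumes "is_subring S"
  shows "0 \<in> S" "1 \<in> S" "\<And>a b. a \<in> S \<Longrightarrow> b \<in> S \<Longrightarrow> a + b \<in> S"
    "\<And>a b. a \<in> S \<Longrightarrow> b \<in> S \<Longrightarrow> a * b \<in> S" "\<And>a. a \<in> S \<Longrightarrow> - a \<in> S"
    "\<And>a b. a \<in> S \<Longrightarrow> b \<in> S \<Longrightarrow> a - b \<in> S"
  using assms unfolding is_subring_def
  by (auto, metis uminus_add_conv_diff add.commute)

lemma subring_power: "is_subring S \<Longrightarrow> a \<in> S \<Longrightarrow> a ^ n \<in> S"
  by (induction n) (auto intro: is_subringD)

lemma subring_sum: "is_subring S \<Longrightarrow> (\<And>i. i \<in> I \<Longrightarrow> g i \<in> S) \<Longrightarrow> sum g I \<in> S"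
  by (induction I rule: infinite_finite_induct) (auto intro: is_subringD)

lemma subring_prod: "is_subring S \<Longrightarrow> (\<And>i. i \<in> I \<Longrightarrow> g i \<in> S) \<Longrightarrow> prod g I \<in> S"
  by (induction I rule: infinite_finite_induct) (auto intro: is_subringD)

lemma subring_of_nat: "is_subring S \<Longrightarrow> of_nat n \<in> S"
  by (induction n) (auto intro: is_subringD)

lemma subfield_is_subring: "is_subfield L \<Longrightarrow> is_subring L"
  by (auto simp: is_subfield_def is_subring_def)

lemma subfield_inverse: "is_subfield L \<Longrightarrow> a \<in> L \<Longrightarrow> inverse a \<in> L"
  by (auto simp: is_subfield_def)

lemma subfield_divide: "is_subfield L \<Longrightarrow> a \<in> L \<Longrightarrow> b \<in> L \<Longrightarrow> a / b \<in> L"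
  unfolding divide_inverse by (simp add: is_subfield_def)

definition poly_over :: "'b::comm_ring_1 set \<Rightarrow> 'b poly set" where
  "poly_over S = {p. \<forall>i. coeff p i \<in> S}"

definition fps_over :: "'b::comm_ring_1 set \<Rightarrow> 'b fps set" where
  "fps_over S = {h. \<forall>n. h $ n \<in> S}"

lemma poly_overD: "p \<in> poly_over S \<Longrightarrow> coeff p i \<in> S"
  by (simp add: poly_over_def)

lemma fps_overD: "h \<in> fps_over S \<Longrightarrow> h $ n \<in> S"
  by (simp add: fps_over_def)

lemma ps_poly_ring_eq: "ps_poly_ring K = poly_over (fps_over K)"
  by (auto simp: ps_poly_ring_def poly_over_def fps_over_def)

lemma is_subring_poly_over: "is_subring S \<Longrightarrow> is_subring (poly_over S)"
  by (subst is_subring_def)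
    (auto simp: poly_over_def coeff_mult coeff_1 intro!: subring_sum intro: is_subringD)

lemma is_subring_fps_over: "is_subring S \<Longrightarrow> is_subring (fps_over S)"
  by (subst is_subring_def)
    (auto simp: fps_over_def fps_mult_nth intro!: subring_sum intro: is_subringD)

lemma const_poly_over: "is_subring S \<Longrightarrow> a \<in> S \<Longrightarrow> [:a:] \<in> poly_over S"
  by (auto simp: poly_over_def coeff_pCons is_subringD split: nat.splits)

lemma pCons_poly_over: "is_subring S \<Longrightarrow> pCons a p \<in> poly_over S \<longleftrightarrow> a \<in> S \<and> p \<in> poly_over S"
  by (auto simp: poly_over_def coeff_pCons is_subringD split: nat.splits)

lemma smult_poly_over: "is_subring S \<Longrightarrow> a \<in> S \<Longrightarrow> p \<in> poly_over S \<Longrightarrow> smult a p \<in> poly_over S"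
  by (auto simp: poly_over_def is_subringD)

lemma monom_poly_over: "is_subring S \<Longrightarrow> a \<in> S \<Longrightarrow> monom a n \<in> poly_over S"
  by (auto simp: poly_over_def is_subringD)

lemma fps_const_over: "is_subring S \<Longrightarrow> a \<in> S \<Longrightarrow> fps_const a \<in> fps_over S"
  by (auto simp: fps_over_def is_subringD)

lemma fps_X_power_over: "is_subring S \<Longrightarrow> fps_X ^ n \<in> fps_over S"
  by (auto simp: fps_over_def is_subringD fps_X_power_nth)

lemma pderiv_poly_over: "is_subring S \<Longrightarrow> p \<in> poly_over S \<Longrightarrow> pderiv p \<in> poly_over S"
  unfolding poly_over_def coeff_pderiv mem_Collect_eq by (metis is_subringD(4) subring_of_nat)

section \<open>Division with remainder over a subring\<close>

text \<open>The leading coefficient of \<open>g\<close> need not be invertible in \<open>S\<close>,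
  so the dividend is multiplied by it instead of being divided by it. Each such step cancels the top
  term and lowers the degree.\<close>

lemma pseudo_division_over:
  fixes g p :: "'b::idom poly"
  assumes S: "is_subring S" and g: "g \<in> poly_over S" "g \<noteq> 0" and p: "p \<in> poly_over S"
  shows "\<exists>M Q r. Q \<in> poly_over S \<and> r \<in> poly_over S \<and> smult (lead_coeff g ^ M) p = g * Q + r \<and>
    (r = 0 \<or> degree r < degree g)"
  using p
proof (induction "degree p" arbitrary: p rule: less_induct)
  case less
  note R = is_subring_poly_over[OF S]
  show ?case
  proof (cases "p = 0 \<or> degree p < degree g")
    case True
    show ?thesis
      by (rule exI[of _ 0], rule exI[of _ 0], rule exI[of _ p]) (use True less.prems R in \<open>auto intro: is_subringD\<close>)
  next
    case False
    hence p0: "p \<noteq> 0" and le: "degree g \<le> degree p" by auto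
    define b where "b = lead_coeff g"
    define h where "h = monom (lead_coeff p) (degree p - degree g)"
    define p' where "p' = smult b p - g * h"
    have bS: "b \<in> S" unfolding b_def using g(1) by (rule poly_overD)
    have hS: "h \<in> poly_over S" unfolding h_def by (intro monom_poly_over S poly_overD[OF less.prems])
    have p'S: "p' \<in> poly_over S" unfolding p'_def
      by (intro is_subringD(6)[OF R] smult_poly_over S bS less.prems is_subringD(4)[OF R] g(1) hS)
    have b0: "b \<noteq> 0" using g(2) by (simp add: b_def)
    have dh: "degree (g * h) = degree p" 
      using p0 g(2) le by (simp add: h_def degree_mult_eq degree_monom_eq monom_eq_0_iff)
    have "coeff (g * h) (degree p) = lead_coeff g * lead_coeff h"
      using lead_coeff_mult[of g h] dh by simp
    hence ct: "coeff p' (degree p) = 0"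
      by (simp add: p'_def b_def h_def degree_monom_eq p0)
    have dp': "degree p' \<le> degree p"
      unfolding p'_def by (rule degree_diff_le) (use dh in auto)
    have step: "\<exists>M Q r. Q \<in> poly_over S \<and> r \<in> poly_over S \<and> smult (b ^ M) p' = g * Q + r \<and>
      (r = 0 \<or> degree r < degree g)"
    proof (cases "p' = 0")
      case True
      show ?thesis
        by (rule exI[of _ 0], rule exI[of _ 0], rule exI[of _ 0]) (use True R in \<open>auto intro: is_subringD\<close>)
    next
      case False
      hence "degree p' < degree p"
        using ct dp' by (metis le_neq_implies_less leading_coeff_0_iff)
      from less.hyps[OF this p'S] show ?thesis unfolding b_def .
    qed
    then obtain M Q r where *: "Q \<in> poly_over S" "r \<in> poly_over S" "smult (b ^ M) p' = g * Q + r"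
      "r = 0 \<or> degree r < degree g" by blast
    have "smult (b ^ Suc M) p = smult (b ^ M) p' + smult (b ^ M) (g * h)"
      by (simp add: p'_def smult_diff_right mult.commute)
    also have "\<dots> = g * (Q + smult (b ^ M) h) + r"
      using * by (simp add: algebra_simps)
    finally show ?thesis
      using * hS by (intro exI[of _ "Suc M"] exI[of _ "Q + smult (b ^ M) h"] exI[of _ r])
        (auto simp: b_def[symmetric] intro!: is_subringD(3)[OF R] smult_poly_over S subring_power bS)
  qed
qed

lemma monic_division_over:
  fixes g p :: "'b::idom poly"
  assumes "is_subring S" "g \<in> poly_over S" "lead_coeff g = 1" "p \<in> poly_over S"
  shows "\<exists>Q r. Q \<in> poly_over S \<and> r \<in> poly_over S \<and> p = g * Q + r \<and> (r = 0 \<or> degree r < degree g)"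
  using pseudo_division_over[OF assms(1,2) _ assms(4)] assms(3) by force

text \<open>Repeated division by the monic \<open>g\<close> produces digits of degree below that of
  \<open>g\<close>; the bound on \<open>degree h\<close> limits their number to
  \<open>n\<close>.\<close>

lemma base_expansion:
  fixes g h :: "'b::idom poly"
  assumes S: "is_subring S" and g: "g \<in> poly_over S" "lead_coeff g = 1" "degree g > 0"
    and h: "h \<in> poly_over S" "degree h < n * degree g"
  shows "\<exists>a. (\<forall>i. a i \<in> poly_over S \<and> degree (a i) < degree g) \<and> h = (\<Sum>i<n. a i * g ^ i)"
  using h
proof (induction n arbitrary: h)
  case (Suc n)
  have g0: "g \<noteq> 0" using g(2) by auto
  obtain Q r where Qr: "Q \<in> poly_over S" "r \<in> poly_over S" "h = g * Q + r" "r = 0 \<or> degree r < degree g"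
    using monic_division_over[OF S g(1,2) Suc.prems(1)] by blast
  have dr: "degree r < degree g" using Qr(4) g(3) by auto
  show ?case
  \<comment> \<open>A zero quotient is separate because for \<open>n = 0\<close> the strict bound
    \<open>degree Q < n * degree g\<close> of the induction hypothesis would fail.\<close>
  proof (cases "Q = 0")
    case True
    define a where "a i = (if i = 0 then r else 0)" for i :: nat
    have "(\<Sum>i<Suc n. a i * g ^ i) = r"
      by (subst sum.lessThan_Suc_shift) (simp add: a_def)
    thus ?thesis using True Qr dr g(3) is_subringD(1)[OF is_subring_poly_over[OF S]]
      by (intro exI[of _ a]) (auto simp: a_def)
  next
    case False
    have "degree (g * Q) = degree g + degree Q" using g0 False by (simp add: degree_mult_eq)
    hence "degree h = degree g + degree Q" using Qr(3) dr by (simp add: degree_add_eq_left)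
    hence "degree Q < n * degree g" using Suc.prems(2) by simp
    from Suc.IH[OF Qr(1) this] obtain a where a: "\<And>i. a i \<in> poly_over S \<and> degree (a i) < degree g"
      "Q = (\<Sum>i<n. a i * g ^ i)" by blast
    define a' where "a' i = (if i = 0 then r else a (i - 1))" for i
    have "(\<Sum>i<Suc n. a' i * g ^ i) = r + g * Q"
      by (subst sum.lessThan_Suc_shift) (simp add: a'_def a(2) sum_distrib_left mult_ac)
    thus ?thesis using a(1) Qr dr by (intro exI[of _ a']) (auto simp: a'_def add.commute)
  qed
qed simp

section \<open>Simple extensions of subfields\<close>

text \<open>In the ideal generated by \<open>A\<close> and \<open>P\<close> over \<open>L\<close>, a
  nonzero element of least degree divides both generators, since lead coefficients are invertible in
  \<open>L\<close>. Irreducibility of \<open>P\<close> makes it a constant, which is scaled to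
  1.\<close>

lemma bezout_irred_over:
  assumes L: "is_subfield L" and P: "irred_over L P"
    and A: "A \<in> poly_over L" "A \<noteq> 0" "degree A < degree P"
  shows "\<exists>u\<in>poly_over L. \<exists>v\<in>poly_over L. u * A + v * P = 1"
proof -
  note S = subfield_is_subring[OF L]
  note R = is_subring_poly_over[OF S]
  have PL: "P \<in> poly_over L" and P0: "P \<noteq> 0" using P by (auto simp: irred_over_def poly_over_def)
  define I where "I = {u * A + v * P |u v. u \<in> poly_over L \<and> v \<in> poly_over L}"
  have IL: "x \<in> poly_over L" if "x \<in> I" for x
    using that A(1) PL R unfolding I_def by (auto intro!: is_subringD(3,4))
  have "1 * A + 0 * P \<in> I" unfolding I_def using is_subringD(1,2)[OF R] by blast
  hence "A \<in> I" by simp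
  have "0 * A + 1 * P \<in> I" unfolding I_def using is_subringD(1,2)[OF R] by blast
  hence PI: "P \<in> I" by simp
  have Isub: "smult a x - g * Q \<in> I" if xg: "x \<in> I" "g \<in> I" and "Q \<in> poly_over L" "a \<in> L" for a x g Q
  proof -
    obtain u v u' v' where "x = u * A + v * P" "g = u' * A + v' * P"
      and *: "u \<in> poly_over L" "v \<in> poly_over L" "u' \<in> poly_over L" "v' \<in> poly_over L"
      using xg unfolding I_def by blast
    then have "smult a x - g * Q = (smult a u - u' * Q) * A + (smult a v - v' * Q) * P"
      by (simp add: algebra_simps smult_add_right)
    moreover have "smult a u - u' * Q \<in> poly_over L" "smult a v - v' * Q \<in> poly_over L"
      using * that by (auto intro!: is_subringD(6)[OF R] is_subringD(4)[OF R] smult_poly_over S)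
    ultimately show ?thesis unfolding I_def by blast
  qed
  obtain g where g: "g \<in> I" "g \<noteq> 0" and gmin: "\<And>h. h \<in> I \<Longrightarrow> h \<noteq> 0 \<Longrightarrow> degree g \<le> degree h"
    using ex_has_least_nat[of "\<lambda>h. h \<in> I \<and> h \<noteq> 0" A degree] \<open>A \<in> I\<close> A(2) by blast
  have divides: "\<exists>Q\<in>poly_over L. x = g * Q" if x: "x \<in> I" for x
  proof -
    obtain M Q r where *: "Q \<in> poly_over L" "r \<in> poly_over L" "smult (lead_coeff g ^ M) x = g * Q + r"
      "r = 0 \<or> degree r < degree g"
      using pseudo_division_over[OF S IL[OF g(1)] g(2) IL[OF x]] by blast
    have lc: "lead_coeff g \<in> L" by (rule poly_overD[OF IL[OF g(1)]])
    have "r = smult (lead_coeff g ^ M) x - g * Q" using *(3) by simp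
    also have "\<dots> \<in> I" by (intro Isub x g *(1) subring_power S lc)
    finally have "r = 0" using *(4) gmin by force
    hence "smult (inverse (lead_coeff g ^ M)) (smult (lead_coeff g ^ M) x) = smult (inverse (lead_coeff g ^ M)) (g * Q)"
      using *(3) by simp
    moreover have "inverse (lead_coeff g ^ M) * lead_coeff g ^ M = 1"
      using g(2) by (intro left_inverse) simp
    ultimately have "x = g * smult (inverse (lead_coeff g ^ M)) Q"
      by (simp only: smult_smult mult_smult_right smult_1_left)
    moreover have "smult (inverse (lead_coeff g ^ M)) Q \<in> poly_over L"
      by (intro smult_poly_over S subfield_inverse[OF L] subring_power lc *(1))
    ultimately show ?thesis by blast
  qed
  obtain Q1 where Q1: "Q1 \<in> poly_over L" "P = g * Q1" using divides[OF PI] by blast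
  obtain Q2 where Q2: "A = g * Q2" using divides[OF \<open>A \<in> I\<close>] by blast
  have "degree g \<le> degree A" using gmin[OF \<open>A \<in> I\<close> A(2)] .
  moreover have "degree g = 0 \<or> degree Q1 = 0"
    using P Q1 IL[OF g(1)] by (auto simp: irred_over_def poly_over_def)
  moreover have "degree P = degree g + degree Q1"
    using P0 Q1 by (auto simp: degree_mult_eq)
  \<comment> \<open>A constant cofactor \<open>Q1\<close> would give \<open>g\<close> the degree of
    \<open>P\<close>, but \<open>degree g \<le> degree A < degree P\<close>.\<close>
  ultimately have "degree g = 0" using A(3) by linarith
  then obtain cc where c: "g = [:cc:]" by (rule degree_eq_zeroE)
  with g have c0: "cc \<noteq> 0" by auto
  have cL: "cc \<in> L" using poly_overD[OF IL[OF g(1)], of 0] c by simp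
  obtain u v where uv: "g = u * A + v * P" "u \<in> poly_over L" "v \<in> poly_over L"
    using g(1) unfolding I_def by auto
  have "smult (inverse cc) u * A + smult (inverse cc) v * P = smult (inverse cc) g"
    using uv(1) by (simp add: smult_add_right)
  also have "\<dots> = 1" using c0 by (simp add: c one_pCons)
  finally show ?thesis using uv cL
    by (intro bexI[of _ "smult (inverse cc) u"] bexI[of _ "smult (inverse cc) v"])
      (auto intro!: smult_poly_over S subfield_inverse L)
qed

lemma irred_over_root_nonzero:
  assumes L: "is_subfield L" and P: "irred_over L P" and z: "poly P z = 0"
    and A: "A \<in> poly_over L" "A \<noteq> 0" "degree A < degree P"
  shows "poly A z \<noteq> 0"
proof
  assume 0: "poly A z = 0"
  obtain u v where "u * A + v * P = 1" using bezout_irred_over[OF L P A] by blast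
  hence "poly (u * A + v * P) z = 1" by simp
  with 0 z show False by simp
qed

text \<open>Dividing by \<open>z ^ n0\<close> turns the relation into a polynomial of degree below
  that of \<open>P\<close> vanishing at \<open>z\<close>. The shifted window is needed later because
  the exponents of \<open>z\<close> in terms of equal weight do not start at 0.\<close>

lemma power_basis_independent:
  assumes L: "is_subfield L" and P: "irred_over L P" and z: "poly P z = 0"
    and a: "\<And>i. i \<in> I \<Longrightarrow> a i \<in> L" and I: "I \<subseteq> {n0..<n0 + degree P}" and z0: "z \<noteq> 0"
    and s: "(\<Sum>i\<in>I. a i * z ^ i) = 0" and i: "i \<in> I"
  shows "a i = 0"
proof -
  have fin: "finite I" using I by (rule finite_subset) simp
  define A where "A = (\<Sum>i\<in>I. monom (a i) (i - n0))"
  have cA: "coeff A (i - n0) = a i" if "i \<in> I" for i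
  proof -
    have "coeff A (i - n0) = (\<Sum>j\<in>I. if j = i then a j else 0)"
      unfolding A_def coeff_sum coeff_monom
    proof (rule sum.cong[OF refl])
      fix j assume "j \<in> I"
      with that I have "n0 \<le> i" "n0 \<le> j" by auto
      thus "(if j - n0 = i - n0 then a j else 0) = (if j = i then a j else 0)" by auto
    qed
    thus ?thesis using that fin by simp
  qed
  have AL: "A \<in> poly_over L" unfolding A_def
    by (intro subring_sum is_subring_poly_over monom_poly_over subfield_is_subring L a)
  have "degree A < degree P"
  proof -
    have P0: "0 < degree P" using P by (simp add: irred_over_def)
    have "degree A \<le> degree P - 1" unfolding A_def
    proof (rule degree_sum_le[OF fin])
      fix i assume "i \<in> I"
      with I have "i < n0 + degree P" by auto
      with P0 show "degree (monom (a i) (i - n0)) \<le> degree P - 1"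
        by (intro order_trans[OF degree_monom_le]) linarith
    qed
    with P0 show ?thesis by linarith
  qed
  have "z ^ n0 * poly A z = (\<Sum>i\<in>I. a i * z ^ i)"
    unfolding A_def poly_sum sum_distrib_left
    by (rule sum.cong) (use I in \<open>auto simp: poly_monom power_add[symmetric] mult.left_commute subset_iff\<close>)
  hence "poly A z = 0" using s z0 by simp
  hence "A = 0" using irred_over_root_nonzero[OF L P z AL _ \<open>degree A < degree P\<close>] by blast
  thus ?thesis using cA[OF i] by simp
qed

lemma is_subfield_adjoin: "is_subfield L \<Longrightarrow> is_subfield (adjoin L z)"
  unfolding adjoin_def is_subfield_def by blast

lemma adjoin_subset: "L \<subseteq> adjoin L z"
  unfolding adjoin_def by blast

lemma adjoin_gen: "z \<in> adjoin L z"
  unfolding adjoin_def by blast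

text \<open>The values at \<open>z\<close> of polynomials over \<open>L\<close> form a field,
  inverses coming from the Bezout identity with \<open>P\<close>. It contains \<open>L\<close> and
  \<open>z\<close>, hence all of \<open>adjoin L z\<close>; division by \<open>P\<close> bounds the
  degree.\<close>

lemma adjoin_representation:
  assumes L: "is_subfield L" and P: "irred_over L P" "lead_coeff P = 1" and z: "poly P z = 0"
    and x: "x \<in> adjoin L z"
  shows "\<exists>p\<in>poly_over L. x = poly p z \<and> degree p < degree P"
proof -
  note S = subfield_is_subring[OF L]
  note R = is_subring_poly_over[OF S]
  have PL: "P \<in> poly_over L" and P0: "0 < degree P" using P by (auto simp: irred_over_def poly_over_def)
  have reduce: "\<exists>p'\<in>poly_over L. poly p z = poly p' z \<and> degree p' < degree P" if p: "p \<in> poly_over L" for p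
  proof -
    obtain Q r where *: "Q \<in> poly_over L" "r \<in> poly_over L" "p = P * Q + r" "r = 0 \<or> degree r < degree P"
      using monic_division_over[OF S PL P(2) p] by blast
    thus ?thesis using P0 z by (intro bexI[of _ r]) auto
  qed
  define M where "M = {poly p z |p. p \<in> poly_over L}"
  have "is_subfield M"
    unfolding is_subfield_def
  proof (intro conjI ballI)
    show "0 \<in> M" unfolding M_def using is_subringD(1)[OF R] by (auto intro!: exI[of _ "0::'a poly"])
    show "1 \<in> M" unfolding M_def using is_subringD(2)[OF R] by (auto intro!: exI[of _ "1::'a poly"])
  next
    fix a b assume "a \<in> M" "b \<in> M"
    then obtain p p' where pp: "a = poly p z" "b = poly p' z" "p \<in> poly_over L" "p' \<in> poly_over L"
      unfolding M_def by blast
    show "a + b \<in> M" unfolding M_def using is_subringD(3)[OF R pp(3,4)] pp(1,2)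
      by (auto intro!: exI[of _ "p + p'"])
    show "a * b \<in> M" unfolding M_def using is_subringD(4)[OF R pp(3,4)] pp(1,2)
      by (auto intro!: exI[of _ "p * p'"])
  next
    fix a assume "a \<in> M"
    then obtain p where p: "a = poly p z" "p \<in> poly_over L"  unfolding M_def by blast
    show "- a \<in> M" unfolding M_def using is_subringD(5)[OF R p(2)] p(1)
      by (auto intro!: exI[of _ "- p"])
    obtain p' where p': "p' \<in> poly_over L" "poly p z = poly p' z" "degree p' < degree P"
      using reduce[OF p(2)] by blast
    show "inverse a \<in> M"
    proof (cases "p' = 0")
      case True
      with p p' \<open>a \<in> M\<close> show ?thesis by simp
    next
      case False
      obtain u v where uv: "u \<in> poly_over L" "u * p' + v * P = 1"
        using bezout_irred_over[OF L P(1) p'(1) False p'(3)] by blast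
      have "poly (u * p' + v * P) z = 1" by (simp add: uv)
      hence "poly u z * a = 1" using p p' z by simp
      hence "inverse a = poly u z" by (metis inverse_unique mult.commute)
      thus ?thesis unfolding M_def using uv by auto
    qed
  qed
  moreover have "L \<subseteq> M" unfolding M_def using const_poly_over[OF S] 
    by (auto intro!: exI[of _ "[:_:]"])
  moreover have "z \<in> M" unfolding M_def using S
    by (auto intro!: exI[of _ "[:0,1:]"] simp: pCons_poly_over is_subringD is_subring_poly_over)
  ultimately have "adjoin L z \<subseteq> M" unfolding adjoin_def by blast
  then obtain p where "p \<in> poly_over L" "x = poly p z" using x unfolding M_def by blast
  thus ?thesis using reduce by fastforce
qed

lemma is_subfield_tower: "is_subfield K \<Longrightarrow> is_subfield (tower K z j)"
  by (induction j) (auto intro: is_subfield_adjoin)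

section \<open>Substitutions\<close>

lemma subs_0 [simp]: "subs 0 A = 0"
  by (simp add: subs_def)

lemma subs_pCons: "subs (pCons h H) A = [:h oo fst A:] + snd A * subs H A"
  unfolding subs_def by (subst map_poly_pCons) (auto simp: pcompose_pCons)

lemma subs_const: "subs [:h:] A = [:h oo fst A:]"
  by (simp add: subs_pCons)

lemma subs_1 [simp]: "subs 1 A = 1"
  by (simp add: one_pCons subs_const)

lemma subs_add: "subs (H + H') A = subs H A + subs H' A"
proof (induction H arbitrary: H')
  case (pCons h H)
  show ?case
    by (cases H', simp_all only: add_pCons subs_pCons pCons.IH fps_compose_add_distrib)
      (simp add: algebra_simps)
qed simp

lemma subs_smult:
  fixes A :: "'a::field pmap"
  assumes "fst A $ 0 = 0"
  shows "subs (smult g H) A = [:g oo fst A:] * subs H A"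
  by (induction H) (simp_all add: subs_pCons fps_compose_mult_distrib[OF assms] algebra_simps smult_add_right)

lemma subs_mult:
  fixes A :: "'a::field pmap"
  assumes "fst A $ 0 = 0"
  shows "subs (H * H') A = subs H A * subs H' A"
  by (induction H) (simp_all add: subs_pCons subs_add subs_smult[OF assms] algebra_simps)

lemma subs_power: "fst (A :: 'a::field pmap) $ 0 = 0 \<Longrightarrow> subs (H ^ n) A = subs H A ^ n"
  by (induction n) (simp_all add: subs_mult)

lemma subs_sum: "subs (sum g I) A = (\<Sum>i\<in>I. subs (g i) A)"
  by (induction I rule: infinite_finite_induct) (simp_all add: subs_add)

lemma subs_prod: "fst (A :: 'a::field pmap) $ 0 = 0 \<Longrightarrow> subs (prod g I) A = (\<Prod>i\<in>I. subs (g i) A)"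
  by (induction I rule: infinite_finite_induct) (simp_all add: subs_mult)

lemma subs_mcomp:
  fixes A B :: "'a::field pmap"
  assumes "fst A $ 0 = 0" "fst B $ 0 = 0"
  shows "subs (subs H A) B = subs H (mcomp A B)"
proof (induction H)
  case (pCons h H)
  have "subs (snd A) B = snd (mcomp A B)" by (simp add: subs_def mcomp_def)
  moreover have "h oo fst A oo fst B = h oo fst (mcomp A B)"
    using assms by (simp add: mcomp_def fps_compose_assoc)
  ultimately show ?case
    using pCons.IH assms by (simp add: subs_pCons subs_add subs_mult subs_const)
qed simp

lemma snd_mcomp: "snd (mcomp A B) = subs (snd A) B"
  by (simp add: mcomp_def subs_def)

lemma fps_compose_monomial_nth:
  fixes h :: "'a::field fps"
  assumes e: "e > 0"
  shows "(h oo (fps_const b * fps_X ^ e)) $ n = (if e dvd n then h $ (n div e) * b ^ (n div e) else 0)"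
proof -
  have "(h oo (fps_const b * fps_X ^ e)) $ n = (\<Sum>i=0..n. if n = e * i then h $ i * b ^ i else 0)"
    unfolding fps_compose_nth
    by (rule sum.cong) (auto simp: power_mult_distrib power_mult[symmetric] fps_const_power fps_X_power_nth)
  also have "\<dots> = (\<Sum>i\<in>{i. n = e * i}. h $ i * b ^ i)"
  proof (rule sum.mono_neutral_cong_right)
    show "{i. n = e * i} \<subseteq> {0..n}" using e by (auto simp: Suc_leI)
  qed auto
  also have "{i. n = e * i} = (if e dvd n then {n div e} else {})"
    using e by auto
  finally show ?thesis by simp
qed

lemma coeff_0_subs: "coeff (subs u A) 0 = poly (map_poly (\<lambda>h. h oo fst A) u) (coeff (snd A) 0)"
  by (induction u) (simp_all add: subs_pCons map_poly_pCons coeff_mult_0)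

lemma const_coeff_subs:
  fixes A :: "'a::field pmap"
  assumes "coeff (snd A) 0 $ 0 = 0"
  shows "coeff (subs u A) 0 $ 0 = coeff u 0 $ 0"
  using assms by (cases u) (simp add: subs_pCons coeff_mult_0)

text \<open>A shift \<open>c\<close> without constant term is invisible modulo x.\<close>

lemma subs_tau_map_coeff_0:
  fixes c :: "'a::field fps"
  assumes c: "c $ 0 = 0"
  shows "coeff (subs H (tau_map c)) i $ 0 = coeff H i $ 0"
proof (induction H arbitrary: i)
  case (pCons h H)
  thus ?case by (cases i) (simp_all add: subs_pCons tau_map_def coeff_pCons c)
qed simp

lemma degree_subs_tau_map: "degree (subs H (tau_map c)) = degree H"
  and lead_coeff_subs_tau_map: "lead_coeff (subs H (tau_map c)) = lead_coeff H"
proof -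
  have *: "subs H (tau_map c) = pcompose H [:c, 1:]"
    by (simp add: subs_def tau_map_def map_poly_idI')
  show "degree (subs H (tau_map c)) = degree H" by (simp add: * degree_pcompose)
  show "lead_coeff (subs H (tau_map c)) = lead_coeff H" by (simp add: * lead_coeff_comp)
qed

lemma degree_subs_le:
  assumes "degree (snd A) \<le> 1"
  shows "degree (subs H A) \<le> degree H"
proof -
  have "degree (subs H A) = degree (map_poly (\<lambda>h. h oo fst A) H) * degree (snd A)"
    unfolding subs_def by (rule degree_pcompose)
  also have "\<dots> \<le> degree (map_poly (\<lambda>h. h oo fst A) H) * 1"
    using assms by (rule mult_le_mono2)
  also have "\<dots> \<le> degree H" by (simp add: map_poly_degree_leq)
  finally show ?thesis .
qed

lemma pderiv_subs: "pderiv (subs H A) = subs (pderiv H) A * pderiv (snd A)" 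
  if "fst (A :: 'a::field pmap) $ 0 = 0"
proof (induction H)
  case (pCons h H)
  show ?case
    using that by (simp add: subs_pCons pderiv_pCons pderiv_add pderiv_mult pCons.IH subs_add algebra_simps)
qed simp

lemma compose_monomial_over:
  assumes S: "is_subring S" and h: "h \<in> fps_over S" and b: "b \<in> S" and e: "e > 0"
  shows "h oo (fps_const b * fps_X ^ e) \<in> fps_over (S :: 'a::field set)"
  unfolding fps_over_def mem_Collect_eq fps_compose_monomial_nth[OF e]
  using S b h by (auto intro!: is_subringD subring_power fps_overD)

lemma subs_over:
  assumes S: "is_subring S" and H: "H \<in> poly_over (fps_over S)" and b: "b \<in> S" and e: "e > 0"
    and A: "fst A = fps_const b * fps_X ^ e" "snd A \<in> poly_over (fps_over S)"
  shows "subs H A \<in> poly_over (fps_over (S :: 'a::field set))"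
  using H
proof (induction H)
  case 0
  show ?case using S by (auto intro!: is_subringD is_subring_poly_over is_subring_fps_over)
next
  case (pCons h H)
  note R = is_subring_fps_over[OF S]
  note RR = is_subring_poly_over[OF R]
  have "h \<in> fps_over S" "H \<in> poly_over (fps_over S)"
    using pCons.prems by (simp_all add: pCons_poly_over R)
  thus ?case
    unfolding subs_pCons A(1)
    by (intro is_subringD(3,4)[OF RR] const_poly_over R compose_monomial_over S b e A pCons.IH)
qed

section \<open>Leading forms\<close>

text \<open>\<open>A\<close> is x^v y^i times a series that does not vanish at the origin. This is
  stronger than knowing the x-valuation and the trailing coefficient: it determines both, it is
  multiplicative, and it passes through \<sigma> and \<tau>.\<close>

definition has_lead :: "'a::field fps poly \<Rightarrow> nat \<Rightarrow> nat \<Rightarrow> 'a \<Rightarrow> bool" where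
  "has_lead A i v b \<longleftrightarrow> b \<noteq> 0 \<and> (\<exists>u. A = monom (fps_X ^ v) i * u \<and> coeff u 0 $ 0 = b)"

lemma has_lead_nonzero: "has_lead A i v b \<Longrightarrow> b \<noteq> 0"
  by (simp add: has_lead_def)

lemma has_lead_monom: "b \<noteq> 0 \<Longrightarrow> has_lead (monom (fps_const b * fps_X ^ v) i) i v b"
  unfolding has_lead_def
  by (auto intro!: exI[of _ "[:fps_const b:]"] simp: monom_altdef mult.commute)

lemma has_lead_mult:
  assumes "has_lead A i v b" "has_lead A' i' v' b'"
  shows "has_lead (A * A') (i + i') (v + v') (b * b')"
proof -
  obtain u u' where u: "A = monom (fps_X ^ v) i * u" "coeff u 0 $ 0 = b"
    "A' = monom (fps_X ^ v') i' * u'" "coeff u' 0 $ 0 = b'"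
    using assms by (auto simp: has_lead_def)
  have "A * A' = monom (fps_X ^ v) i * monom (fps_X ^ v') i' * (u * u')"
    by (simp add: u algebra_simps)
  also have "monom (fps_X ^ v) i * monom (fps_X ^ v') i' = monom (fps_X ^ (v + v') :: 'a fps) (i + i')"
    by (simp add: mult_monom power_add)
  finally show ?thesis using u assms unfolding has_lead_def
    by (auto intro!: exI[of _ "u * u'"] simp: coeff_mult_0)
qed

lemma has_lead_1: "has_lead 1 0 0 1"
  unfolding has_lead_def by (auto intro!: exI[of _ 1] simp: monom_0)

lemma has_lead_power: "has_lead A i v b \<Longrightarrow> has_lead (A ^ n) (n * i) (n * v) (b ^ n)"
  by (induction n) (auto simp: has_lead_1 intro: has_lead_mult)

lemma has_lead_prod:
  assumes "finite I" "\<And>j. j \<in> I \<Longrightarrow> has_lead (A j) 0 (v j) (b j)"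
  shows "has_lead (\<Prod>j\<in>I. A j) 0 (\<Sum>j\<in>I. v j) (\<Prod>j\<in>I. b j)"
  using assms by (induction I rule: finite_induct) (auto simp: has_lead_1 dest: has_lead_mult[of _ 0 _ _ _ 0, simplified])

lemma has_lead_support:
  fixes A :: "'a::field fps poly"
  assumes "has_lead A i v b" "coeff A l $ n \<noteq> 0"
  shows "i \<le> l" "v \<le> n"
  using assms unfolding has_lead_def
  by (auto simp: coeff_monom_mult fps_X_power_mult_nth split: if_splits)

lemma has_lead_coeff: "has_lead (A :: 'a::field fps poly) i v b \<Longrightarrow> coeff A i $ v = b"
  unfolding has_lead_def by (auto simp: coeff_monom_mult fps_X_power_mult_nth)

lemma has_lead_unique:
  assumes "has_lead A i v b" "has_lead A i' v' b'"
  shows "i = i'" "v = v'" "b = b'"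
  using has_lead_support[OF assms(1), of i' v'] has_lead_support[OF assms(2), of i v]
    has_lead_coeff[OF assms(1)] has_lead_coeff[OF assms(2)]
    has_lead_nonzero[OF assms(1)] has_lead_nonzero[OF assms(2)] by force+

lemma has_lead_valx:
  fixes A :: "'a::field fps poly"
  assumes A: "has_lead A i v b"
  shows "valx A = v" "trail_lc A = b"
proof -
  have c: "coeff A i $ v \<noteq> 0" using has_lead_coeff[OF A] has_lead_nonzero[OF A] by simp
  have "finite {subdegree (coeff A l) | l. coeff A l \<noteq> 0}"
    by (rule finite_subset[of _ "(\<lambda>l. subdegree (coeff A l)) ` {..degree A}"]) (auto intro: le_degree)
  moreover have "subdegree (coeff A i) = v"
    by (rule subdegreeI[OF c]) (use has_lead_support(2)[OF A] in force)
  moreover have "v \<le> subdegree (coeff A l)" if "coeff A l \<noteq> 0" for l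
    using has_lead_support(2)[OF A, of l] that by auto
  ultimately show v: "valx A = v"
    unfolding valx_def using c by (intro Min_eqI) (auto intro!: exI[of _ i])
  have "(LEAST l. coeff A l $ v \<noteq> 0) = i"
    using c has_lead_support(1)[OF A] by (intro Least_equality) auto
  thus "trail_lc A = b" unfolding trail_lc_def v Let_def using has_lead_coeff[OF A] by simp
qed

text \<open>Once x^w0 is factored out, only the terms of weight exactly \<open>w0\<close> have a
  constant term left; \<open>ne\<close> is the requirement that these do not cancel.\<close>

lemma has_lead_sum:
  assumes J: "finite J" and T: "\<And>j. j \<in> J \<Longrightarrow> has_lead (A j) 0 (w j) (b j)"
    and w: "\<And>j. j \<in> J \<Longrightarrow> w0 \<le> w j"
    and ne: "(\<Sum>j\<in>{j\<in>J. w j = w0}. b j) \<noteq> 0"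
  shows "has_lead (\<Sum>j\<in>J. A j) 0 w0 (\<Sum>j\<in>{j\<in>J. w j = w0}. b j)"
proof -
  obtain u where u: "\<And>j. j \<in> J \<Longrightarrow> A j = monom (fps_X ^ w j) 0 * u j \<and> coeff (u j) 0 $ 0 = b j"
    using T unfolding has_lead_def by metis
  define U where "U = (\<Sum>j\<in>J. smult (fps_X ^ (w j - w0)) (u j))"
  have "(\<Sum>j\<in>J. A j) = monom (fps_X ^ w0) 0 * U"
    unfolding U_def sum_distrib_left
    by (rule sum.cong) (use u w in \<open>auto simp: monom_0 power_add[symmetric]\<close>)
  moreover have "coeff U 0 $ 0 = (\<Sum>j\<in>{j\<in>J. w j = w0}. b j)"
  proof -
    have "coeff U 0 $ 0 = (\<Sum>j\<in>J. if w j = w0 then b j else 0)"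
      unfolding U_def coeff_sum fps_sum_nth
    proof (rule sum.cong[OF refl])
      fix j assume j: "j \<in> J"
      show "coeff (smult (fps_X ^ (w j - w0)) (u j)) 0 $ 0 = (if w j = w0 then b j else 0)"
        using u[OF j] w[OF j] by (cases "w j = w0") (auto simp: fps_X_power_mult_nth)
    qed
    also have "\<dots> = (\<Sum>j\<in>{j\<in>J. w j = w0}. b j)" using J by (simp add: sum.inter_filter)
    finally show ?thesis .
  qed
  ultimately show ?thesis using ne unfolding has_lead_def by auto
qed

lemma has_lead_subs_tau:
  fixes c :: "'a::field fps"
  assumes A: "has_lead A 0 v b" and c: "c $ 0 = 0"
  shows "has_lead (subs A (tau_map c)) 0 v b"
proof -
  obtain u where u: "A = monom (fps_X ^ v) 0 * u" "coeff u 0 $ 0 = b"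
    using A by (auto simp: has_lead_def)
  have "subs A (tau_map c) = monom (fps_X ^ v) 0 * subs u (tau_map c)"
    unfolding u(1) by (simp add: monom_0 subs_smult tau_map_def)
  moreover have "coeff (subs u (tau_map c)) 0 $ 0 = b"
    using u(2) subs_tau_map_coeff_0[OF c] by metis
  ultimately show ?thesis using A by (auto simp: has_lead_def)
qed

text \<open>If \<open>m = 0\<close>, the substitution moves the origin, so the unit must be trivial.\<close>
lemma has_lead_subs_sigma:
  fixes A :: "'a::field fps poly"
  assumes A: "has_lead A i v b" and q: "q > 0" and z: "z \<noteq> 0" and s: "s \<ge> 0" and m: "m \<ge> 0"
    and or: "m > 0 \<or> A = monom (fps_X ^ v) i"
  shows "has_lead (subs A (sigma_map z t q m s)) 0 (q * v + nat m * i) (b * z ^ (t * v + nat s * i))"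
proof -
  obtain u :: "'a fps poly" where u: "A = monom (fps_X ^ v) i * u" "coeff u 0 $ 0 = b" "m > 0 \<or> u = 1"
  proof (cases "m > 0")
    case True
    thus ?thesis using that A by (auto simp: has_lead_def)
  next
    case False
    hence "A = monom (fps_X ^ v) i * 1" using or by simp
    moreover have "b = 1" using has_lead_coeff[OF A] or False by simp
    ultimately show ?thesis using that[of 1] by simp
  qed
  let ?S = "sigma_map z t q m s"
  have f0: "fst ?S $ 0 = 0" using q by (simp add: sigma_map_def)
  have uS: "coeff (subs u ?S) 0 $ 0 = b"
  proof (cases "u = 1")
    case False
    with u have "m > 0" by simp
    hence "coeff (snd ?S) 0 $ 0 = 0" by (simp add: sigma_map_def)
    from const_coeff_subs[OF this] u show ?thesis by simp
  qed (use u in simp)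
  have zs: "z powi s = z ^ nat s" using s by (simp add: power_int_def)
  \<comment> \<open>Since z^s is nonzero, y becomes x^m times a unit at the origin. A factor y^i is
    thus traded for x^(m i) and a power of \<open>z\<close>, and the y-exponent drops to 0.\<close>
  have y: "subs [:0, 1:] ?S = [:fps_X ^ nat m:] * [:fps_const (z ^ nat s), 1:]"
    by (simp add: subs_pCons sigma_map_def zs)
  have mm: "monom (fps_X ^ v) i = [:fps_X:] ^ v * [:0, 1:] ^ i"
    by (simp add: monom_altdef poly_const_pow)
  have e1: "(fps_const (z ^ t) * fps_X ^ q) ^ v = fps_const (z ^ (t * v)) * fps_X ^ (q * v)"
    by (simp add: power_mult_distrib power_mult fps_const_power)
  have "subs (monom (fps_X ^ v) i) ?S
      = [:(fps_const (z ^ t) * fps_X ^ q):] ^ v * ([:fps_X ^ nat m:] * [:fps_const (z ^ nat s), 1:]) ^ i"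
    unfolding mm subs_mult[OF f0] subs_power[OF f0] y using f0
    by (simp add: subs_const sigma_map_def)
  also have "\<dots> = [:fps_X ^ (q * v + nat m * i):] * ([:fps_const (z ^ (t * v)):] * [:fps_const (z ^ nat s), 1:] ^ i)"
    unfolding power_mult_distrib poly_const_pow e1
    by (simp add: power_mult[symmetric] power_add mult_ac)
  finally have e: "subs A ?S = monom (fps_X ^ (q * v + nat m * i)) 0 *
     ([:fps_const (z ^ (t * v)):] * [:fps_const (z ^ nat s), 1:] ^ i * subs u ?S)"
    unfolding u(1) subs_mult[OF f0] by (simp add: monom_0 mult_ac)
  have "coeff ([:fps_const (z ^ (t * v)):] * [:fps_const (z ^ nat s), 1:] ^ i * subs u ?S) 0 $ 0
     = z ^ (t * v) * (z ^ nat s) ^ i * b"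
    by (simp add: coeff_mult_0 uS coeff_0_power fps_const_power)
  also have "\<dots> = b * z ^ (t * v + nat s * i)"
    by (simp add: power_add power_mult)
  finally show ?thesis using e z has_lead_nonzero[OF A] unfolding has_lead_def
    by (intro conjI exI[of _ "[:fps_const (z ^ (t * v)):] * [:fps_const (z ^ nat s), 1:] ^ i * subs u ?S"]) auto
qed

section \<open>Linear dependence over a subring\<close>

text \<open>Gaussian elimination without division: a homogeneous system with more unknowns than
  equations, in which a nonzero pivot for equation \<open>j\<close> removes one of each.\<close>

lemma linear_dependence:
  fixes A :: "'i \<Rightarrow> 'j \<Rightarrow> 'b::idom"
  assumes S: "is_subring S" and J: "finite J" and I: "finite I" "card J < card I"
    and A: "\<And>i j. i \<in> I \<Longrightarrow> j \<in> J \<Longrightarrow> A i j \<in> S"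
  shows "\<exists>c. (\<forall>i\<in>I. c i \<in> S) \<and> (\<exists>i\<in>I. c i \<noteq> 0) \<and> (\<forall>j\<in>J. (\<Sum>i\<in>I. c i * A i j) = 0)"
  using J I A
proof (induction J arbitrary: I A rule: finite_induct)
  case empty
  then obtain i where "i \<in> I" by fastforce
  thus ?case by (intro exI[of _ "\<lambda>_. 1"]) (use S in \<open>auto intro: is_subringD\<close>)
next
  case (insert j J)
  show ?case
  proof (cases "\<exists>p\<in>I. A p j \<noteq> 0")
    case False
    have "card J < card I" using insert.prems insert.hyps by simp
    then obtain c where "\<forall>i\<in>I. c i \<in> S" "\<exists>i\<in>I. c i \<noteq> 0" "\<forall>j\<in>J. (\<Sum>i\<in>I. c i * A i j) = 0"
      using insert.IH[of I A] insert.prems by auto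
    with False show ?thesis by (intro exI[of _ c]) auto
  next
    case True
    then obtain p where p: "p \<in> I" "A p j \<noteq> 0" by blast
    define I' where "I' = I - {p}"
    define B where "B i l = A p j * A i l - A i j * A p l" for i l
    have I': "finite I'" "card J < card I'"
      using insert.prems(1,2) insert.hyps p(1) by (simp_all add: I'_def card_Diff_singleton)
    have "B i l \<in> S" if "i \<in> I'" "l \<in> J" for i l
      using that p insert.prems unfolding B_def I'_def
      by (intro is_subringD(4,6)[OF S]) auto
    then obtain c where c: "\<And>i. i \<in> I' \<Longrightarrow> c i \<in> S" "\<exists>i\<in>I'. c i \<noteq> 0"
      "\<And>l. l \<in> J \<Longrightarrow> (\<Sum>i\<in>I'. c i * B i l) = 0"
      using insert.IH[OF I', of B] by blast
    \<comment> \<open>The unknown of the pivot row is determined by equation \<open>j\<close>;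
      scaling all the others by the pivot \<open>A p j\<close> replaces the division by it.\<close>
    define c' where "c' i = (if i = p then - (\<Sum>i\<in>I'. c i * A i j) else c i * A p j)" for i
    have split: "(\<Sum>i\<in>I. c' i * A i l) = (\<Sum>i\<in>I'. c i * A p j * A i l) - (\<Sum>i\<in>I'. c i * A i j) * A p l" for l
    proof -
      have "(\<Sum>i\<in>I. c' i * A i l) = c' p * A p l + (\<Sum>i\<in>I'. c' i * A i l)"
        unfolding I'_def using p insert.prems(1) by (simp add: sum.remove)
      also have "(\<Sum>i\<in>I'. c' i * A i l) = (\<Sum>i\<in>I'. c i * A p j * A i l)"
        by (rule sum.cong) (auto simp: c'_def I'_def)
      finally show ?thesis by (simp add: c'_def)
    qed
    show ?thesis
    proof (intro exI[of _ c'] conjI ballI)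
      fix i assume i: "i \<in> I"
      have "(\<Sum>i\<in>I'. c i * A i j) \<in> S"
        using insert.prems by (intro subring_sum S is_subringD(4)[OF S] c) (auto simp: I'_def)
      moreover have "c i * A p j \<in> S" if "i \<noteq> p"
        using insert.prems i p that by (intro is_subringD(4)[OF S] c) (auto simp: I'_def)
      ultimately show "c' i \<in> S" unfolding c'_def using is_subringD(5)[OF S] by auto
    next
      show "\<exists>i\<in>I. c' i \<noteq> 0" using c(2) p by (auto simp: c'_def I'_def)
    next
      fix l assume l: "l \<in> insert j J"
      show "(\<Sum>i\<in>I. c' i * A i l) = 0"
      proof (cases "l = j")
        case True
        show ?thesis unfolding split True sum_distrib_right by (simp add: mult_ac)
      next
        case False
        hence "(\<Sum>i\<in>I'. c i * B i l) = 0" using c(3) l by blast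
        thus ?thesis unfolding split
          by (simp add: B_def algebra_simps sum_subtractf sum_distrib_left)
      qed
    qed
  qed
qed

text \<open>A power series over \<open>L\<close> is split by residues modulo \<open>e\<close>; hence \<open>L[[x]]\<close> is generated
  by the \<open>\<zeta>\<^sub>a x\<^sup>b\<close> over the image of \<open>K[[x]]\<close> under \<open>x \<mapsto> \<mu> x\<^sup>e\<close>.\<close>
lemma fps_over_generated:
  fixes L K :: "'a::field set"
  assumes L: "is_subfield L" and mu: "\<mu> \<in> L" "\<mu> \<noteq> 0" and e: "e > 0"
    and gen: "\<And>x. x \<in> L \<Longrightarrow> \<exists>\<kappa>. (\<forall>i<n. \<kappa> i \<in> K) \<and> x = (\<Sum>i<n. \<kappa> i * \<zeta> i)"
    and T: "T \<in> fps_over L"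
  shows "\<exists>g. (\<forall>i<n. \<forall>r<e. g (i, r) \<in> fps_over K) \<and>
    T = (\<Sum>(i, r)\<in>{..<n} \<times> {..<e}. fps_const (\<zeta> i) * fps_X ^ r * (g (i, r) oo (fps_const \<mu> * fps_X ^ e)))"
proof -
  have "\<forall>x\<in>L. \<exists>\<kappa>. (\<forall>i<n. \<kappa> i \<in> K) \<and> x = (\<Sum>i<n. \<kappa> i * \<zeta> i)" using gen by blast
  then obtain \<kappa> where k: "\<And>x i. x \<in> L \<Longrightarrow> i < n \<Longrightarrow> \<kappa> x i \<in> K" "\<And>x. x \<in> L \<Longrightarrow> x = (\<Sum>i<n. \<kappa> x i * \<zeta> i)"
    by metis
  \<comment> \<open>The coefficient of x^(e j + r) is divided by \<mu>^j because substituting \<mu>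
    x^e for x multiplies the j-th coefficient by \<mu>^j.\<close>
  define g where "g = (\<lambda>(i, r). Abs_fps (\<lambda>j. \<kappa> (T $ (e * j + r) / \<mu> ^ j) i))"
  have mem: "T $ l / \<mu> ^ j \<in> L" for l j
    by (intro subfield_divide[OF L] fps_overD[OF T] subring_power subfield_is_subring L mu)
  have gK: "g (i, r) \<in> fps_over K" if "i < n" for i r
    using that k(1)[OF mem] by (simp add: g_def fps_over_def)
  have "(\<Sum>(i, r)\<in>{..<n} \<times> {..<e}. fps_const (\<zeta> i) * fps_X ^ r * (g (i, r) oo (fps_const \<mu> * fps_X ^ e))) $ l = T $ l" for l
  proof -
    have inner: "(fps_const (\<zeta> i) * fps_X ^ r * (g (i, r) oo (fps_const \<mu> * fps_X ^ e))) $ l =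
        (if r = l mod e then \<zeta> i * \<kappa> (T $ l / \<mu> ^ (l div e)) i * \<mu> ^ (l div e) else 0)" if r: "r < e" for i r
    proof -
      have "(fps_const (\<zeta> i) * fps_X ^ r * (g (i, r) oo (fps_const \<mu> * fps_X ^ e))) $ l
        = (if l < r then 0 else \<zeta> i * ((g (i, r) oo (fps_const \<mu> * fps_X ^ e)) $ (l - r)))"
        by (simp add: mult.assoc fps_X_power_mult_nth)
      also have "\<dots> = (if r = l mod e then \<zeta> i * \<kappa> (T $ l / \<mu> ^ (l div e)) i * \<mu> ^ (l div e) else 0)"
      proof (cases "r = l mod e")
        case True
        hence "l - r = e * (l div e)" "r \<le> l" by (simp_all add: minus_mod_eq_mult_div)
        moreover have "\<not> l < l mod e" by (simp add: not_less)
        ultimately show ?thesis using e True by (auto simp: fps_compose_monomial_nth g_def)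
      next
        case False
        have "\<not> e dvd (l - r)" if "r \<le> l"
        proof
          assume "e dvd l - r"
          then obtain w where "l - r = e * w" by blast
          hence "l = e * w + r" using that by simp
          with r False show False by simp
        qed
        thus ?thesis using e False by (auto simp: fps_compose_monomial_nth)
      qed
      finally show ?thesis .
    qed
    have "(\<Sum>(i, r)\<in>{..<n} \<times> {..<e}. fps_const (\<zeta> i) * fps_X ^ r * (g (i, r) oo (fps_const \<mu> * fps_X ^ e))) $ l
      = (\<Sum>i<n. \<Sum>r<e. (fps_const (\<zeta> i) * fps_X ^ r * (g (i, r) oo (fps_const \<mu> * fps_X ^ e))) $ l)"
      by (simp add: fps_sum_nth sum.cartesian_product case_prod_unfold)
    also have "\<dots> = (\<Sum>i<n. \<Sum>r<e. if r = l mod e then \<zeta> i * \<kappa> (T $ l / \<mu> ^ (l div e)) i * \<mu> ^ (l div e) else 0)"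
      by (intro sum.cong refl inner) simp
    also have "\<dots> = (\<Sum>i<n. \<zeta> i * \<kappa> (T $ l / \<mu> ^ (l div e)) i * \<mu> ^ (l div e))"
      using e by (simp add: sum.delta')
    also have "\<dots> = (\<Sum>i<n. \<kappa> (T $ l / \<mu> ^ (l div e)) i * \<zeta> i) * \<mu> ^ (l div e)"
      by (simp add: sum_distrib_right sum_distrib_left mult_ac)
    also have "\<dots> = T $ l"
      using mu by (simp add: k(2)[OF mem, symmetric])
    finally show ?thesis .
  qed
  thus ?thesis using gK by (intro exI[of _ g]) (auto simp: fps_eq_iff)
qed

text \<open>The \<open>n * e + 1\<close> powers of \<open>T\<close> up to exponent
  \<open>n * e\<close> lie in a module with \<open>n * e\<close> generators over the image of
  K[[x]], so they satisfy a nontrivial relation, which is the polynomial sought.\<close>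

lemma annihilating_polynomial:
  fixes L K :: "'a::field set"
  assumes K: "is_subfield K" and L: "is_subfield L" and mu: "\<mu> \<in> L" "\<mu> \<noteq> 0" and e: "e > 0"
    and gen: "\<And>x. x \<in> L \<Longrightarrow> \<exists>\<kappa>. (\<forall>i<n. \<kappa> i \<in> K) \<and> x = (\<Sum>i<n. \<kappa> i * \<zeta> i)"
    and T: "T \<in> fps_over L"
  shows "\<exists>p\<in>poly_over (fps_over K). p \<noteq> 0 \<and> degree p \<le> n * e \<and>
    poly (map_poly (\<lambda>h. h oo (fps_const \<mu> * fps_X ^ e)) p) T = 0"
proof -
  let ?x = "fps_const \<mu> * fps_X ^ e"
  let ?J = "{..<n} \<times> {..<e}"
  have R: "is_subring (fps_over L)" by (intro is_subring_fps_over subfield_is_subring L)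
  have RK: "is_subring (fps_over K)" by (intro is_subring_fps_over subfield_is_subring K)
  have x0: "?x $ 0 = 0" using e by simp
  define good where "good i g \<longleftrightarrow> (\<forall>a<n. \<forall>r<e. g (a, r) \<in> fps_over K) \<and>
    T ^ i = (\<Sum>(a, r)\<in>?J. fps_const (\<zeta> a) * fps_X ^ r * (g (a, r) oo ?x))" for i g
  have "\<exists>g. good i g" for i
    unfolding good_def using fps_over_generated[OF L mu e gen subring_power[OF R T]] .
  then obtain g where "\<And>i. good i (g i)" by metis
  hence g: "\<And>i a r. a < n \<Longrightarrow> r < e \<Longrightarrow> g i (a, r) \<in> fps_over K"
    "\<And>i. T ^ i = (\<Sum>(a, r)\<in>?J. fps_const (\<zeta> a) * fps_X ^ r * (g i (a, r) oo ?x))"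
    unfolding good_def by blast+
  have "\<exists>c. (\<forall>i\<in>{..n * e}. c i \<in> fps_over K) \<and> (\<exists>i\<in>{..n * e}. c i \<noteq> 0) \<and>
     (\<forall>j\<in>?J. (\<Sum>i\<in>{..n * e}. c i * g i j) = 0)"
    by (rule linear_dependence[OF RK]) (auto simp: g)
  then obtain c where c: "\<And>i. i \<le> n * e \<Longrightarrow> c i \<in> fps_over K" "\<exists>i\<le>n * e. c i \<noteq> 0"
     "\<And>j. j \<in> ?J \<Longrightarrow> (\<Sum>i\<le>n * e. c i * g i j) = 0" by auto
  define p where "p = (\<Sum>i\<le>n * e. monom (c i) i)"
  have cp: "coeff p i = (if i \<le> n * e then c i else 0)" for i
    unfolding p_def by (simp add: coeff_sum)
  have pS: "p \<in> poly_over (fps_over K)"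
    using c(1) is_subringD(1)[OF RK] by (auto simp: poly_over_def cp)
  have p0: "p \<noteq> 0" using c(2) cp by (metis coeff_0)
  have dp: "degree p \<le> n * e" by (rule degree_le) (simp add: cp)
  have "poly (map_poly (\<lambda>h. h oo ?x) p) T = (\<Sum>i\<le>n * e. (c i oo ?x) * T ^ i)"
  proof -
    have "map_poly (\<lambda>h. h oo ?x) p = (\<Sum>i\<le>n * e. monom (c i oo ?x) i)"
      by (rule poly_eqI) (simp add: coeff_map_poly cp coeff_sum)
    thus ?thesis by (simp add: poly_sum poly_monom)
  qed
  also have "\<dots> = (\<Sum>i\<le>n * e. \<Sum>j\<in>?J. fps_const (\<zeta> (fst j)) * fps_X ^ snd j * ((c i * g i j) oo ?x))"
    by (subst g(2)) (simp add: sum_distrib_left fps_compose_mult_distrib[OF x0] case_prod_unfold mult_ac)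
  also have "\<dots> = (\<Sum>j\<in>?J. fps_const (\<zeta> (fst j)) * fps_X ^ snd j * ((\<Sum>i\<le>n * e. c i * g i j) oo ?x))"
    by (subst sum.swap) (simp add: sum_distrib_left fps_compose_sum_distrib)
  also have "\<dots> = 0"
    by (rule sum.neutral) (auto simp: c(3))
  finally show ?thesis using pS p0 dp by blast
qed

section \<open>Factorisations over power series\<close>

text \<open>A Gauss lemma for K[[x]][y]. As x is prime, the powers of x dividing \<open>h\<close>
  can be moved out of the two factors. The remaining scalar is a unit, so the factorisation becomes
  one of the monic \<phi> itself, and irreducibility leaves no room for a nonconstant
  cofactor.\<close>

lemma irreducible_in_degree:
  fixes K :: "'a::field set"
  assumes K: "is_subfield K" and irr: "irreducible_in (poly_over (fps_over K)) \<phi>" and mon: "lead_coeff \<phi> = 1"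
    and psi: "\<psi> \<in> poly_over (fps_over K)" "\<psi> \<noteq> 0" "degree \<psi> > 0"
    and dvd: "smult h \<phi> = \<psi> * Q" "h \<noteq> 0" "Q \<in> poly_over (fps_over K)"
  shows "degree \<phi> = degree \<psi>"
proof -
  let ?R = "poly_over (fps_over K)"
  note S = subfield_is_subring[OF K]
  have shiftR: "\<exists>p'\<in>?R. p = smult fps_X p'" if p: "p \<in> ?R" and 0: "\<And>i. coeff p i $ 0 = 0" for p
  proof
    show "map_poly (fps_shift 1) p \<in> ?R"
      using p by (auto simp: poly_over_def fps_over_def coeff_map_poly)
    show "p = smult fps_X (map_poly (fps_shift 1) p)"
      using 0 by (auto simp: poly_eq_iff coeff_map_poly fps_eq_iff split: nat.splits)
  qed
  have gauss: "\<exists>u \<psi>' Q'. u $ 0 \<noteq> 0 \<and> \<psi>' \<in> ?R \<and> Q' \<in> ?R \<and> degree \<psi>' = degree \<psi> \<and> smult u \<phi> = \<psi>' * Q'"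
    using psi dvd
  proof (induction "subdegree h" arbitrary: h \<psi> Q)
    case 0
    hence "h $ 0 \<noteq> 0" by (metis nth_subdegree_nonzero)
    with 0 show ?case by blast
  next
    case (Suc n)
    have h0: "h $ 0 = 0" using Suc.hyps(2) by (intro nth_less_subdegree_zero) simp
    define h' where "h' = fps_shift 1 h"
    have h': "h = fps_X * h'" using h0 by (auto simp: h'_def fps_eq_iff)
    have "n = subdegree h'" using Suc.hyps(2) by (simp add: h'_def)
    have h'0: "h' \<noteq> 0" using Suc.prems h' by auto
    \<comment> \<open>Reduction modulo x: the product reduces to 0 in an integral domain, so one of
      the two factors is divisible by x.\<close>
    define red where "red = map_poly (\<lambda>f::'a fps. f $ 0)"
    have "red (\<psi> * Q) = red \<psi> * red Q"
      by (rule poly_eqI) (simp add: red_def coeff_map_poly coeff_mult fps_sum_nth)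
    moreover have "red (\<psi> * Q) = 0"
      unfolding Suc.prems(4)[symmetric] by (rule poly_eqI) (simp add: red_def coeff_map_poly h0)
    ultimately have "red \<psi> = 0 \<or> red Q = 0" by simp
    hence *: "(\<forall>i. coeff \<psi> i $ 0 = 0) \<or> (\<forall>i. coeff Q i $ 0 = 0)"
      by (auto simp: red_def poly_eq_iff coeff_map_poly)
    show ?case
    proof (cases "\<forall>i. coeff \<psi> i $ 0 = 0")
      case True
      then obtain p' where p': "p' \<in> ?R" "\<psi> = smult fps_X p'" using shiftR[OF Suc.prems(1)] by blast
      have "smult fps_X (smult h' \<phi>) = smult fps_X (p' * Q)"
        using Suc.prems(4) by (simp add: h' p'(2))
      hence "smult h' \<phi> = p' * Q" by (simp add: poly_eq_iff)
      with Suc.hyps(1)[OF \<open>n = _\<close> p'(1) _ _ _ h'0 Suc.prems(6)] Suc.prems p'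
      show ?thesis by auto
    next
      case False
      with * have "\<And>i. coeff Q i $ 0 = 0" by blast
      then obtain p' where p': "p' \<in> ?R" "Q = smult fps_X p'" using shiftR[OF Suc.prems(6)] by blast
      have "smult fps_X (smult h' \<phi>) = smult fps_X (\<psi> * p')"
        using Suc.prems(4) by (simp add: h' p'(2))
      hence "smult h' \<phi> = \<psi> * p'" by (simp add: poly_eq_iff)
      with Suc.hyps(1)[OF \<open>n = _\<close> Suc.prems(1-3) _ h'0 p'(1)]
      show ?thesis by auto
    qed
  qed
  then obtain u \<psi>' Q' where *: "u $ 0 \<noteq> 0" "\<psi>' \<in> ?R" "Q' \<in> ?R" "degree \<psi>' = degree \<psi>" "smult u \<phi> = \<psi>' * Q'"
    by blast
  have ui: "inverse u * u = 1" using *(1) by (rule inverse_mult_eq_1)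
  have "lead_coeff \<psi>' * lead_coeff Q' = u"
    using *(5) mon by (metis lead_coeff_mult lead_coeff_smult mult.right_neutral)
  have "\<phi> = smult (inverse u) (smult u \<phi>)" by (simp add: ui)
  also have "\<dots> = \<psi>' * smult (inverse u) Q'" by (simp add: *(5))
  finally have fac: "\<phi> = \<psi>' * smult (inverse u) Q'" .
  \<comment> \<open>The leading coefficients of the two factors multiply to a unit. Shifting the one
    of \<psi>' to the cofactor makes the first factor monic.\<close>
  define c where "c = lead_coeff \<psi>'"
  define c' where "c' = inverse u * lead_coeff Q'"
  have cc: "c * c' = 1" using \<open>_ = u\<close> ui by (simp add: c_def c'_def mult_ac)
  have sc: "smult c' \<psi>' * smult c X = \<psi>' * X" for X
    using cc by (simp add: mult.commute)
  have cK: "c \<in> fps_over K" unfolding c_def by (rule poly_overD[OF *(2)])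
  have c0: "c $ 0 \<noteq> 0" using cc by (metis fps_mult_nth_0 fps_one_nth mult_zero_left zero_neq_one)
  \<comment> \<open>The recursion for the inverse of a power series divides only by the constant
    term \<open>c $ 0\<close>, an element of \<open>K\<close>.\<close>
  have "c' \<in> fps_over K"
  proof -
    have "c' $ i \<in> K" for i
    proof (induction i rule: less_induct)
      case (less i)
      have "(if i = 0 then 1 else 0) = (\<Sum>j\<le>i. c $ j * c' $ (i - j))"
        using arg_cong[OF cc, of "\<lambda>x. x $ i"] by (simp add: fps_mult_nth atLeast0AtMost)
      also have "\<dots> = c $ 0 * c' $ i + (\<Sum>j\<in>{..i} - {0}. c $ j * c' $ (i - j))"
        by (subst sum.remove[of _ 0]) auto
      finally have "c' $ i = inverse (c $ 0) * ((if i = 0 then 1 else 0) - (\<Sum>j\<in>{..i} - {0}. c $ j * c' $ (i - j)))"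
        using c0 by (simp add: field_simps)
      also have "\<dots> \<in> K"
        using S cK less by (intro is_subringD(4,6)[OF S] subfield_inverse[OF K] subring_sum fps_overD[OF cK])
          (auto intro: is_subringD)
      finally show ?case .
    qed
    thus ?thesis by (simp add: fps_over_def)
  qed
  have RR: "is_subring ?R" by (intro is_subring_poly_over is_subring_fps_over S)
  \<comment> \<open>The cofactor was formed with \<open>inverse u\<close>. It lies over
    \<open>K\<close> because it agrees with the quotient of \<phi> by a monic polynomial over
    \<open>K\<close>, and such a quotient is unique.\<close>
  have q'': "smult c (smult (inverse u) Q') \<in> ?R"
  proof -
    have "c' \<noteq> 0" using cc by (metis mult_zero_right zero_neq_one)
    hence m: "lead_coeff (smult c' \<psi>') = 1" using cc by (simp add: c_def mult_ac)
    have cR: "smult c' \<psi>' \<in> ?R" by (intro smult_poly_over is_subring_fps_over S \<open>c' \<in> _\<close> *(2))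
    have phiR: "\<phi> \<in> ?R" using irr by (simp add: irreducible_in_def)
    have "\<phi> = smult c' \<psi>' * smult c (smult (inverse u) Q')"
      unfolding sc by (rule fac)
    moreover obtain Q2 r2 where q2: "Q2 \<in> ?R" "r2 \<in> ?R" "\<phi> = smult c' \<psi>' * Q2 + r2" "r2 = 0 \<or> degree r2 < degree (smult c' \<psi>')"
      using monic_division_over[OF is_subring_fps_over[OF S] cR m phiR] by blast
    ultimately have "smult c' \<psi>' * (smult c (smult (inverse u) Q') - Q2) = r2"
      by (simp add: algebra_simps)
    moreover have "smult c' \<psi>' \<noteq> 0" using m by auto
    ultimately have "smult c (smult (inverse u) Q') - Q2 = 0"
      using q2(4) by (metis add.commute degree_mult_eq le_add2 leD mult_eq_0_iff)
    thus ?thesis using q2(1) by simp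
  qed
  define \<psi>1 where "\<psi>1 = smult c' \<psi>'"
  define Q1 where "Q1 = smult c (smult (inverse u) Q')"
  have f1: "\<phi> = \<psi>1 * Q1" unfolding \<psi>1_def Q1_def
    unfolding sc by (rule fac)
  have \<psi>1R: "\<psi>1 \<in> ?R" unfolding \<psi>1_def by (intro smult_poly_over is_subring_fps_over S \<open>c' \<in> _\<close> *(2))
  have "c' \<noteq> 0" using cc by (metis mult_zero_right zero_neq_one)
  hence d1: "degree \<psi>1 = degree \<psi>" by (simp add: \<psi>1_def *(4))
  have unit_deg: "degree A = 0" if un: "unit_in ?R A" for A
  proof -
    obtain B where B: "A * B = 1" using un by (auto simp: unit_in_def)
    hence "degree A + degree B = 0" by (metis degree_1 degree_mult_eq mult_eq_0_iff zero_neq_one)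
    thus ?thesis by simp
  qed
  have "unit_in ?R \<psi>1 \<or> unit_in ?R Q1"
    using irr f1 \<psi>1R q'' unfolding irreducible_in_def Q1_def by blast
  with unit_deg psi d1 have "degree Q1 = 0" by auto
  moreover have "\<phi> \<noteq> 0" using mon by auto
  ultimately show ?thesis using f1 d1 by (metis add.right_neutral degree_mult_eq mult_eq_0_iff)
qed

text \<open>Weierstrass division determines the coefficients of \<open>G\<close> recursively, without leaving \<open>L\<close>.\<close>
lemma weierstrass_over:
  fixes L :: "'a::field set"
  assumes L: "is_subfield L" and A: "U * G \<in> poly_over (fps_over L)" and U: "coeff U 0 $ 0 \<noteq> 0"
    and G: "weierstrass G N"
  shows "G \<in> poly_over (fps_over L)"
proof -
  note S = subfield_is_subring[OF L]
  have deg: "degree G = N" and lc: "coeff G N = 1" and low: "\<And>i. i < N \<Longrightarrow> coeff G i $ 0 = 0"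
    using G by (auto simp: weierstrass_def)
  have Ac: "coeff (U * G) i $ n = (\<Sum>l\<le>i. \<Sum>p\<le>n. coeff U (i - l) $ (n - p) * coeff G l $ p)" for i n
  proof -
    have "coeff (U * G) i $ n = (\<Sum>l\<le>i. (coeff G l * coeff U (i - l)) $ n)"
      by (simp add: coeff_mult fps_sum_nth mult.commute[of U])
    thus ?thesis by (simp add: fps_mult_nth atLeast0AtMost mult.commute)
  qed
  have AL: "coeff (U * G) i $ n \<in> L" for i n
    using A by (simp add: poly_over_def fps_over_def)
  \<comment> \<open>Modulo x a Weierstrass polynomial is y^N; this is what makes the linear
    relations below triangular.\<close>
  have G0: "coeff G l $ 0 = (if l = N then 1 else 0)" for l
    using low[of l] lc deg by (cases l N rule: linorder_cases) (auto simp: coeff_eq_0)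
  have main: "(\<forall>i. coeff U i $ n \<in> L) \<and> (\<forall>i. coeff G i $ n \<in> L)" for n
  proof (induction n rule: less_induct)
    case (less n)
    note IH = less.IH
    have GL: "coeff G i $ n \<in> L" for i
    proof (cases "n = 0")
      case True
      thus ?thesis using S by (auto simp: G0 intro: is_subringD)
    next
      case n: False
      show ?thesis
      proof (induction i rule: less_induct)
        case (less i)
        show ?case
        proof (cases "i < N")
          case False
          hence "coeff G i = (if i = N then 1 else 0)" using lc deg by (auto simp: coeff_eq_0)
          thus ?thesis using S n by (auto intro: is_subringD)
        next
          case True
          \<comment> \<open>For \<open>i < N\<close> the pair (i, n) contributes
            \<open>coeff U 0 $ 0\<close> times the wanted coefficient. Pairs with
            \<open>p = 0\<close> vanish because \<open>l < N\<close>; all others involve lower order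
            in x, or the same order and a smaller power of y.\<close>
          define R where "R = (\<Sum>(l, p)\<in>{..i} \<times> {..n} - {(i, n)}. coeff U (i - l) $ (n - p) * coeff G l $ p)"
          have "coeff (U * G) i $ n = (\<Sum>(l, p)\<in>{..i} \<times> {..n}. coeff U (i - l) $ (n - p) * coeff G l $ p)"
            unfolding Ac by (simp add: sum.cartesian_product)
          also have "\<dots> = coeff U 0 $ 0 * coeff G i $ n + R"
            unfolding R_def by (subst sum.remove[of _ "(i, n)"]) auto
          finally have "coeff G i $ n = inverse (coeff U 0 $ 0) * (coeff (U * G) i $ n - R)"
            using U by (simp add: field_simps)
          moreover have U0: "coeff U j $ 0 \<in> L" for j using IH n by blast
          have "R \<in> L" unfolding R_def
          proof (intro subring_sum S)
            fix lp assume "lp \<in> {..i} \<times> {..n} - {(i, n)}"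
            then obtain l p where lp: "l \<in> {..i}" "p \<in> {..n}" "(l, p) \<noteq> (i, n)" and lp': "lp = (l, p)"
              by (cases lp) auto
            have "coeff U (i - l) $ (n - p) * coeff G l $ p \<in> L"
            proof (cases "p = 0")
              case True
              hence "coeff G l $ p = 0" using \<open>i < N\<close> lp by (simp add: G0)
              thus ?thesis using is_subringD(1)[OF S] by simp
            next
              case p: False
              have 1: "coeff U (i - l) $ (n - p) \<in> L" using IH[of "n - p"] p n by auto
              have 2: "coeff G l $ p \<in> L"
                using IH[of p] less.IH[of l] lp by (cases "p = n") auto
              show ?thesis using is_subringD(4)[OF S 1 2] .
            qed
            thus "(case lp of (l, p) \<Rightarrow> coeff U (i - l) $ (n - p) * coeff G l $ p) \<in> L"
              by (simp add: lp')
          qed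
          ultimately show ?thesis
            using is_subringD(4,6)[OF S] subfield_inverse[OF L] U0 AL by metis
        qed
      qed
    qed
    have UL: "coeff U i $ n \<in> L" for i
    proof -
      \<comment> \<open>Multiplying by G raises the y-degree by N modulo x, so the coefficient of
        y^(i + N) x^n isolates the coefficient of \<open>U\<close> at (i, n).\<close>
      define R where "R = (\<Sum>(l, p)\<in>{..i + N} \<times> {..n} - {(N, 0)}. coeff U (i + N - l) $ (n - p) * coeff G l $ p)"
      have "coeff (U * G) (i + N) $ n = (\<Sum>(l, p)\<in>{..i + N} \<times> {..n}. coeff U (i + N - l) $ (n - p) * coeff G l $ p)"
        unfolding Ac by (simp add: sum.cartesian_product)
      also have "\<dots> = coeff U i $ n + R"
        unfolding R_def by (subst sum.remove[of _ "(N, 0)"]) (auto simp: G0)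
      finally have "coeff U i $ n = coeff (U * G) (i + N) $ n - R" by simp
      moreover have "R \<in> L" unfolding R_def
      proof (intro subring_sum S)
        fix lp assume "lp \<in> {..i + N} \<times> {..n} - {(N, 0)}"
        then obtain l p where lp: "l \<in> {..i + N}" "p \<in> {..n}" "(l, p) \<noteq> (N, 0)" and lp': "lp = (l, p)"
          by (cases lp) auto
        have "coeff U (i + N - l) $ (n - p) * coeff G l $ p \<in> L"
        proof (cases "p = 0")
          case True
          hence "coeff G l $ p = 0" using lp by (simp add: G0)
          thus ?thesis using is_subringD(1)[OF S] by simp
        next
          case p: False
          have 1: "coeff U (i + N - l) $ (n - p) \<in> L" 
            using less.IH[of "n - p"] p lp by auto
          have 2: "coeff G l $ p \<in> L" using less.IH[of p] GL lp by (cases "p = n") auto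
          show ?thesis using is_subringD(4)[OF S 1 2] .
        qed
        thus "(case lp of (l, p) \<Rightarrow> coeff U (i + N - l) $ (n - p) * coeff G l $ p) \<in> L"
          by (simp add: lp')
      qed
      ultimately show ?thesis using is_subringD(6)[OF S] AL by metis
    qed
    show ?case using GL UL by blast
  qed
  thus ?thesis by (simp add: poly_over_def fps_over_def)
qed

section \<open>Newton polygons\<close>

lemma finite_np_points: "finite (np_points H)"
  unfolding np_points_def
  by (rule finite_subset[of _ "(\<lambda>i. (real i, real (subdegree (coeff H i)))) ` {..degree H}"])
    (auto intro: le_degree)

lemma convex_hull_halfplane:
  fixes S :: "(real \<times> real) set"
  assumes "\<And>p. p \<in> S \<Longrightarrow> b \<le> snd p + r * fst p" and "p \<in> convex hull S"
  shows "b \<le> snd p + r * fst p"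
proof -
  have "convex {p :: real \<times> real. b \<le> snd p + r * fst p}"
    using convex_halfspace_ge[of b "(r, 1) :: real \<times> real"] by (simp add: inner_prod_def add.commute)
  hence "convex hull S \<subseteq> {p. b \<le> snd p + r * fst p}"
    using assms(1) by (intro hull_minimal) auto
  thus ?thesis using assms(2) by auto
qed

lemma newton_polygon_le:
  "p \<in> newton_polygon H \<Longrightarrow> coeff H i \<noteq> 0 \<Longrightarrow> fst p = real i \<Longrightarrow> snd p \<le> real (subdegree (coeff H i))"
proof -
  assume p: "p \<in> newton_polygon H" "coeff H i \<noteq> 0" "fst p = real i"
  have "(real i, real (subdegree (coeff H i))) \<in> convex hull (np_points H)"
    using p(2) by (intro hull_inc) (auto simp: np_points_def)
  thus ?thesis using p unfolding newton_polygon_def by fastforce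
qed

text \<open>To the left of (N, 0) every point has height at least 1, so from any polygon point of
  abscissa below N the polygon descends further. The least slope towards the points on the right is
  negative and, by convexity, supports the points on the left as well.\<close>

lemma weierstrass_supporting_line:
  fixes H :: "'a::field fps poly"
  assumes H: "weierstrass H N" and N: "N > 0" and p: "p \<in> newton_polygon H"
  shows "\<exists>r>0. \<forall>i. coeff H i \<noteq> 0 \<longrightarrow> snd p + r * fst p \<le> real (subdegree (coeff H i)) + r * real i"
proof -
  have deg: "degree H = N" and lc: "coeff H N = 1" and low: "\<And>i. i < N \<Longrightarrow> coeff H i $ 0 = 0"
    using H by (auto simp: weierstrass_def)
  define a where "a i = subdegree (coeff H i)" for i
  define S where "S = np_points H"
  have S: "S = {(real i, real (a i)) | i. coeff H i \<noteq> 0}" by (simp add: S_def np_points_def a_def)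
  have aN: "a N = 0" by (simp add: a_def lc)
  have a1: "a i \<ge> 1" if "i < N" "coeff H i \<noteq> 0" for i
  proof -
    have "a i \<noteq> 0" using low[OF that(1)] that(2) by (simp add: a_def subdegree_eq_0_iff)
    thus ?thesis by simp
  qed
  have iN: "i \<le> N" if "coeff H i \<noteq> 0" for i using that deg le_degree by metis
  have NS: "(real N, 0) \<in> S" unfolding S using aN lc by (auto intro!: exI[of _ N])
  have ph: "p \<in> convex hull S" and pmin: "\<And>p'. p' \<in> convex hull S \<Longrightarrow> fst p' = fst p \<Longrightarrow> snd p \<le> snd p'"
    using p by (auto simp: newton_polygon_def S_def)
  \<comment> \<open>This is the line through (0, 1) and (N, 0). It serves directly when the point is
    (N, 0), and otherwise shows that the point has positive height.\<close>
  have hull1: "1 \<le> snd p' + (1 / real N) * fst p'" if "p' \<in> convex hull S" for p'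
  proof (rule convex_hull_halfplane[OF _ that])
    fix x assume "x \<in> S"
    then obtain i where i: "x = (real i, real (a i))" "coeff H i \<noteq> 0" unfolding S by auto
    show "1 \<le> snd x + 1 / real N * fst x"
    proof (cases "i < N")
      case True
      hence "1 \<le> real (a i)" using a1 i by simp
      thus ?thesis using i by (simp add: add_increasing2)
    next
      case False
      hence "i = N" using iN i by force
      thus ?thesis using i N by simp
    qed
  qed
  have hullN: "fst p' \<le> real N" if "p' \<in> convex hull S" for p'
  proof -
    have "convex {x :: real \<times> real. fst x \<le> real N}"
      using convex_halfspace_le[of "(1, 0) :: real \<times> real" "real N"] by (simp add: inner_prod_def)
    hence "convex hull S \<subseteq> {x. fst x \<le> real N}"
      using iN by (intro hull_minimal) (auto simp: S)
    thus ?thesis using that by auto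
  qed
  show ?thesis
  proof (cases "fst p = real N")
    case True
    hence "snd p \<le> 0" using pmin[of "(real N, 0)"] NS by (simp add: hull_inc)
    have "snd p + (1 / real N) * fst p \<le> real (a i) + (1 / real N) * real i" if "coeff H i \<noteq> 0" for i
    proof -
      have "snd p + (1 / real N) * fst p \<le> 1" using True N \<open>snd p \<le> 0\<close> by simp
      also have "1 \<le> real (a i) + (1 / real N) * real i"
        using hull1[of "(real i, real (a i))"] that by (auto simp: S intro: hull_inc)
      finally show ?thesis .
    qed
    thus ?thesis using N by (intro exI[of _ "1 / real N"]) (simp add: a_def)
  next
    case False
    with hullN[OF ph] have lt: "fst p < real N" by simp
    define Rt where "Rt = {x \<in> S. fst p < fst x}"
    define sl where "sl x = (snd x - snd p) / (fst x - fst p)" for x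
    have "finite Rt" unfolding Rt_def S_def by (simp add: finite_np_points)
    moreover have NR: "(real N, 0) \<in> Rt" using NS lt by (simp add: Rt_def)
    ultimately obtain x1 where x1: "x1 \<in> Rt" and xmin: "\<And>x. x \<in> Rt \<Longrightarrow> sl x1 \<le> sl x"
      using arg_min_if_finite[of Rt sl] by (metis emptyE not_less)
    have "sl x1 \<le> sl (real N, 0)" using xmin NR by blast
    moreover have "snd p > 0"
    proof -
      have "1 / real N * fst p < 1" using lt N by simp
      thus ?thesis using hull1[OF ph] by linarith
    qed
    ultimately have neg: "sl x1 < 0" using lt by (simp add: sl_def divide_neg_pos order_le_less_trans)
    have gt1: "fst p < fst x1" using x1 by (simp add: Rt_def)
    have line: "snd p + sl x1 * (fst x - fst p) \<le> snd x" if x: "x \<in> S" for x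
    proof (cases "fst x" "fst p" rule: linorder_cases)
      case greater
      hence "sl x1 \<le> sl x" using xmin x by (simp add: Rt_def)
      thus ?thesis using greater by (simp add: sl_def pos_le_divide_eq)
    next
      case equal
      thus ?thesis using pmin[of x] x by (simp add: hull_inc)
    next
      case less
      define u where "u = fst x1 - fst p"
      define w where "w = fst p - fst x"
      define D where "D = u + w"
      have pos: "u > 0" "w > 0" "D > 0" using less gt1 by (simp_all add: D_def u_def w_def)
      have t: "0 \<le> u / D" "0 \<le> w / D" "u / D + w / D = 1"
        using pos by (simp_all add: D_def flip: add_divide_distrib)
      \<comment> \<open>The weights are chosen so that this point of the hull has the abscissa of
        \<open>p\<close>; were \<open>x\<close> below the line, it would lie below
        \<open>p\<close>.\<close>
      have "(u / D) *\<^sub>R x + (w / D) *\<^sub>R x1 \<in> convex hull S"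
        using x x1 t by (intro convexD[OF convex_convex_hull]) (auto simp: hull_inc Rt_def)
      moreover have "fst ((u / D) *\<^sub>R x + (w / D) *\<^sub>R x1) = fst p"
      proof -
        have "u * fst x + w * fst x1 = D * fst p" by (simp add: u_def w_def D_def algebra_simps)
        thus ?thesis using pos by (simp add: add_divide_distrib[symmetric])
      qed
      ultimately have "snd p \<le> snd ((u / D) *\<^sub>R x + (w / D) *\<^sub>R x1)" by (rule pmin)
      hence "snd p \<le> (u * snd x + w * snd x1) / D" by (simp add: add_divide_distrib)
      hence "snd p * (u + w) \<le> u * snd x + w * snd x1"
        using pos by (simp add: pos_le_divide_eq D_def)
      hence "snd p * u - w * (snd x1 - snd p) \<le> u * snd x"
        by (simp add: algebra_simps)
      hence "(snd p * u - w * (snd x1 - snd p)) / u \<le> snd x"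
        using pos by (simp add: pos_divide_le_eq mult.commute)
      hence "snd p - w * ((snd x1 - snd p) / u) \<le> snd x"
        using pos by (simp add: diff_divide_distrib right_diff_distrib)
      moreover have "fst x - fst p = - w" "fst x1 - fst p = u" by (simp_all add: w_def u_def)
      ultimately show ?thesis by (simp add: sl_def mult.commute)
    qed
    show ?thesis
    proof (intro exI[of _ "- sl x1"] conjI allI impI)
      show "0 < - sl x1" using neg by simp
    next
      fix i assume "coeff H i \<noteq> 0"
      hence "(real i, real (a i)) \<in> S" by (auto simp: S)
      from line[OF this] show "snd p + - sl x1 * fst p \<le> real (subdegree (coeff H i)) + - sl x1 * real i"
        by (simp add: a_def algebra_simps)
    qed
  qed
qed

lemma coeff_boundary_poly:
  "coeff (boundary_poly E H) i $ j = (if i \<le> degree H \<and> (real i, real j) \<in> E then coeff H i $ j else 0)"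
  unfolding boundary_poly_def by (auto simp: coeff_sum)

lemma closed_segment_slope:
  fixes p1 p2 :: "real \<times> real"
  assumes "x \<in> closed_segment p1 p2" "y \<in> closed_segment p1 p2" "fst p1 < fst p2"
    and "(snd p2 - snd p1) / (fst p2 - fst p1) = k"
  shows "snd y - snd x = k * (fst y - fst x)"
proof -
  obtain u v where u: "x = (1 - u) *\<^sub>R p1 + u *\<^sub>R p2" "y = (1 - v) *\<^sub>R p1 + v *\<^sub>R p2"
    using assms(1,2) unfolding closed_segment_def by auto
  have k: "snd p2 - snd p1 = k * (fst p2 - fst p1)" using assms(3,4) by (auto simp: field_simps)
  have "snd y - snd x = (v - u) * (snd p2 - snd p1)" unfolding u by (simp add: algebra_simps)
  also have "\<dots> = k * ((v - u) * (fst p2 - fst p1))" by (simp add: k)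
  also have "(v - u) * (fst p2 - fst p1) = fst y - fst x" unfolding u by (simp add: algebra_simps)
  finally show ?thesis .
qed

lemma degree_edge_poly:
  fixes P :: "'a::field poly"
  assumes q: "q > 0" and P: "lead_coeff P = 1"
  shows "degree (edge_poly q m P) = q * degree P" "edge_poly q m P \<noteq> 0"
proof -
  have c: "coeff (edge_poly q m P) (q * degree P) \<noteq> 0"
  proof -
    let ?x = "\<lambda>j. fps_const (coeff P j) * fps_X ^ nat (if m \<ge> 0 then m * int (degree P - j) else - m * int j)"
    have "coeff (edge_poly q m P) (q * degree P) = (\<Sum>j\<le>degree P. if j = degree P then ?x j else 0)"
      unfolding edge_poly_def coeff_sum coeff_monom using q by (intro sum.cong) auto
    also have "\<dots> = ?x (degree P)" by simp
    finally show ?thesis using P by simp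
  qed
  show "edge_poly q m P \<noteq> 0" using c by auto
  have "degree (edge_poly q m P) \<le> q * degree P"
    unfolding edge_poly_def by (rule degree_sum_le) (auto intro: order_trans[OF degree_monom_le])
  with le_degree[OF c] show "degree (edge_poly q m P) = q * degree P" by simp
qed

text \<open>A monic \<open>H\<close> has (N, 0) on its polygon. Comparing the single slope of
  \<open>E\<close> with that of the last segment ending there gives the sign of \<open>m\<close>;
  comparing degrees of the boundary polynomial gives \<open>N\<close>. A second boundary point
  excludes P = y, the only monic irreducible polynomial with root 0.\<close>

lemma degenerate_monic:
  fixes H :: "'a::field fps poly"
  assumes deg: "degree H = N" and lc: "lead_coeff H = 1"
    and E: "E = newton_polygon H \<or> (E = principal_polygon H \<and> weierstrass H N)"
    and dg: "degenerate E L H q m P N'"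
  shows "m \<ge> 0" "weierstrass H N \<Longrightarrow> m > 0" "N = q * degree P * N'" "poly P 0 \<noteq> 0"
proof -
  have q: "q > 0" and st: "straight_of_slope E q m" and Pl: "lead_coeff P = 1" and irr: "irred_over L P"
    using dg by (auto simp: degenerate_def)
  obtain c where c: "c \<noteq> 0" "boundary_poly E H = [:fps_const c:] * edge_poly q m P ^ N'"
    using dg by (auto simp: degenerate_def)
  obtain p1 p2 where p12: "E = closed_segment p1 p2" "fst p1 < fst p2"
    "(snd p2 - snd p1) / (fst p2 - fst p1) = - (real_of_int m / real q)"
    using st by (auto simp: straight_of_slope_def)
  define a where "a i = subdegree (coeff H i)" for i
  define S where "S = np_points H"
  have S: "S = {(real i, real (a i)) | i. coeff H i \<noteq> 0}" by (simp add: S_def np_points_def a_def)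
  have cN: "coeff H N = 1" using lc deg by simp
  hence aN: "a N = 0" by (simp add: a_def)
  have iN: "i \<le> N" if "coeff H i \<noteq> 0" for i using that deg le_degree by metis
  have NS: "(real N, 0) \<in> S" unfolding S using aN cN by (auto intro!: exI[of _ N])
  have "E \<subseteq> newton_polygon H" using E by (auto simp: principal_polygon_def)
  hence ES: "E \<subseteq> convex hull S" by (auto simp: newton_polygon_def S_def)
  define I where "I = {i. i < N \<and> coeff H i \<noteq> 0}"
  have "I \<noteq> {}"
  proof
    assume "I = {}"
    have "coeff H i \<noteq> 0 \<longleftrightarrow> i = N" for i
    proof
      assume c: "coeff H i \<noteq> 0"
      have "i \<notin> I" using \<open>I = {}\<close> by simp
      with c have "\<not> i < N" by (simp add: I_def)
      with iN[OF c] show "i = N" by simp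
    qed (use cN in simp)
    hence "S = {(real N, 0)}" unfolding S by (simp add: aN)
    hence "convex hull S = {(real N, 0)}" by simp
    moreover have "p1 \<in> E" "p2 \<in> E" by (simp_all add: p12(1))
    ultimately have "p1 = p2" using ES by auto
    with p12(2) show False by simp
  qed
  \<comment> \<open>The least ratio belongs to the last edge, since slopes increase along a lower
    convex hull.\<close>
  define i1 where "i1 = arg_min_on (\<lambda>i. real (a i) / (real N - real i)) I"
  have finI: "finite I" by (simp add: I_def)
  have i1: "i1 \<in> I" unfolding i1_def by (rule arg_min_if_finite(1)[OF finI \<open>I \<noteq> {}\<close>])
  have imin: "real (a i1) / (real N - real i1) \<le> real (a i) / (real N - real i)" if "i \<in> I" for i
    using arg_min_if_finite(2)[OF finI \<open>I \<noteq> {}\<close>] that unfolding i1_def by (meson not_less)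
  define r where "r = real (a i1) / (real N - real i1)"
  have r0: "r \<ge> 0" using i1 by (auto simp: r_def I_def)
  have i1N: "i1 < N" and c1: "coeff H i1 \<noteq> 0" using i1 by (auto simp: I_def)
  have r1: "real (a i1) = r * (real N - real i1)" using i1N by (simp add: r_def)
  have half: "r * real N \<le> snd x + r * fst x" if "x \<in> convex hull S" for x
  proof (rule convex_hull_halfplane[OF _ that])
    fix x assume "x \<in> S"
    then obtain i where i: "x = (real i, real (a i))" "coeff H i \<noteq> 0" unfolding S by auto
    show "r * real N \<le> snd x + r * fst x"
    proof (cases "i < N")
      case True
      hence "r \<le> real (a i) / (real N - real i)" using imin i unfolding r_def I_def by auto
      hence "r * (real N - real i) \<le> real (a i)" using True by (simp add: pos_le_divide_eq)
      thus ?thesis using i by (simp add: algebra_simps)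
    next
      case False
      hence "i = N" using iN i by force
      thus ?thesis using i by simp
    qed
  qed
  let ?A = "(real i1, real (a i1))" and ?B = "(real N, 0 :: real)"
  have AS: "?A \<in> S" using c1 by (auto simp: S)
  have onhull: "closed_segment ?A ?B \<subseteq> convex hull S"
    using AS NS by (intro closed_segment_subset_convex_hull hull_inc)
  have seg: "closed_segment ?A ?B \<subseteq> newton_polygon H"
  proof
    fix x assume x: "x \<in> closed_segment ?A ?B"
    then obtain u where u: "x = (1 - u) *\<^sub>R ?A + u *\<^sub>R ?B" by (auto simp: closed_segment_def)
    have "snd x + r * fst x = r * real N"
      unfolding u by (simp add: r1 algebra_simps)
    moreover have "x \<in> convex hull S" using x onhull by blast
    ultimately show "x \<in> newton_polygon H"
      unfolding newton_polygon_def S_def[symmetric] using half by fastforce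
  qed
  have rpos: "r > 0" if "weierstrass H N"
  proof -
    have "coeff H i1 $ 0 = 0" using that i1N by (simp add: weierstrass_def)
    hence "a i1 \<noteq> 0" using c1 by (simp add: a_def subdegree_eq_0_iff)
    thus ?thesis using i1N by (simp add: r_def)
  qed
  have slope: "(0 - real (a i1)) / (real N - real i1) = - r" by (simp add: r_def)
  \<comment> \<open>The principal polygon contains this segment only if its slope is strictly
    negative, which is where the Weierstrass condition enters.\<close>
  have AB: "?A \<in> E" "?B \<in> E"
  proof -
    have "?A \<in> newton_polygon H" "?B \<in> newton_polygon H" using seg by auto
    moreover have "?A \<in> principal_polygon H" "?B \<in> principal_polygon H" if w: "weierstrass H N"
    proof -
      show "?A \<in> principal_polygon H"
        unfolding principal_polygon_def mem_Collect_eq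
      proof (intro conjI bexI[of _ ?B])
        show "(snd ?B - snd ?A) / (fst ?B - fst ?A) < 0"
          unfolding fst_conv snd_conv slope using rpos[OF w] by simp
      qed (use seg calculation i1N in auto)
      have "(real (a i1) - 0) / (real i1 - real N) = - r"
        using i1N by (simp add: r_def field_simps)
      thus "?B \<in> principal_polygon H"
        unfolding principal_polygon_def mem_Collect_eq
        by (intro conjI bexI[of _ ?A])
          (use seg calculation i1N rpos[OF w] in \<open>auto simp: closed_segment_commute\<close>)
    qed
    ultimately show "?A \<in> E" "?B \<in> E" using E by auto
  qed
  have "snd ?B - snd ?A = - (real_of_int m / real q) * (fst ?B - fst ?A)"
    by (rule closed_segment_slope[OF _ _ p12(2,3)]) (use AB p12(1) in auto)
  hence "real (a i1) = real_of_int m / real q * (real N - real i1)" by simp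
  hence "r * (real N - real i1) = (real_of_int m / real q) * (real N - real i1)" using r1 by simp
  hence mr: "r = real_of_int m / real q"
    using i1N by (subst (asm) mult_right_cancel) simp_all
  have mrq: "real_of_int m = r * real q" using mr q by simp
  show "m \<ge> 0" using mrq r0 by (metis mult_nonneg_nonneg of_int_0_le_iff of_nat_0_le_iff)
  show "m > 0" if "weierstrass H N"
    using mrq rpos[OF that] q by (metis mult_pos_pos of_int_0_less_iff of_nat_0_less_iff)
  have bN: "coeff (boundary_poly E H) N $ 0 = 1" using AB deg cN by (simp add: coeff_boundary_poly)
  have b1: "coeff (boundary_poly E H) i1 $ a i1 \<noteq> 0"
    using AB deg i1N c1 by (simp add: coeff_boundary_poly a_def)
  have "degree (boundary_poly E H) = N"
  proof (rule antisym)
    show "degree (boundary_poly E H) \<le> N"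
      by (rule degree_le) (auto simp: fps_eq_iff coeff_boundary_poly deg)
    show "N \<le> degree (boundary_poly E H)" using bN by (intro le_degree) auto
  qed
  thus N: "N = q * degree P * N'"
    using c degree_edge_poly[OF q Pl, of m] by (simp add: degree_power_eq mult_ac)
  show "poly P 0 \<noteq> 0"
  proof
    assume 0: "poly P 0 = 0"
    obtain b A where P: "P = pCons b A" by (cases P)
    with 0 have PA: "P = [:0, 1:] * A" by simp
    have "\<forall>i. coeff P i \<in> L" using irr by (simp add: irred_over_def)
    hence PL: "\<And>i. coeff P i \<in> L" by blast
    have AL: "coeff A i \<in> L" for i using PL[of "Suc i"] P by simp
    \<comment> \<open>Here \<open>L\<close> is an arbitrary set; 0 and 1 belong to it because they
      are the constant and the leading coefficient of \<open>P\<close>.\<close>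
    have "coeff [:0, 1:] i \<in> L" for i :: nat
      using PL[of "degree P"] PL[of 0] 0 Pl P by (cases i) (auto simp: coeff_pCons split: nat.splits)
    with irr AL PA have "degree A = 0" unfolding irred_over_def by fastforce
    then obtain b' where "A = [:b':]" by (rule degree_eq_zeroE)
    with PA Pl have PX: "P = [:0, 1:]" by (cases "b' = 0") auto
    have "edge_poly q m P = monom (fps_X ^ nat (if m \<ge> 0 then 0 else - m)) q"
      unfolding edge_poly_def PX by (simp add: atMost_Suc)
    hence "boundary_poly E H = [:fps_const c:] * monom ((fps_X ^ nat (if m \<ge> 0 then 0 else - m)) ^ N') (q * N')"
      using c(2) by (simp add: monom_power)
    moreover have "q * N' = N" using N PX by simp
    ultimately have "coeff (boundary_poly E H) i1 = 0" using i1N by simp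
    with b1 show False by simp
  qed
qed

section \<open>The tower of substitutions\<close>

lemma inverse_of_nat_mem: "is_subfield L \<Longrightarrow> 1 / of_nat n \<in> (L :: 'a::field set)"
  by (intro subfield_divide subring_of_nat is_subringD(2) subfield_is_subring)

lemma fps_const_X_compose:
  fixes B :: "'a::field fps"
  assumes "B $ 0 = 0"
  shows "(fps_const b * fps_X ^ e) oo B = fps_const b * B ^ e"
  using assms by (simp add: fps_compose_mult_distrib fps_compose_power[symmetric])

locale substitution_tower =
  fixes K :: "'a::field set" and F :: "'a fps poly" and k :: nat
    and H U G :: "nat \<Rightarrow> 'a fps poly" and q N t a :: "nat \<Rightarrow> nat" and m s :: "nat \<Rightarrow> int"
    and P :: "nat \<Rightarrow> 'a poly" and z :: "nat \<Rightarrow> 'a" and c :: "nat \<Rightarrow> 'a fps"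
    and phi :: "nat \<Rightarrow> 'a fps poly"
  assumes K: "is_subfield K"
    and F: "F \<in> ps_poly_ring K" "lead_coeff F = 1"
    and char: "CHAR('a) = 0 \<or> CHAR('a) > degree F"
    and proc: "procedure_upto K F k H q m P N z s t a U G c"
    and Nk: "N k > 1"
    and phi: "\<forall>i\<le>k. phi i \<in> ps_poly_ring K \<and> lead_coeff (phi i) = 1 \<and>
                irreducible_in (ps_poly_ring K) (phi i) \<and>
                poly (map_poly (\<lambda>h. h oo fst (the_pi q m z s t c i)) (phi i))
                     (coeff (snd (the_pi q m z s t c i)) 0) = 0"
begin

abbreviation L where "L j \<equiv> tower K z j"
abbreviation R where "R \<equiv> poly_over (fps_over K)"
abbreviation RL where "RL j \<equiv> poly_over (fps_over (L j))"
definition sg where "sg j = sigma_map (z j) (t j) (q j) (m j) (s j)"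
definition ta where "ta j = tau_map (c j)"
definition pj where "pj j = the_pi q m z s t c j"
definition ell where "ell j = degree (P j)"
definition ee where "ee j = (\<Prod>i\<in>{1..j}. q i)"
definition ff where "ff j = (\<Prod>i\<in>{1..j}. ell i)"

lemma ee_0 [simp]: "ee 0 = 1" and ee_Suc [simp]: "ee (Suc j) = ee j * q (Suc j)"
  and ff_0 [simp]: "ff 0 = 1" and ff_Suc [simp]: "ff (Suc j) = ff j * ell (Suc j)"
  by (simp_all add: ee_def ff_def)

lemma pj_0: "pj 0 = ta 0"
  and pj_Suc: "pj (Suc j) = mcomp (mcomp (pj j) (sg (Suc j))) (ta (Suc j))"
  by (simp_all add: pj_def the_pi_def sg_def ta_def)

lemma proc_0: "c 0 = - coeff F (degree F - 1) * fps_const (1 / of_nat (degree F))"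
  "H 0 = subs F (ta 0)" "N 0 = degree F"
  using proc by (auto simp: procedure_upto_def ta_def)

lemma proc_Suc:
  assumes "j < k"
  shows "degenerate (if j = 0 then newton_polygon (H j) else principal_polygon (H j))
           (L j) (H j) (q (Suc j)) (m (Suc j)) (P (Suc j)) (N (Suc j))"
    "poly (P (Suc j)) (z (Suc j)) = 0"
    "int (q (Suc j)) * s (Suc j) - m (Suc j) * int (t (Suc j)) = 1"
    "subs (H j) (sg (Suc j)) = [:fps_X ^ a (Suc j):] * U (Suc j) * G (Suc j)"
    "coeff (U (Suc j)) 0 $ 0 \<noteq> 0"
    "weierstrass (G (Suc j)) (N (Suc j))"
    "c (Suc j) = - coeff (G (Suc j)) (N (Suc j) - 1) * fps_const (1 / of_nat (N (Suc j)))"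
    "H (Suc j) = subs (G (Suc j)) (ta (Suc j))"
  using proc assms unfolding procedure_upto_def sg_def ta_def by blast+

lemma c_Suc_0: "j < k \<Longrightarrow> c (Suc j) $ 0 = 0"
proof -
  assume j: "j < k"
  show ?thesis
  proof (cases "N (Suc j) = 0")
    \<comment> \<open>With \<open>N (Suc j) = 0\<close> the factor \<open>1 / of_nat 0\<close> is 0,
      so the shift is zero.\<close>
    case True
    thus ?thesis by (simp add: proc_Suc(7)[OF j])
  next
    case False
    hence "coeff (G (Suc j)) (N (Suc j) - 1) $ 0 = 0"
      using proc_Suc(6)[OF j] by (auto simp: weierstrass_def)
    thus ?thesis by (simp add: proc_Suc(7)[OF j])
  qed
qed

lemma H_monic: "j \<le> k \<Longrightarrow> degree (H j) = N j \<and> lead_coeff (H j) = 1 \<and> (j > 0 \<longrightarrow> weierstrass (H j) (N j))"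
proof (cases j)
  case 0
  have "degree (H 0) = N 0" "lead_coeff (H 0) = 1"
    using degree_subs_tau_map[of F "c 0"] lead_coeff_subs_tau_map[of F "c 0"] F(2)
    by (simp_all only: proc_0(2,3) ta_def)
  with 0 show ?thesis by simp
next
  case (Suc i)
  assume "j \<le> k"
  hence i: "i < k" using Suc by simp
  have G: "degree (G j) = N j" "lead_coeff (G j) = 1" "\<forall>l<N j. coeff (G j) l $ 0 = 0"
    using proc_Suc(6)[OF i] Suc by (auto simp: weierstrass_def)
  have "degree (H j) = N j" "lead_coeff (H j) = 1"
    using degree_subs_tau_map[of "G j" "c j"] lead_coeff_subs_tau_map[of "G j" "c j"] G(1,2)
    by (simp_all only: Suc proc_Suc(8)[OF i] ta_def)
  moreover have "coeff (H j) l $ 0 = coeff (G j) l $ 0" for l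
    by (simp only: Suc proc_Suc(8)[OF i] ta_def subs_tau_map_coeff_0[OF c_Suc_0[OF i]])
  ultimately show ?thesis using G by (auto simp: weierstrass_def)
qed

text \<open>The signs of \<open>m\<close> and \<open>s\<close> let the relation q s - m t = 1 be
  used over the natural numbers. The value m = 0 is confined to the first stage, since later H_j are
  Weierstrass.\<close>

lemma stage:
  assumes j: "j < k"
  shows "q (Suc j) > 0" "m (Suc j) \<ge> 0" "m (Suc j) > 0 \<or> j = 0" "N j = q (Suc j) * ell (Suc j) * N (Suc j)"
    "z (Suc j) \<noteq> 0" "irred_over (L j) (P (Suc j))" "lead_coeff (P (Suc j)) = 1" "s (Suc j) > 0"
    "q (Suc j) * nat (s (Suc j)) = 1 + nat (m (Suc j)) * t (Suc j)" "ell (Suc j) > 0"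
proof -
  note dg = proc_Suc(1)[OF j]
  have Hj: "degree (H j) = N j" "lead_coeff (H j) = 1" "j > 0 \<longrightarrow> weierstrass (H j) (N j)"
    using H_monic[of j] j by auto
  note dm = degenerate_monic[OF Hj(1,2) _ dg]
  show q: "q (Suc j) > 0" and irr: "irred_over (L j) (P (Suc j))" and "lead_coeff (P (Suc j)) = 1"
    using dg by (auto simp: degenerate_def)
  show m: "m (Suc j) \<ge> 0" using dm(1) Hj(3) by (cases "j = 0") auto
  show "m (Suc j) > 0 \<or> j = 0" using dm(2) Hj(3) by auto
  show "N j = q (Suc j) * ell (Suc j) * N (Suc j)" using dm(3) Hj(3) by (cases "j = 0") (auto simp: ell_def)
  have "poly (P (Suc j)) 0 \<noteq> 0" using dm(4) Hj(3) by (cases "j = 0") auto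
  thus "z (Suc j) \<noteq> 0" using proc_Suc(2)[OF j] by metis
  show "ell (Suc j) > 0" using irr by (simp add: ell_def irred_over_def)
  have qs: "int (q (Suc j)) * s (Suc j) = 1 + m (Suc j) * int (t (Suc j))" using proc_Suc(3)[OF j] by simp
  hence "int (q (Suc j)) * s (Suc j) > 0" using m by (simp add: add_pos_nonneg)
  thus s: "s (Suc j) > 0" using q by (simp add: zero_less_mult_iff)
  have "int (q (Suc j) * nat (s (Suc j))) = int (1 + nat (m (Suc j)) * t (Suc j))"
    using s m qs by simp
  thus "q (Suc j) * nat (s (Suc j)) = 1 + nat (m (Suc j)) * t (Suc j)" by (simp only: of_nat_eq_iff)
qed

lemma ee_pos: "j \<le> k \<Longrightarrow> ee j > 0" and ff_pos: "j \<le> k \<Longrightarrow> ff j > 0"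
  by (induction j) (auto simp: stage)

lemma degree_F: "j \<le> k \<Longrightarrow> degree F = ff j * ee j * N j"
proof (induction j)
  case 0
  thus ?case by (simp add: proc_0)
next
  case (Suc j)
  thus ?case using stage(4)[of j] by simp
qed

lemma N_pos: "j \<le> k \<Longrightarrow> N j > 0"
proof -
  assume j: "j \<le> k"
  have "degree F > 0" using degree_F[of k] ee_pos[of k] ff_pos[of k] Nk by simp
  thus "N j > 0" using degree_F[OF j] by (metis gr0I mult_0_right)
qed

lemma degree_le_F: "j \<le> k \<Longrightarrow> ff j * ee j \<le> degree F"
  using degree_F[of j] N_pos[of j] by simp

text \<open>The assumption on the characteristic enters here: it allows coefficients to be recovered
  from a y-derivative in degrees up to that of \<open>F\<close>.\<close>

lemma of_nat_nonzero: "0 < i \<Longrightarrow> i \<le> degree F \<Longrightarrow> of_nat i \<noteq> (0::'a)"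
  using char by (auto simp: of_nat_eq_0_iff_char_dvd dest: dvd_imp_le)

lemma L_subfield: "is_subfield (L j)" by (rule is_subfield_tower[OF K])

lemma L_subring: "is_subring (L j)" by (rule subfield_is_subring[OF L_subfield])

lemma fpsL_subring: "is_subring (fps_over (L j))" by (rule is_subring_fps_over[OF L_subring])

lemma RL_subring: "is_subring (RL j)" by (rule is_subring_poly_over[OF fpsL_subring])

lemma K_subring: "is_subring K" by (rule subfield_is_subring[OF K])

lemma L_Suc: "L j \<subseteq> L (Suc j)" using adjoin_subset by simp

lemma z_mem: "z (Suc j) \<in> L (Suc j)" using adjoin_gen by simp

lemma K_L: "K \<subseteq> L j" by (induction j) (use L_Suc in auto)

lemma R_RL: "R \<subseteq> RL j" using K_L[of j] by (auto simp: poly_over_def fps_over_def)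

lemma RL_Suc: "RL j \<subseteq> RL (Suc j)" using L_Suc[of j] by (auto simp: poly_over_def fps_over_def)

lemma sg_props:
  assumes j: "j < k"
  shows "fst (sg (Suc j)) = fps_const (z (Suc j) ^ t (Suc j)) * fps_X ^ q (Suc j)"
    "snd (sg (Suc j)) = [:fps_X ^ nat (m (Suc j)) * fps_const (z (Suc j) ^ nat (s (Suc j))), fps_X ^ nat (m (Suc j)):]"
    "fst (sg (Suc j)) $ 0 = 0" "z (Suc j) ^ t (Suc j) \<in> L (Suc j)" "snd (sg (Suc j)) \<in> RL (Suc j)"
proof -
  note st = stage[OF j]
  have zs: "z (Suc j) powi s (Suc j) = z (Suc j) ^ nat (s (Suc j))" using st(8) by (simp add: power_int_def)
  show 1: "fst (sg (Suc j)) = fps_const (z (Suc j) ^ t (Suc j)) * fps_X ^ q (Suc j)"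
    and 2: "snd (sg (Suc j)) = [:fps_X ^ nat (m (Suc j)) * fps_const (z (Suc j) ^ nat (s (Suc j))), fps_X ^ nat (m (Suc j)):]"
    by (simp_all add: sg_def sigma_map_def zs)
  show "fst (sg (Suc j)) $ 0 = 0" using st(1) by (simp add: 1)
  show "z (Suc j) ^ t (Suc j) \<in> L (Suc j)" by (intro subring_power L_subring z_mem)
  show "snd (sg (Suc j)) \<in> RL (Suc j)"
    unfolding 2 using is_subringD(1)[OF RL_subring]
    by (auto simp: pCons_poly_over[OF fpsL_subring] intro!: is_subringD(4)[OF fpsL_subring]
        fps_X_power_over[OF L_subring] fps_const_over[OF L_subring] subring_power[OF L_subring] z_mem simp del: tower.simps)
qed

lemma ta_props: "fst (ta j) = fps_X" "snd (ta j) = [:c j, 1:]" "fst (ta j) $ 0 = 0"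
  by (simp_all add: ta_def tau_map_def)

lemma subs_ta_over: "H' \<in> RL j \<Longrightarrow> c j \<in> fps_over (L j) \<Longrightarrow> subs H' (ta j) \<in> RL j"
  by (rule subs_over[OF L_subring _ is_subringD(2)[OF L_subring], of _ _ 1])
    (use is_subringD(1,2)[OF RL_subring] is_subringD(2)[OF fpsL_subring]
      in \<open>auto simp: ta_props pCons_poly_over[OF fpsL_subring]\<close>)

text \<open>\<open>U\<close> and \<open>G\<close> are given only over the ambient field. Their
  product lies over \<open>L (Suc j)\<close>, and \<open>weierstrass_over\<close> transfers this to
  \<open>G\<close>, hence to the shift and to the next H.\<close>

lemma H_over: "j \<le> k \<Longrightarrow> c j \<in> fps_over (L j) \<and> H j \<in> RL j"
proof (induction j)
  case 0
  have FR: "F \<in> R" using F by (simp add: ps_poly_ring_eq)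
  have "c 0 \<in> fps_over (L 0)"
    unfolding proc_0(1)
    by (intro is_subringD(4,5)[OF fpsL_subring] fps_const_over[OF L_subring] inverse_of_nat_mem[OF L_subfield])
      (use poly_overD[OF FR] in simp)
  moreover have "F \<in> RL 0" using FR by simp
  ultimately show ?case using subs_ta_over[of F 0] proc_0(2) by metis
next
  case (Suc j)
  hence j: "j < k" by simp
  have HR: "H j \<in> RL (Suc j)" using Suc RL_Suc by auto
  have "subs (H j) (sg (Suc j)) \<in> RL (Suc j)"
    by (rule subs_over[OF L_subring HR sg_props(4)[OF j] stage(1)[OF j] sg_props(1)[OF j] sg_props(5)[OF j]])
  hence X: "[:fps_X ^ a (Suc j):] * (U (Suc j) * G (Suc j)) \<in> RL (Suc j)"
    by (simp only: proc_Suc(4)[OF j] mult.assoc)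
  have "U (Suc j) * G (Suc j) \<in> RL (Suc j)"
  proof -
    \<comment> \<open>Multiplication by a power of x merely shifts coefficients, so it can be undone
      without leaving the field.\<close>
    have "coeff (U (Suc j) * G (Suc j)) i $ n \<in> L (Suc j)" for i n
    proof -
      have "coeff ([:fps_X ^ a (Suc j):] * (U (Suc j) * G (Suc j))) i $ (a (Suc j) + n) \<in> L (Suc j)"
        using X unfolding poly_over_def fps_over_def by blast
      thus ?thesis by (simp add: fps_X_power_mult_nth)
    qed
    thus ?thesis unfolding poly_over_def fps_over_def by blast
  qed
  hence GL: "G (Suc j) \<in> RL (Suc j)"
    by (rule weierstrass_over[OF L_subfield _ proc_Suc(5)[OF j] proc_Suc(6)[OF j]])
  have "c (Suc j) \<in> fps_over (L (Suc j))"
    unfolding proc_Suc(7)[OF j]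
    by (intro is_subringD(4,5)[OF fpsL_subring] fps_const_over[OF L_subring] inverse_of_nat_mem[OF L_subfield] poly_overD[OF GL])
  thus ?case using subs_ta_over[OF GL] proc_Suc(8)[OF j] by simp
qed

text \<open>The constant \<mu>_j in x \<mapsto> \<mu>_j x^(e_j); the next stage replaces x by z^t
  x^q, whose power e_j contributes the new factor.\<close>

primrec mu where
  "mu 0 = 1"
| "mu (Suc j) = mu j * z (Suc j) ^ (t (Suc j) * ee j)"

lemma mu_mem: "j \<le> k \<Longrightarrow> mu j \<in> L j \<and> mu j \<noteq> 0"
proof (induction j)
  case 0
  thus ?case using is_subringD(2)[OF K_subring] by simp
next
  case (Suc j)
  have "mu j \<in> L (Suc j)" using Suc L_Suc[of j] by auto
  moreover have "z (Suc j) ^ (t (Suc j) * ee j) \<in> L (Suc j)" by (intro subring_power L_subring z_mem)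
  ultimately show ?case using Suc stage(5)[of j] is_subringD(4)[OF L_subring[of "Suc j"]] by simp
qed

lemma fst_pj: "j \<le> k \<Longrightarrow> fst (pj j) = fps_const (mu j) * fps_X ^ ee j"
proof (induction j)
  case 0
  thus ?case by (simp add: pj_0 ta_props)
next
  case (Suc j)
  hence j: "j < k" by simp
  have "fst (pj (Suc j)) = fst (pj j) oo fst (sg (Suc j))"
    by (simp add: pj_Suc mcomp_def ta_props)
  also have "\<dots> = fps_const (mu j) * fst (sg (Suc j)) ^ ee j"
    using Suc sg_props(3)[OF j] by (simp add: fps_const_X_compose)
  also have "\<dots> = fps_const (mu (Suc j)) * fps_X ^ ee (Suc j)"
    by (simp add: sg_props(1)[OF j] power_mult_distrib power_mult[symmetric] mult_ac fps_const_power
        flip: fps_const_mult)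
  finally show ?case .
qed

lemma fst_pj_0: "j \<le> k \<Longrightarrow> fst (pj j) $ 0 = 0"
  using ee_pos[of j] by (simp add: fst_pj)

lemma subs_pj_Suc:
  assumes j: "j < k"
  shows "subs h (pj (Suc j)) = subs (subs (subs h (pj j)) (sg (Suc j))) (ta (Suc j))"
proof -
  have 1: "fst (pj j) $ 0 = 0" "fst (sg (Suc j)) $ 0 = 0" "fst (ta (Suc j)) $ 0 = 0"
    using fst_pj_0 sg_props(3) ta_props(3) j by auto
  have 2: "fst (mcomp (pj j) (sg (Suc j))) $ 0 = 0"
    using 1 by (simp add: mcomp_def)
  show ?thesis unfolding pj_Suc using 1 2 by (simp add: subs_mcomp)
qed

text \<open>Linearity in y bounds the degree of pullbacks, and the monomial y-coefficient makes the
  chain rule factor a leading form. Membership over \<open>L j\<close> supplies the series S_j for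
  the generator count.\<close>

lemma snd_pj: "j \<le> k \<Longrightarrow> snd (pj j) \<in> RL j \<and> (\<exists>S \<alpha> r. snd (pj j) = [:S, fps_const \<alpha> * fps_X ^ r:] \<and> \<alpha> \<noteq> 0)"
proof (induction j)
  case 0
  have "snd (pj 0) = [:c 0, fps_const 1 * fps_X ^ 0:]" by (simp add: pj_0 ta_props)
  moreover have "snd (pj 0) \<in> RL 0"
    using H_over[of 0] is_subringD(1,2)[OF RL_subring[of 0]] is_subringD(2)[OF fpsL_subring[of 0]]
    by (simp add: pj_0 ta_props pCons_poly_over[OF fpsL_subring] del: tower.simps)
  ultimately show ?case by (metis one_neq_zero)
next
  case (Suc j)
  hence j: "j < k" by simp
  obtain S \<alpha> r where S: "snd (pj j) = [:S, fps_const \<alpha> * fps_X ^ r:]" "\<alpha> \<noteq> 0" and mem: "snd (pj j) \<in> RL j"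
    using Suc by auto
  have e: "snd (pj (Suc j)) = subs (subs (snd (pj j)) (sg (Suc j))) (ta (Suc j))"
    by (simp add: pj_Suc snd_mcomp)
  have mem': "snd (pj j) \<in> RL (Suc j)" using mem RL_Suc by blast
  have "snd (pj (Suc j)) \<in> RL (Suc j)"
    unfolding e using H_over[of "Suc j"] Suc.prems
    by (intro subs_ta_over subs_over[OF L_subring mem' sg_props(4)[OF j] stage(1)[OF j] sg_props(1)[OF j] sg_props(5)[OF j]])
      simp
  moreover have "\<exists>S' \<alpha>' r'. snd (pj (Suc j)) = [:S', fps_const \<alpha>' * fps_X ^ r':] \<and> \<alpha>' \<noteq> 0"
  proof -
    define W where "W = fps_const (\<alpha> * z (Suc j) ^ (t (Suc j) * r)) * fps_X ^ (q (Suc j) * r + nat (m (Suc j)))"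
    have "(fps_const \<alpha> * fps_X ^ r) oo fst (sg (Suc j)) = fps_const (\<alpha> * z (Suc j) ^ (t (Suc j) * r)) * fps_X ^ (q (Suc j) * r)"
      by (subst fps_const_X_compose[OF sg_props(3)[OF j]])
        (simp add: sg_props(1)[OF j] power_mult_distrib power_mult[symmetric] fps_const_power mult_ac flip: fps_const_mult)
    hence "\<exists>V. subs (snd (pj j)) (sg (Suc j)) = [:V, W:]"
      unfolding S(1) subs_pCons sg_props(2)[OF j] W_def by (simp add: power_add mult_ac)
    then obtain V where "subs (snd (pj j)) (sg (Suc j)) = [:V, W:]" by blast
    hence "\<exists>V. snd (pj (Suc j)) = [:V, W:]"
      unfolding e by (simp add: subs_pCons ta_props)
    moreover have "\<alpha> * z (Suc j) ^ (t (Suc j) * r) \<noteq> 0" using S stage(5)[OF j] by simp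
    ultimately show ?thesis unfolding W_def by blast
  qed
  ultimately show ?case by blast
qed

lemma subs_pj_over: "j \<le> k \<Longrightarrow> h \<in> R \<Longrightarrow> subs h (pj j) \<in> RL j"
  using R_RL[of j] mu_mem[of j] ee_pos[of j] fst_pj[of j] snd_pj[of j]
  by (intro subs_over[OF L_subring, of _ _ "mu j" "ee j"]) auto

lemma has_lead_mem: "j \<le> k \<Longrightarrow> h \<in> R \<Longrightarrow> has_lead (subs h (pj j)) i v b \<Longrightarrow> b \<in> L j"
  using has_lead_coeff[of "subs h (pj j)" i v b] subs_pj_over[of j h]
  unfolding poly_over_def fps_over_def by blast

text \<open>Products of old generators with powers of the new z, indexed by quotient and remainder
  modulo the new degree, span the next field. Spanning alone suffices for the upper bound on the
  degree of phi_j.\<close>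

lemma tower_generated:
  "j \<le> k \<Longrightarrow> \<exists>\<zeta>. \<forall>x\<in>L j. \<exists>\<kappa>. (\<forall>i<ff j. \<kappa> i \<in> K) \<and> x = (\<Sum>i<ff j. \<kappa> i * \<zeta> i)"
proof (induction j)
  case 0
  show ?case by (intro exI[of _ "\<lambda>_. 1"]) auto
next
  case (Suc j)
  hence j: "j < k" by simp
  define n where "n = ff j"
  define l where "l = ell (Suc j)"
  have l0: "l > 0" using stage(10)[OF j] by (simp add: l_def)
  obtain \<zeta> where "\<forall>x\<in>L j. \<exists>\<kappa>. (\<forall>i<n. \<kappa> i \<in> K) \<and> x = (\<Sum>i<n. \<kappa> i * \<zeta> i)"
    using Suc by (auto simp: n_def)
  then obtain \<kappa> where \<kappa>: "\<And>x i. x \<in> L j \<Longrightarrow> i < n \<Longrightarrow> \<kappa> x i \<in> K"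
    "\<And>x. x \<in> L j \<Longrightarrow> (\<Sum>i<n. \<kappa> x i * \<zeta> i) = x" by metis
  have "\<exists>\<kappa>'. (\<forall>i<n * l. \<kappa>' i \<in> K) \<and> x = (\<Sum>i<n * l. \<kappa>' i * (\<zeta> (i div l) * z (Suc j) ^ (i mod l)))"
    if x: "x \<in> L (Suc j)" for x
  proof -
    obtain p where p: "p \<in> poly_over (L j)" "x = poly p (z (Suc j))" "degree p < l"
      using adjoin_representation[OF L_subfield stage(6,7)[OF j] proc_Suc(2)[OF j], of x] x
      by (auto simp: l_def ell_def)
    define \<kappa>' where "\<kappa>' i = \<kappa> (coeff p (i mod l)) (i div l)" for i
    have "(\<Sum>i<n * l. \<kappa>' i * (\<zeta> (i div l) * z (Suc j) ^ (i mod l)))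
        = (\<Sum>b<n. \<Sum>i=b * l..<b * l + l. \<kappa>' i * (\<zeta> (i div l) * z (Suc j) ^ (i mod l)))"
      by (rule sum.nat_group[symmetric])
    also have "\<dots> = (\<Sum>b<n. \<Sum>r<l. \<kappa> (coeff p r) b * (\<zeta> b * z (Suc j) ^ r))"
    proof (rule sum.cong[OF refl])
      fix b
      show "(\<Sum>i=b * l..<b * l + l. \<kappa>' i * (\<zeta> (i div l) * z (Suc j) ^ (i mod l)))
        = (\<Sum>r<l. \<kappa> (coeff p r) b * (\<zeta> b * z (Suc j) ^ r))"
        using l0 by (subst sum.atLeastLessThan_shift_0) (auto simp: \<kappa>'_def lessThan_atLeast0 intro!: sum.cong)
    qed
    also have "\<dots> = (\<Sum>r<l. (\<Sum>b<n. \<kappa> (coeff p r) b * \<zeta> b) * z (Suc j) ^ r)"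
      by (subst sum.swap) (simp add: sum_distrib_right sum_distrib_left mult_ac)
    also have "\<dots> = (\<Sum>r<l. coeff p r * z (Suc j) ^ r)"
      using \<kappa>(2)[OF poly_overD[OF p(1)]] by simp
    also have "\<dots> = x"
      unfolding p(2) poly_altdef using p(3)
      by (intro sum.mono_neutral_right) (auto simp: coeff_eq_0)
    finally have "x = (\<Sum>i<n * l. \<kappa>' i * (\<zeta> (i div l) * z (Suc j) ^ (i mod l)))" by simp
    moreover have "\<kappa>' i \<in> K" if "i < n * l" for i
      unfolding \<kappa>'_def using that by (intro \<kappa>(1) poly_overD[OF p(1)]) (simp add: less_mult_imp_div_less)
    ultimately show ?thesis by blast
  qed
  thus ?case by (intro exI[of _ "\<lambda>i. \<zeta> (i div l) * z (Suc j) ^ (i mod l)"]) (simp add: n_def l_def del: tower.simps)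
qed

section \<open>Independence of leading coefficients of equal weight\<close>

text \<open>\<open>VV j p\<close> and \<open>LL j p\<close> are \<open>v\<^sub>j(\<phi>\<^bsub>p-1\<^esub>)\<close> and \<open>\<lambda>\<^sub>j(\<phi>\<^bsub>p-1\<^esub>)\<close>; \<open>wt j\<close> and \<open>lam j\<close> omit the last
  entry, that of \<open>\<phi>\<^sub>j\<close>, of an index vector.\<close>
definition VV where "VV j p = valx (subs (Phi_vec phi p) (pj j))"
definition LL where "LL j p = trail_lc (subs (Phi_vec phi p) (pj j))"

definition ibox where
  "ibox j = {B :: nat \<Rightarrow> nat. (\<forall>p>j. B p = 0) \<and> (\<forall>p\<in>{1..j}. B p < q p * ell p)}"

definition wt where "wt j B = (\<Sum>p\<le>j. B p * VV j p)"
definition lam where "lam j B = (\<Prod>p\<le>j. LL j p ^ B p)"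

text \<open>Independence is required only within one weight, because terms of different x-valuation
  cannot cancel each other.\<close>

definition indep where
  "indep j \<longleftrightarrow> (\<forall>X f w. finite X \<longrightarrow> X \<subseteq> ibox j \<longrightarrow> (\<forall>B\<in>X. wt j B = w \<and> f B \<in> K) \<longrightarrow>
     (\<Sum>B\<in>X. f B * lam j B) = 0 \<longrightarrow> (\<forall>B\<in>X. f B = 0))"

lemma indepD:
  assumes "indep j" "finite X" "X \<subseteq> ibox j" "\<And>B. B \<in> X \<Longrightarrow> wt j B = w" "\<And>B. B \<in> X \<Longrightarrow> f B \<in> K"
    "(\<Sum>B\<in>X. f B * lam j B) = 0" "B \<in> X"
  shows "f B = 0"
  using assms(1) unfolding indep_def
  by (elim allE[of _ X] allE[of _ f] allE[of _ w]) (use assms(2-) in simp)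

lemma phi_props:
  assumes "i \<le> k"
  shows "phi i \<in> R" "lead_coeff (phi i) = 1" "irreducible_in R (phi i)" "coeff (subs (phi i) (pj i)) 0 = 0"
  using phi assms by (auto simp: ps_poly_ring_eq pj_def coeff_0_subs)

lemma Phi_vec_mem: "p \<le> Suc k \<Longrightarrow> Phi_vec phi p \<in> R"
proof (cases "p = 0")
  case True
  have "fps_X ^ 1 \<in> fps_over K" by (rule fps_X_power_over[OF K_subring])
  thus ?thesis using True by (simp add: Phi_vec_def const_poly_over is_subring_fps_over K_subring)
qed (simp add: Phi_vec_def phi_props)

lemma has_lead_x:
  assumes j: "j \<le> k"
  shows "has_lead (subs (Phi_vec phi 0) (pj j)) 0 (ee j) (mu j)"
proof -
  have "subs (Phi_vec phi 0) (pj j) = monom (fps_const (mu j) * fps_X ^ ee j) 0"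
    using fst_pj_0[OF j] by (simp add: Phi_vec_def subs_const fst_pj[OF j] monom_0)
  thus ?thesis using has_lead_monom mu_mem[OF j] by metis
qed

lemma VV_0: "j \<le> k \<Longrightarrow> VV j 0 = ee j" and LL_0: "j \<le> k \<Longrightarrow> LL j 0 = mu j"
  unfolding VV_def LL_def using has_lead_valx[OF has_lead_x] by auto

lemma LL_mem:
  "j \<le> k \<Longrightarrow> p \<le> Suc k \<Longrightarrow> has_lead (subs (Phi_vec phi p) (pj j)) i v (LL j p) \<Longrightarrow> LL j p \<in> L j"
  by (rule has_lead_mem[OF _ Phi_vec_mem])

lemma indep_0: "indep 0"
  unfolding indep_def
proof (intro allI impI ballI)
  fix X :: "(nat \<Rightarrow> nat) set" and f :: "(nat \<Rightarrow> nat) \<Rightarrow> 'a" and w B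
  assume X: "finite X" "X \<subseteq> ibox 0" "\<forall>B\<in>X. wt 0 B = w \<and> f B \<in> K"
    "(\<Sum>B\<in>X. f B * lam 0 B) = 0" "B \<in> X"
  have "B' = B" if "B' \<in> X" for B'
  proof
    fix p
    have "wt 0 B' = wt 0 B" using X that by simp
    moreover have "B' p = 0 \<and> B p = 0" if "p > 0" using X(2,5) \<open>B' \<in> X\<close> that by (auto simp: ibox_def)
    ultimately show "B' p = B p" by (cases "p = 0") (simp_all add: wt_def VV_0)
  qed
  hence "X = {B}" using X(5) by blast
  thus "f B = 0" using X(4) by (simp add: lam_def LL_0)
qed

text \<open>The exponent \<open>\<epsilon>\<close> of \<open>z\<close> in a monomial of weight \<open>w\<close> with last entry \<open>b\<close> satisfies
  \<open>q \<epsilon> = t w + b\<close> because \<open>q s - m t = 1\<close>; as \<open>b < q \<ell>\<close>, distinct \<open>b\<close> give distinct powers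
  of \<open>z\<close> within a window of length \<open>\<ell>\<close>.\<close>
lemma indep_Suc:
  assumes j: "j < k" and ind: "indep j"
    and V: "\<And>p. p \<le> j \<Longrightarrow> VV (Suc j) p = q (Suc j) * VV j p"
    and V': "VV (Suc j) (Suc j) = q (Suc j) * VV j (Suc j) + nat (m (Suc j))"
    and Lm: "\<And>p. p \<le> j \<Longrightarrow> LL (Suc j) p = LL j p * z (Suc j) ^ (t (Suc j) * VV j p)"
    and Lm': "LL (Suc j) (Suc j) = LL j (Suc j) * z (Suc j) ^ (t (Suc j) * VV j (Suc j) + nat (s (Suc j)))"
    and mem: "\<And>p. p \<le> Suc j \<Longrightarrow> LL j p \<in> L j" and nz: "LL j (Suc j) \<noteq> 0"
  shows "indep (Suc j)"
  unfolding indep_def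
proof (intro allI impI ballI)
  fix X :: "(nat \<Rightarrow> nat) set" and f :: "(nat \<Rightarrow> nat) \<Rightarrow> 'a" and w B0
  assume X: "finite X" "X \<subseteq> ibox (Suc j)" "\<forall>B\<in>X. wt (Suc j) B = w \<and> f B \<in> K"
    and sum0: "(\<Sum>B\<in>X. f B * lam (Suc j) B) = 0" and B0: "B0 \<in> X"
  define Q where "Q = q (Suc j)"
  define Z where "Z = z (Suc j)"
  define T where "T = t (Suc j)"
  define M where "M = nat (m (Suc j))"
  define S where "S = nat (s (Suc j))"
  define v where "v = VV j (Suc j)"
  define th where "th = LL j (Suc j)"
  have Q0: "Q > 0" and QS: "Q * S = 1 + M * T" and Z0: "Z \<noteq> 0"
    using stage[OF j] by (auto simp: Q_def S_def M_def T_def Z_def)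
  define cut where "cut B = B(Suc j := 0 :: nat)" for B
  define b where "b B = B (Suc j)" for B :: "nat \<Rightarrow> nat"
  have wt_cut: "wt j (cut B) = (\<Sum>p\<le>j. B p * VV j p)" for B
    unfolding wt_def cut_def by (rule sum.cong) auto
  have lam_cut: "lam j (cut B) = (\<Prod>p\<le>j. LL j p ^ B p)" for B
    unfolding lam_def cut_def by (rule prod.cong) auto
  have wtS: "wt (Suc j) B = Q * (wt j (cut B) + b B * v) + b B * M" for B
  proof -
    have "wt (Suc j) B = (\<Sum>p\<le>j. B p * VV (Suc j) p) + B (Suc j) * VV (Suc j) (Suc j)"
      by (simp add: wt_def)
    also have "(\<Sum>p\<le>j. B p * VV (Suc j) p) = Q * wt j (cut B)"
      unfolding wt_cut sum_distrib_left by (rule sum.cong) (simp_all add: V Q_def)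
    finally show ?thesis by (simp add: V' Q_def v_def M_def b_def algebra_simps)
  qed
  define \<epsilon> where "\<epsilon> B = T * (wt j (cut B) + b B * v) + b B * S" for B
  have lamS: "lam (Suc j) B = lam j (cut B) * th ^ b B * Z ^ \<epsilon> B" for B
  proof -
    have "lam (Suc j) B = (\<Prod>p\<le>j. LL (Suc j) p ^ B p) * LL (Suc j) (Suc j) ^ b B"
      by (simp add: lam_def b_def)
    also have "(\<Prod>p\<le>j. LL (Suc j) p ^ B p) = (\<Prod>p\<le>j. LL j p ^ B p * Z ^ (T * (B p * VV j p)))"
      by (rule prod.cong) (simp_all add: Lm Z_def T_def power_mult_distrib power_mult[symmetric] mult_ac)
    also have "\<dots> = lam j (cut B) * Z ^ (T * wt j (cut B))"
      by (simp add: prod.distrib lam_cut wt_cut sum_distrib_left power_sum)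
    finally show ?thesis
      by (simp add: Lm' \<epsilon>_def th_def Z_def T_def v_def S_def power_mult_distrib power_mult[symmetric]
          power_add[symmetric] algebra_simps)
  qed
  have eps: "Q * \<epsilon> B = T * w + b B" if "B \<in> X" for B
  proof -
    have w: "w = Q * (wt j (cut B) + b B * v) + b B * M" using X(3) that wtS by auto
    have "Q * \<epsilon> B = T * (Q * (wt j (cut B) + b B * v)) + b B * (Q * S)"
      by (simp add: \<epsilon>_def algebra_simps)
    thus ?thesis by (simp add: QS w algebra_simps)
  qed
  have bL: "b B < Q * ell (Suc j)" if "B \<in> X" for B
    using X(2) that by (auto simp: ibox_def Q_def b_def)
  have cutbox: "cut B \<in> ibox j" if "B \<in> X" for B
    using X(2) that unfolding ibox_def cut_def by (auto simp: subset_iff)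
  define E where "E = \<epsilon> ` X"
  define C where "C e = (\<Sum>B\<in>{B\<in>X. \<epsilon> B = e}. f B * lam j (cut B) * th ^ b B)" for e
  have finE: "finite E" using X(1) by (simp add: E_def)
  have CL: "C e \<in> L j" for e
    unfolding C_def lam_def th_def
    using X(3) K_L mem
    by (intro subring_sum[OF L_subring] is_subringD(4)[OF L_subring] subring_prod[OF L_subring] subring_power[OF L_subring])
      auto
  have "(\<Sum>B\<in>X. f B * lam (Suc j) B) = (\<Sum>e\<in>E. \<Sum>B\<in>{B\<in>X. \<epsilon> B = e}. f B * lam (Suc j) B)"
    unfolding E_def by (rule sum.image_gen[OF X(1)])
  also have "\<dots> = (\<Sum>e\<in>E. C e * Z ^ e)"
    unfolding C_def sum_distrib_right by (intro sum.cong refl) (auto simp: lamS mult_ac)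
  finally have C0: "(\<Sum>e\<in>E. C e * Z ^ e) = 0" using sum0 by simp
  define n0 where "n0 = Min E"
  have "n0 \<in> E" unfolding n0_def using finE B0 by (intro Min_in) (auto simp: E_def)
  then obtain B1 where B1: "B1 \<in> X" "n0 = \<epsilon> B1" by (auto simp: E_def)
  have "E \<subseteq> {n0..<n0 + degree (P (Suc j))}"
  proof
    fix e assume e: "e \<in> E"
    then obtain B where B: "B \<in> X" "e = \<epsilon> B" by (auto simp: E_def)
    have "Q * e < Q * n0 + Q * ell (Suc j)"
      using eps[OF B(1)] eps[OF B1(1)] bL[OF B(1)] by (simp add: B B1)
    hence "Q * e < Q * (n0 + ell (Suc j))" by (simp add: distrib_left)
    hence "e < n0 + ell (Suc j)" by simp
    moreover have "n0 \<le> e" unfolding n0_def using finE e by (rule Min_le)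
    ultimately show "e \<in> {n0..<n0 + degree (P (Suc j))}" by (simp add: ell_def)
  qed
  hence Ce: "C e = 0" if "e \<in> E" for e
    using power_basis_independent[OF L_subfield stage(6)[OF j] proc_Suc(2)[OF j], of E C n0 e]
      CL C0 Z0 that by (auto simp: Z_def)
  \<comment> \<open>Vectors with the same exponent of \<open>Z\<close> share their last entry, so a
    common power of \<open>th\<close> splits off and cutting that entry is injective. The cut
    vectors have equal weight at level j, which is what independence there needs.\<close>
  define X0 where "X0 = {B\<in>X. \<epsilon> B = \<epsilon> B0}"
  have same: "b B = b B0" if "B \<in> X0" for B
    using eps[of B] eps[OF B0] that by (auto simp: X0_def)
  have recover: "(cut B)(Suc j := b B0) = B" if "B \<in> X0" for B
    using same[OF that] by (auto simp: cut_def b_def)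
  have "C (\<epsilon> B0) = 0" using Ce B0 by (auto simp: E_def)
  hence "(\<Sum>B\<in>X0. f B * lam j (cut B)) * th ^ b B0 = 0"
    unfolding C_def X0_def[symmetric] sum_distrib_right using same by simp
  hence sumX0: "(\<Sum>B\<in>X0. f B * lam j (cut B)) = 0" using nz by (simp add: th_def)
  have injc: "inj_on cut X0" by (rule inj_on_inverseI[of _ "\<lambda>B. B(Suc j := b B0)"]) (rule recover)
  have "f ((cut B0)(Suc j := b B0)) = 0"
  proof (rule indepD[OF ind, where X = "cut ` X0" and w = "wt j (cut B0)" and f = "\<lambda>B. f (B(Suc j := b B0))" and B = "cut B0"])
    show "finite (cut ` X0)" using X(1) by (simp add: X0_def)
    show "cut ` X0 \<subseteq> ibox j" using cutbox by (auto simp: X0_def)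
    show "cut B0 \<in> cut ` X0" using B0 by (auto simp: X0_def)
    show "(\<Sum>B\<in>cut ` X0. f (B(Suc j := b B0)) * lam j B) = 0"
      using sumX0 by (subst sum.reindex[OF injc]) (simp add: recover)
  next
    fix B assume "B \<in> cut ` X0"
    then obtain B' where B': "B = cut B'" "B' \<in> X0" by blast
    hence B'X: "B' \<in> X" by (simp add: X0_def)
    show "f (B(Suc j := b B0)) \<in> K" using X(3) B' B'X recover by auto
    have "Q * (wt j (cut B') + b B' * v) + b B' * M = Q * (wt j (cut B0) + b B0 * v) + b B0 * M"
      using X(3) B0 B'X wtS by metis
    thus "wt j B = wt j (cut B0)" using same[OF B'(2)] Q0 B'(1) by simp
  qed
  moreover have "B0 \<in> X0" using B0 by (simp add: X0_def)
  ultimately show "f B0 = 0" using recover by simp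
qed

section \<open>Expansions in the phi_i with power series coefficients\<close>

text \<open>The x-exponent is fixed to 0 because powers of x are absorbed into the power series
  coefficients; this also makes the index set finite.\<close>

definition box0 where "box0 j = {B \<in> ibox j. B 0 = 0}"

definition mon where "mon j B = (\<Prod>p\<in>{1..j}. Phi_vec phi p ^ B p)"

definition low_leads where
  "low_leads j \<longleftrightarrow> (\<forall>p\<le>j. has_lead (subs (Phi_vec phi p) (pj j)) 0 (VV j p) (LL j p))"

lemma wt_upd0: "wt j (B(0 := n)) = n * VV j 0 + (\<Sum>p\<in>{1..j}. B p * VV j p)"
  unfolding wt_def atMost_atLeast0 by (subst sum.atLeast_Suc_atMost) (auto intro!: sum.cong)

lemma lam_upd0: "lam j (B(0 := n)) = LL j 0 ^ n * (\<Prod>p\<in>{1..j}. LL j p ^ B p)"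
  unfolding lam_def atMost_atLeast0 by (subst prod.atLeast_Suc_atMost) (auto intro!: prod.cong)

lemma has_lead_fps:
  assumes j: "j \<le> k" and g: "g \<noteq> 0"
  shows "has_lead (subs [:g:] (pj j)) 0 (subdegree g * VV j 0) (g $ subdegree g * LL j 0 ^ subdegree g)"
proof -
  define n where "n = subdegree g"
  have f0: "fst (pj j) $ 0 = 0" by (rule fst_pj_0[OF j])
  have g': "g = fps_X ^ n * fps_shift n g" unfolding n_def using fps_shift_times_fps_X_power'' by (metis mult.commute order_refl subdegree_decompose)
  have c0: "fps_shift n g $ 0 = g $ n" by simp
  define u where "u = fps_const (mu j ^ n) * (fps_shift n g oo fst (pj j))"
  have "g oo fst (pj j) = fst (pj j) ^ n * (fps_shift n g oo fst (pj j))"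
    by (subst g') (simp add: fps_compose_mult_distrib[OF f0] fps_compose_power[OF f0, symmetric] f0)
  also have "\<dots> = fps_X ^ (n * ee j) * u"
    by (simp add: fst_pj[OF j] u_def power_mult_distrib power_mult[symmetric] fps_const_power mult_ac)
  finally have "subs [:g:] (pj j) = monom (fps_X ^ (n * ee j)) 0 * [:u:]"
    by (simp add: subs_const monom_0)
  moreover have "u $ 0 = g $ n * mu j ^ n" by (simp add: u_def)
  moreover have "g $ n * mu j ^ n \<noteq> 0" using g mu_mem[OF j] by (simp add: n_def)
  ultimately show ?thesis
    unfolding has_lead_def n_def[symmetric] VV_0[OF j] LL_0[OF j]
    by (intro conjI exI[of _ "[:u:]"]) auto
qed

lemma has_lead_term:
  assumes j: "j \<le> k" and low: "low_leads j" and g: "g \<noteq> 0"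
  shows "has_lead (subs ([:g:] * mon j B) (pj j)) 0 (wt j (B(0 := subdegree g)))
     (g $ subdegree g * lam j (B(0 := subdegree g)))"
proof -
  note f0 = fst_pj_0[OF j]
  have 1: "has_lead (\<Prod>p\<in>{1..j}. subs (Phi_vec phi p) (pj j) ^ B p) 0
     (\<Sum>p\<in>{1..j}. B p * VV j p) (\<Prod>p\<in>{1..j}. LL j p ^ B p)"
  proof (rule has_lead_prod)
    fix p assume "p \<in> {1..j}"
    hence "has_lead (subs (Phi_vec phi p) (pj j)) 0 (VV j p) (LL j p)" using low by (simp add: low_leads_def)
    from has_lead_power[OF this, of "B p"]
    show "has_lead (subs (Phi_vec phi p) (pj j) ^ B p) 0 (B p * VV j p) (LL j p ^ B p)" by simp
  qed simp
  show ?thesis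
    using has_lead_mult[OF has_lead_fps[OF j g] 1]
    unfolding subs_mult[OF f0] mon_def subs_prod[OF f0] subs_power[OF f0] wt_upd0 lam_upd0
    by (simp add: mult_ac)
qed

text \<open>Each summand leads at the vector whose x-entry is the subdegree of its coefficient.
  Distinct summands give distinct vectors, so \<open>indep\<close> excludes cancellation among those
  of least weight.\<close>

lemma has_lead_expansion:
  assumes j: "j \<le> k" and ind: "indep j" and low: "low_leads j"
    and X: "finite X" "X \<subseteq> box0 j" "X \<noteq> {}" and g: "\<And>B. B \<in> X \<Longrightarrow> g B \<in> fps_over K \<and> g B \<noteq> 0"
  defines "\<omega> \<equiv> \<lambda>B. wt j (B(0 := subdegree (g B)))"
  defines "w \<equiv> Min (\<omega> ` X)"
  shows "has_lead (subs (\<Sum>B\<in>X. [:g B:] * mon j B) (pj j)) 0 w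
     (\<Sum>B\<in>{B\<in>X. \<omega> B = w}. g B $ subdegree (g B) * lam j (B(0 := subdegree (g B))))"
  unfolding subs_sum
proof (rule has_lead_sum[OF X(1)])
  show "has_lead (subs ([:g B:] * mon j B) (pj j)) 0 (\<omega> B) (g B $ subdegree (g B) * lam j (B(0 := subdegree (g B))))"
    if "B \<in> X" for B
    unfolding \<omega>_def using has_lead_term[OF j low] g[OF that] by blast
  show "w \<le> \<omega> B" if "B \<in> X" for B
    unfolding w_def using X(1) that by simp
  define Y where "Y = {B\<in>X. \<omega> B = w}"
  define up where "up B = B(0 := subdegree (g B))" for B
  have bk: "(up B)(0 := 0) = B" if "B \<in> X" for B
  proof -
    have "B 0 = 0" using that X(2) by (auto simp: box0_def)
    thus ?thesis by (auto simp: up_def)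
  qed
  have inj: "inj_on up Y"
    by (rule inj_on_inverseI[of _ "\<lambda>B. B(0 := 0)"]) (use bk in \<open>auto simp: Y_def\<close>)
  have "w \<in> \<omega> ` X" unfolding w_def using X by (intro Min_in) auto
  then obtain B0 where B0: "B0 \<in> Y" by (auto simp: Y_def)
  show "(\<Sum>B\<in>{B\<in>X. \<omega> B = w}. g B $ subdegree (g B) * lam j (B(0 := subdegree (g B)))) \<noteq> 0"
  proof
    assume 0: "(\<Sum>B\<in>{B\<in>X. \<omega> B = w}. g B $ subdegree (g B) * lam j (B(0 := subdegree (g B)))) = 0"
    \<comment> \<open>Scalars are indexed by full vectors: the x-entry tells which coefficient of
      the series belonging to the remaining entries to take.\<close>
    define f where "f B = g (B(0 := 0)) $ B 0" for B
    have fup: "f (up B) = g B $ subdegree (g B)" if "B \<in> X" for B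
      unfolding f_def bk[OF that] by (simp add: up_def)
    have "f (up B0) = 0"
    proof (rule indepD[OF ind, where X = "up ` Y" and w = w and f = f and B = "up B0"])
      show "finite (up ` Y)" using X(1) by (simp add: Y_def)
      show "up ` Y \<subseteq> ibox j" using X(2) by (auto simp: Y_def up_def box0_def ibox_def)
      show "up B0 \<in> up ` Y" using B0 by blast
      show "wt j B = w" if "B \<in> up ` Y" for B using that by (auto simp: Y_def up_def \<omega>_def)
      show "f B \<in> K" if "B \<in> up ` Y" for B
        using that fup g by (auto simp: Y_def fps_over_def)
      have "(\<Sum>B\<in>up ` Y. f B * lam j B) = (\<Sum>B\<in>Y. f (up B) * lam j (up B))"
        by (subst sum.reindex[OF inj]) simp
      also have "\<dots> = 0" using 0 fup unfolding Y_def up_def by simp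
      finally show "(\<Sum>B\<in>up ` Y. f B * lam j B) = 0" .
    qed
    thus False using fup g B0 by (auto simp: Y_def)
  qed
qed

lemma box0_Suc:
  "box0 (Suc j) = (\<lambda>(B, i). B(Suc j := i)) ` (box0 j \<times> {..<q (Suc j) * ell (Suc j)})"
  "inj_on (\<lambda>(B, i). B(Suc j := i)) (box0 j \<times> (UNIV :: nat set))"
proof -
  show "inj_on (\<lambda>(B, i). B(Suc j := i)) (box0 j \<times> (UNIV :: nat set))"
  proof (rule inj_on_inverseI[of _ "\<lambda>B. (B(Suc j := 0), B (Suc j))"])
    fix x :: "(nat \<Rightarrow> nat) \<times> nat" assume "x \<in> box0 j \<times> UNIV"
    then obtain B i where x: "x = (B, i)" "B \<in> box0 j" by auto
    hence "B (Suc j) = 0" by (simp add: box0_def ibox_def)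
    thus "(\<lambda>B. (B(Suc j := 0), B (Suc j))) (case x of (B, i) \<Rightarrow> B(Suc j := i)) = x"
      using x(1) by auto
  qed
  show "box0 (Suc j) = (\<lambda>(B, i). B(Suc j := i)) ` (box0 j \<times> {..<q (Suc j) * ell (Suc j)})"
  proof (intro equalityI subsetI)
    fix B assume B: "B \<in> box0 (Suc j)"
    hence "B(Suc j := 0) \<in> box0 j" "B (Suc j) < q (Suc j) * ell (Suc j)"
      by (auto simp: box0_def ibox_def)
    thus "B \<in> (\<lambda>(B, i). B(Suc j := i)) ` (box0 j \<times> {..<q (Suc j) * ell (Suc j)})"
      by (intro image_eqI[of _ _ "(B(Suc j := 0), B (Suc j))"]) auto
  qed (auto simp: box0_def ibox_def)
qed

lemma box0_0: "box0 0 = {\<lambda>_. 0}"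
proof (intro equalityI subsetI)
  fix B assume B: "B \<in> box0 0"
  have "B p = 0" for p using B by (cases "p = 0") (auto simp: box0_def ibox_def)
  thus "B \<in> {\<lambda>_. 0}" by auto
qed (simp add: box0_def ibox_def)

lemma finite_box0: "finite (box0 j)"
  by (induction j) (simp_all add: box0_0 box0_Suc(1))

lemma mon_Suc: "mon (Suc j) (B(Suc j := i)) = mon j B * phi j ^ i"
proof -
  have "(\<Prod>p\<in>{1..j}. Phi_vec phi p ^ (B(Suc j := i)) p) = mon j B"
    unfolding mon_def by (rule prod.cong) auto
  moreover have "Phi_vec phi (Suc j) = phi j" by (simp add: Phi_vec_def)
  ultimately show ?thesis
    unfolding mon_def[of "Suc j"] by (subst prod.nat_ivl_Suc') (simp_all add: mult.commute)
qed

text \<open>The expansion in the last phi has digits below its degree, to which the previous level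
  applies; the digit count q \<ell> is the ratio of consecutive degrees.\<close>

lemma expansion_exists:
  assumes "j \<le> k" and "\<And>i. i < j \<Longrightarrow> degree (phi i) = ff i * ee i"
    and "h \<in> R" "degree h < ff j * ee j"
  shows "\<exists>g. (\<forall>B. g B \<in> fps_over K) \<and> h = (\<Sum>B\<in>box0 j. [:g B:] * mon j B)"
  using assms
proof (induction j arbitrary: h)
  case 0
  hence "h = [:coeff h 0:]" by (simp add: degree_eq_zeroE) (metis degree_eq_zeroE coeff_pCons_0)
  moreover have "coeff h 0 \<in> fps_over K" using poly_overD[OF 0(3)] .
  ultimately show ?case by (intro exI[of _ "\<lambda>_. coeff h 0"]) (simp add: box0_0 mon_def)
next
  case (Suc j)
  define n where "n = q (Suc j) * ell (Suc j)"
  have pp: "phi j \<in> R" "lead_coeff (phi j) = 1" using phi_props[of j] Suc.prems(1) by auto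
  have dp: "degree (phi j) = ff j * ee j" using Suc.prems(2) by simp
  have d0: "degree (phi j) > 0" using dp ff_pos[of j] ee_pos[of j] Suc.prems(1) by simp
  have dh: "degree h < n * degree (phi j)" using Suc.prems(4) by (simp add: dp n_def mult_ac)
  obtain a where a': "(\<forall>i. a i \<in> R \<and> degree (a i) < degree (phi j)) \<and> h = (\<Sum>i<n. a i * phi j ^ i)"
    using base_expansion[OF is_subring_fps_over[OF K_subring] pp d0 Suc.prems(3) dh] by (elim exE)
  hence a: "\<And>i. a i \<in> R" "\<And>i. degree (a i) < degree (phi j)" "h = (\<Sum>i<n. a i * phi j ^ i)"
    by simp_all
  define good where "good i g \<longleftrightarrow> (\<forall>B. g B \<in> fps_over K) \<and> a i = (\<Sum>B\<in>box0 j. [:g B:] * mon j B)" for i g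
  have "\<exists>g. good i g" for i
  proof -
    have "degree (a i) < ff j * ee j" using a(2)[of i] dp by simp
    moreover have "j \<le> k" "\<And>i. i < j \<Longrightarrow> degree (phi i) = ff i * ee i" using Suc.prems(1,2) by simp_all
    ultimately show ?thesis unfolding good_def using Suc.IH a(1) by blast
  qed
  then obtain g where "\<And>i. good i (g i)" by metis
  hence g: "\<And>i B. g i B \<in> fps_over K" "\<And>i. a i = (\<Sum>B\<in>box0 j. [:g i B:] * mon j B)"
    by (simp_all add: good_def)
  define g' where "g' B = g (B (Suc j)) (B(Suc j := 0))" for B
  have "(\<Sum>B\<in>box0 (Suc j). [:g' B:] * mon (Suc j) B)
     = (\<Sum>(B, i)\<in>box0 j \<times> {..<n}. [:g i B:] * mon j B * phi j ^ i)"
    unfolding box0_Suc(1) n_def[symmetric]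
  proof (subst sum.reindex)
    show "inj_on (\<lambda>(B, i). B(Suc j := i)) (box0 j \<times> {..<n})"
      by (rule inj_on_subset[OF box0_Suc(2)]) auto
    have "B(Suc j := 0) = B" if "B \<in> box0 j" for B
      using that by (auto simp: box0_def ibox_def fun_upd_idem_iff)
    thus "sum ((\<lambda>B. [:g' B:] * mon (Suc j) B) \<circ> (\<lambda>(B, i). B(Suc j := i))) (box0 j \<times> {..<n})
      = (\<Sum>(B, i)\<in>box0 j \<times> {..<n}. [:g i B:] * mon j B * phi j ^ i)"
      by (intro sum.cong refl) (auto simp: mon_Suc g'_def)
  qed
  also have "\<dots> = (\<Sum>i<n. a i * phi j ^ i)"
    by (subst sum.cartesian_product[symmetric], subst sum.swap) (simp add: g(2) sum_distrib_right)
  finally have "h = (\<Sum>B\<in>box0 (Suc j). [:g' B:] * mon (Suc j) B)" using a(3) by simp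
  moreover have "\<forall>B. g' B \<in> fps_over K" using g(1) by (simp add: g'_def)
  ultimately show ?case by blast
qed

lemma has_lead_low_degree:
  assumes j: "j \<le> k" and ind: "indep j" and low: "low_leads j"
    and deg: "\<And>i. i < j \<Longrightarrow> degree (phi i) = ff i * ee i"
    and h: "h \<in> R" "degree h < ff j * ee j" "h \<noteq> 0"
  shows "\<exists>w b. has_lead (subs h (pj j)) 0 w b"
proof -
  have "\<exists>g. (\<forall>B. g B \<in> fps_over K) \<and> h = (\<Sum>B\<in>box0 j. [:g B:] * mon j B)"
    by (rule expansion_exists[OF j _ h(1,2)]) (rule deg)
  then obtain g where "(\<forall>B. g B \<in> fps_over K) \<and> h = (\<Sum>B\<in>box0 j. [:g B:] * mon j B)"
    by (elim exE)
  hence g: "\<And>B. g B \<in> fps_over K" "h = (\<Sum>B\<in>box0 j. [:g B:] * mon j B)" by simp_all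
  define X where "X = {B \<in> box0 j. g B \<noteq> 0}"
  have hX: "h = (\<Sum>B\<in>X. [:g B:] * mon j B)"
    unfolding g(2) X_def by (rule sum.mono_neutral_right) (auto simp: finite_box0)
  have X: "finite X" "X \<subseteq> box0 j" using finite_box0 by (auto simp: X_def)
  have "X \<noteq> {}" using hX h(3) by auto
  moreover have "g B \<in> fps_over K \<and> g B \<noteq> 0" if "B \<in> X" for B using g(1) that by (simp add: X_def)
  ultimately have "\<exists>w b. has_lead (subs (\<Sum>B\<in>X. [:g B:] * mon j B) (pj j)) 0 w b"
    using has_lead_expansion[OF j ind low X, of g] by blast
  thus ?thesis using hX by simp
qed

section \<open>The invariant: degrees and leading forms of the phi_j\<close>

text \<open>Level j knows the degrees only of the phi_i with i < j. The degree of phi_j is derived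
  from this, and its leading form then starts level j+1.\<close>

definition invar where
  "invar j \<longleftrightarrow> indep j \<and> low_leads j \<and> (\<forall>i<j. degree (phi i) = ff i * ee i)"

lemma invar_low_degree:
  assumes "j \<le> k" "invar j" "h \<in> R" "degree h < ff j * ee j" "h \<noteq> 0"
  shows "\<exists>w b. has_lead (subs h (pj j)) 0 w b"
  by (rule has_lead_low_degree[OF assms(1)]) (use assms in \<open>auto simp: invar_def\<close>)

lemma low_degree_no_root:
  assumes "j \<le> k" "invar j" "h \<in> R" "degree h < ff j * ee j" "h \<noteq> 0"
  shows "coeff (subs h (pj j)) 0 \<noteq> 0"
proof -
  obtain w b where l: "has_lead (subs h (pj j)) 0 w b" using invar_low_degree[OF assms] by (elim exE)
  show ?thesis
  proof
    assume "coeff (subs h (pj j)) 0 = 0"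
    thus False using has_lead_coeff[OF l] has_lead_nonzero[OF l] by simp
  qed
qed

text \<open>The generator count provides some \<open>p\<close> vanishing along pi_j. The
  pseudo-remainder of phi_j by \<open>p\<close> vanishes there too and has lower degree, so it is
  zero and irreducibility compares the degrees. Pseudo-division is used since \<open>p\<close> need
  not be monic.\<close>

lemma phi_degree:
  assumes j: "j \<le> k" and inv: "invar j"
  shows "degree (phi j) = ff j * ee j"
proof -
  have D0: "ff j * ee j > 0" using ff_pos[OF j] ee_pos[OF j] by simp
  obtain \<zeta> where gen: "\<forall>x\<in>L j. \<exists>\<kappa>. (\<forall>i<ff j. \<kappa> i \<in> K) \<and> x = (\<Sum>i<ff j. \<kappa> i * \<zeta> i)"
    using tower_generated[OF j] by (elim exE)
  have T: "coeff (snd (pj j)) 0 \<in> fps_over (L j)"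
    using snd_pj[OF j] by (intro poly_overD) simp
  have "\<exists>p\<in>R. p \<noteq> 0 \<and> degree p \<le> ff j * ee j \<and>
    poly (map_poly (\<lambda>h. h oo (fps_const (mu j) * fps_X ^ ee j)) p) (coeff (snd (pj j)) 0) = 0"
    by (rule annihilating_polynomial[OF K L_subfield _ _ ee_pos[OF j] bspec[OF gen] T])
      (use mu_mem[OF j] in auto)
  then obtain p where p: "p \<in> R" "p \<noteq> 0" "degree p \<le> ff j * ee j"
    "poly (map_poly (\<lambda>h. h oo (fps_const (mu j) * fps_X ^ ee j)) p) (coeff (snd (pj j)) 0) = 0"
    by (elim bexE conjE)
  have p0: "coeff (subs p (pj j)) 0 = 0"
    unfolding coeff_0_subs fst_pj[OF j] by (rule p(4))
  \<comment> \<open>Nothing nonzero of smaller degree vanishes along pi_j, so the upper bound from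
    the count is attained.\<close>
  have dp: "degree p = ff j * ee j"
    using low_degree_no_root[OF j inv p(1) _ p(2)] p0 p(3) by linarith
  note pp = phi_props[OF j]
  obtain M Q r where Qr: "Q \<in> R" "r \<in> R" "smult (lead_coeff p ^ M) (phi j) = p * Q + r" "r = 0 \<or> degree r < degree p"
    using pseudo_division_over[OF is_subring_fps_over[OF K_subring] p(1,2) pp(1)] by (elim exE conjE)
  have f0: "fst (pj j) $ 0 = 0" by (rule fst_pj_0[OF j])
  have "subs (smult (lead_coeff p ^ M) (phi j)) (pj j) = subs p (pj j) * subs Q (pj j) + subs r (pj j)"
    unfolding Qr(3) subs_add subs_mult[OF f0] ..
  hence "coeff (subs r (pj j)) 0 = 0"
    unfolding subs_smult[OF f0] by (metis add_0 coeff_add mult_zero_left mult_zero_right p0 pp(4) coeff_mult_0)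
  hence "r = 0"
    using low_degree_no_root[OF j inv Qr(2)] Qr(4) dp by auto
  hence "smult (lead_coeff p ^ M) (phi j) = p * Q" using Qr(3) by simp
  moreover have "lead_coeff p ^ M \<noteq> 0" using p(2) by simp
  ultimately have "degree (phi j) = degree p"
    using irreducible_in_degree[OF K pp(3,2) p(1,2)] D0 dp Qr(1) by metis
  thus ?thesis using dp by simp
qed

text \<open>Since \<open>\<phi>\<^sub>j \<circ> \<pi>\<^sub>j\<close> vanishes at \<open>y = 0\<close>, its leading form is read off from its \<open>y\<close>-derivative,
  to which the low degree case applies.\<close>
lemma phi_lead:
  assumes j: "j \<le> k" and inv: "invar j"
  shows "\<exists>v b. has_lead (subs (phi j) (pj j)) 1 v b"
proof -
  define D where "D = ff j * ee j"
  define A where "A = subs (phi j) (pj j)"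
  note pp = phi_props[OF j]
  have f0: "fst (pj j) $ 0 = 0" by (rule fst_pj_0[OF j])
  have D0: "D > 0" using ff_pos[OF j] ee_pos[OF j] by (simp add: D_def)
  have dphi: "degree (phi j) = D" using phi_degree[OF j inv] by (simp add: D_def)
  have DF: "D \<le> degree F" using degree_le_F[OF j] by (simp add: D_def)
  have nz: "of_nat i \<noteq> (0::'a)" if "0 < i" "i \<le> D" for i
    using of_nat_nonzero that DF by simp
  obtain S \<alpha> r where S: "snd (pj j) = [:S, fps_const \<alpha> * fps_X ^ r:]" "\<alpha> \<noteq> 0"
    using snd_pj[OF j] by (elim exE conjE)
  define h where "h = pderiv (phi j)"
  have hR: "h \<in> R" unfolding h_def by (intro pderiv_poly_over is_subring_fps_over K_subring pp)
  have cD: "coeff h (D - 1) = of_nat D"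
    using D0 pp(2) dphi by (simp add: h_def coeff_pderiv)
  have "of_nat D \<noteq> (0 :: 'a fps)"
    using nz[of D] D0 by (metis fps_of_nat fps_const_eq_0_iff order_refl)
  hence h0: "h \<noteq> 0" using cD by auto
  have "degree h \<le> D - 1" unfolding h_def by (rule degree_le) (auto simp: coeff_pderiv coeff_eq_0 dphi)
  hence dh: "degree h < ff j * ee j" unfolding D_def[symmetric] using D0 by linarith
  obtain w b where lh: "has_lead (subs h (pj j)) 0 w b"
    using invar_low_degree[OF j inv hR dh h0] by (elim exE)
  have "pderiv A = subs h (pj j) * [:fps_const \<alpha> * fps_X ^ r:]"
    unfolding A_def pderiv_subs[OF f0] h_def S(1) by (simp add: pderiv_pCons)
  moreover have "has_lead [:fps_const \<alpha> * fps_X ^ r:] 0 r \<alpha>"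
    using has_lead_monom[OF S(2), of r 0] by (simp add: monom_0)
  ultimately have "has_lead (pderiv A) 0 (w + r) (b * \<alpha>)" using has_lead_mult[OF lh] by fastforce
  then obtain u where u: "pderiv A = monom (fps_X ^ (w + r)) 0 * u" "coeff u 0 $ 0 \<noteq> 0"
    unfolding has_lead_def by auto
  define v where "v = w + r"
  have cu: "of_nat (Suc i) * coeff A (Suc i) = fps_X ^ v * coeff u i" for i
    using arg_cong[OF u(1), of "\<lambda>p. coeff p i"] by (simp add: coeff_pderiv v_def monom_0)
  have dA: "degree A \<le> D"
    unfolding A_def dphi[symmetric] by (rule degree_subs_le) (simp add: S(1))
  \<comment> \<open>Integration in y: the divisors i + 1 are at most D and hence invertible.\<close>
  have cA: "coeff A (Suc i) = fps_X ^ v * (fps_const (1 / of_nat (Suc i)) * coeff u i)" if "i < D" for i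
  proof -
    have "fps_const (1 / of_nat (Suc i)) * of_nat (Suc i) = (1 :: 'a fps)"
      using nz[of "Suc i"] that by (simp only: fps_of_nat[symmetric] fps_const_mult) (simp del: of_nat_Suc)
    hence "coeff A (Suc i) = fps_const (1 / of_nat (Suc i)) * (of_nat (Suc i) * coeff A (Suc i))"
      by (simp only: mult.assoc[symmetric] mult_1_left)
    thus ?thesis unfolding cu by (simp only: mult_ac)
  qed
  \<comment> \<open>The cofactor of x^v y in \<open>A\<close>. Its constant term is that of
    \<open>u\<close>, because the divisor in degree 0 is 1.\<close>
  define B where "B = (\<Sum>i<D. monom (fps_const (1 / of_nat (Suc i)) * coeff u i) i)"
  have cB: "coeff B i = (if i < D then fps_const (1 / of_nat (Suc i)) * coeff u i else 0)" for i
    unfolding B_def by (simp add: coeff_sum)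
  have "A = monom (fps_X ^ v) 1 * B"
  proof (rule poly_eqI)
    fix l
    show "coeff A l = coeff (monom (fps_X ^ v) 1 * B) l"
    proof (cases l)
      case 0
      thus ?thesis using pp(4) by (simp add: A_def coeff_monom_mult)
    next
      case (Suc i)
      have "coeff A (Suc i) = 0" if "\<not> i < D" using dA that by (intro coeff_eq_0) simp
      thus ?thesis using Suc cA[of i] by (simp add: coeff_monom_mult cB del: of_nat_Suc)
    qed
  qed
  moreover have "coeff B 0 $ 0 \<noteq> 0" using D0 u(2) by (simp add: cB)
  ultimately show ?thesis unfolding has_lead_def A_def[symmetric] by blast
qed

lemma phi_lead':
  assumes "j \<le> k" "invar j"
  shows "has_lead (subs (Phi_vec phi (Suc j)) (pj j)) 1 (VV j (Suc j)) (LL j (Suc j))"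
proof -
  obtain v b where l: "has_lead (subs (phi j) (pj j)) 1 v b"
    using phi_lead[OF assms] by (elim exE)
  moreover have "Phi_vec phi (Suc j) = phi j" by (simp add: Phi_vec_def)
  ultimately show ?thesis unfolding VV_def LL_def using has_lead_valx[OF l] by simp
qed

lemma invar_0: "invar 0"
proof -
  have "has_lead (subs (Phi_vec phi 0) (pj 0)) 0 (VV 0 0) (LL 0 0)"
    using has_lead_x[of 0] VV_0[of 0] LL_0[of 0] by simp
  thus ?thesis using indep_0 by (simp add: invar_def low_leads_def)
qed

text \<open>A monic polynomial of degree 1 vanishing at the shift c_0 becomes y itself. This
  exactness is what makes a first stage with m = 0 tractable.\<close>

lemma phi_0: "subs (phi 0) (pj 0) = [:0, 1:]"
proof -
  have d: "degree (phi 0) = 1" using phi_degree[OF _ invar_0] by simp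
  note pp = phi_props[OF le0]
  obtain b0 b1 where b: "phi 0 = [:b0, b1:]"
    using d by (metis One_nat_def degree_eq_zeroE degree_pCons_eq_if nat.inject pCons_cases zero_neq_one)
  with d pp(2) have "b1 = 1" by (auto split: if_splits)
  hence "subs (phi 0) (pj 0) = [:b0 + c 0, 1:]"
    by (simp add: b subs_pCons pj_0 ta_props)
  with pp(4) show ?thesis by simp
qed

lemma has_lead_Suc:
  assumes j: "j < k" and l: "has_lead (subs h (pj j)) i v b"
    and or: "m (Suc j) > 0 \<or> subs h (pj j) = monom (fps_X ^ v) i"
  shows "has_lead (subs h (pj (Suc j))) 0 (q (Suc j) * v + nat (m (Suc j)) * i)
     (b * z (Suc j) ^ (t (Suc j) * v + nat (s (Suc j)) * i))"
  unfolding subs_pj_Suc[OF j] sg_def ta_def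
  by (intro has_lead_subs_tau has_lead_subs_sigma l or c_Suc_0[OF j])
    (use stage[OF j] in auto)

text \<open>A leading form x^v y^i turns into one with i = 0, weight q v + m i and an extra power t
  v + s i of z. So phi_j joins the elements without y, and these rules are the hypotheses of
  \<open>indep_Suc\<close>.\<close>

lemma invar_Suc:
  assumes j: "j < k" and inv: "invar j"
  shows "invar (Suc j)"
proof -
  have jk: "j \<le> k" using j by simp
  define Q where "Q = q (Suc j)"
  define Z where "Z = z (Suc j)"
  have low: "has_lead (subs (Phi_vec phi p) (pj j)) 0 (VV j p) (LL j p)" if "p \<le> j" for p
    using inv that by (simp add: invar_def low_leads_def)
  note top = phi_lead'[OF jk inv]
  have start: "m (Suc j) > 0 \<or> (j = 0 \<and> p \<le> 1)" if "p \<le> Suc j" for p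
    using stage(3)[OF j] that by auto
  have l1: "has_lead (subs (Phi_vec phi p) (pj (Suc j))) 0 (Q * VV j p) (LL j p * Z ^ (t (Suc j) * VV j p))"
    if p: "p \<le> j" for p
  proof -
    have "m (Suc j) > 0 \<or> subs (Phi_vec phi p) (pj j) = monom (fps_X ^ VV j p) 0"
    proof (cases "m (Suc j) > 0")
      case False
      hence "j = 0" "p = 0" using stage(3)[OF j] p by auto
      thus ?thesis by (simp add: Phi_vec_def subs_const pj_0 ta_props VV_0 monom_0)
    qed simp
    from has_lead_Suc[OF j low[OF p] this] show ?thesis by (simp add: Q_def Z_def)
  qed
  have "m (Suc j) > 0 \<or> subs (Phi_vec phi (Suc j)) (pj j) = monom (fps_X ^ VV j (Suc j)) 1"
  proof (cases "m (Suc j) > 0")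
    case False
    hence j0: "j = 0" using stage(3)[OF j] by auto
    have e: "subs (Phi_vec phi (Suc 0)) (pj 0) = monom (fps_const 1 * fps_X ^ 0) 1"
      using phi_0 by (simp add: Phi_vec_def monom_altdef)
    have "VV 0 (Suc 0) = 0"
      unfolding VV_def e by (rule has_lead_valx(1)[OF has_lead_monom]) simp
    thus ?thesis using e j0 by simp
  qed simp
  from has_lead_Suc[OF j top this]
  have l2: "has_lead (subs (Phi_vec phi (Suc j)) (pj (Suc j))) 0 (Q * VV j (Suc j) + nat (m (Suc j)))
     (LL j (Suc j) * Z ^ (t (Suc j) * VV j (Suc j) + nat (s (Suc j))))"
    by (simp add: Q_def Z_def)
  have V1: "VV (Suc j) p = Q * VV j p" "LL (Suc j) p = LL j p * Z ^ (t (Suc j) * VV j p)" if "p \<le> j" for p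
    using has_lead_valx[OF l1[OF that]] by (simp_all add: VV_def[of "Suc j"] LL_def[of "Suc j"])
  have V2: "VV (Suc j) (Suc j) = Q * VV j (Suc j) + nat (m (Suc j))"
    "LL (Suc j) (Suc j) = LL j (Suc j) * Z ^ (t (Suc j) * VV j (Suc j) + nat (s (Suc j)))"
    using has_lead_valx[OF l2] by (simp_all add: VV_def[of "Suc j"] LL_def[of "Suc j"])
  have "low_leads (Suc j)"
    unfolding low_leads_def
  proof (intro allI impI)
    fix p assume "p \<le> Suc j"
    thus "has_lead (subs (Phi_vec phi p) (pj (Suc j))) 0 (VV (Suc j) p) (LL (Suc j) p)"
      using l1[of p] V1[of p] l2 V2 by (cases "p = Suc j") auto
  qed
  moreover have "indep (Suc j)"
  proof (rule indep_Suc[OF j])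
    show "indep j" using inv by (simp add: invar_def)
    show "LL j p \<in> L j" if "p \<le> Suc j" for p
    proof (cases "p = Suc j")
      case True
      show ?thesis unfolding True by (rule LL_mem[OF jk _ top]) (use j in simp)
    next
      case False
      with that have p: "p \<le> j" by simp
      show ?thesis by (rule LL_mem[OF jk _ low[OF p]]) (use p j in simp)
    qed
    show "LL j (Suc j) \<noteq> 0" by (rule has_lead_nonzero[OF top])
  qed (use V1 V2 in \<open>simp_all add: Q_def Z_def\<close>)
  moreover have "degree (phi i) = ff i * ee i" if "i < Suc j" for i
    using that inv phi_degree[OF jk inv] by (cases "i = j") (auto simp: invar_def)
  ultimately show ?thesis by (simp add: invar_def)
qed

lemma invar: "j \<le> k \<Longrightarrow> invar j"
  by (induction j) (auto intro: invar_0 invar_Suc)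

section \<open>Factorisation of F along the substitutions\<close>

text \<open>The cofactor \<open>A\<close> accumulates the factors x^a U of all stages. Its being
  exactly 1 at level 0 covers a first stage with m = 0.\<close>

lemma F_factor:
  "j \<le> k \<Longrightarrow> \<exists>A v b. subs F (pj j) = A * H j \<and> has_lead A 0 v b \<and> (j = 0 \<longrightarrow> A = 1)"
proof (induction j)
  case 0
  have "subs F (pj 0) = 1 * H 0" using proc_0(2) by (simp add: pj_0)
  thus ?case using has_lead_1 by blast
next
  case (Suc j)
  hence j: "j < k" by simp
  obtain A v b where A: "subs F (pj j) = A * H j" "has_lead A 0 v b" "j = 0 \<longrightarrow> A = 1"
    using Suc.IH j by (meson less_imp_le)
  have sf: "fst (sg (Suc j)) $ 0 = 0" using sg_props(3)[OF j] .
  have tf: "fst (ta (Suc j)) $ 0 = 0" using ta_props(3) .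
  define X where "X = [:fps_X ^ a (Suc j):] * U (Suc j)"
  have or: "m (Suc j) > 0 \<or> A = monom (fps_X ^ v) 0"
  proof (cases "m (Suc j) > 0")
    case False
    hence "A = 1" using stage(3)[OF j] A(3) by auto
    moreover have "v = 0" using A(2) has_lead_1 has_lead_unique(2) \<open>A = 1\<close> by blast
    ultimately show ?thesis by (simp add: monom_0)
  qed simp
  have s0: "s (Suc j) \<ge> 0" using stage(8)[OF j] by simp
  have lA: "has_lead (subs (subs A (sg (Suc j))) (ta (Suc j))) 0 (q (Suc j) * v) (b * z (Suc j) ^ (t (Suc j) * v))"
    using has_lead_subs_tau[OF _ c_Suc_0[OF j]]
      has_lead_subs_sigma[OF A(2) stage(1)[OF j] stage(5)[OF j] s0 stage(2)[OF j] or, of "t (Suc j)"]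
    by (simp add: sg_def ta_def)
  have "has_lead X 0 (a (Suc j)) (coeff (U (Suc j)) 0 $ 0)"
    unfolding has_lead_def X_def using proc_Suc(5)[OF j] by (auto simp: monom_0 intro!: exI[of _ "U (Suc j)"])
  hence lX: "has_lead (subs X (ta (Suc j))) 0 (a (Suc j)) (coeff (U (Suc j)) 0 $ 0)"
    unfolding ta_def by (rule has_lead_subs_tau[OF _ c_Suc_0[OF j]])
  have "subs F (pj (Suc j)) = subs (subs A (sg (Suc j)) * (X * G (Suc j))) (ta (Suc j))"
    unfolding subs_pj_Suc[OF j] A(1) subs_mult[OF sf] proc_Suc(4)[OF j] X_def by simp
  also have "\<dots> = subs (subs A (sg (Suc j))) (ta (Suc j)) * subs X (ta (Suc j)) * H (Suc j)"
    unfolding subs_mult[OF tf] proc_Suc(8)[OF j] by (simp only: mult.assoc)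
  finally show ?case using has_lead_mult[OF lA lX] by auto
qed

end

section \<open>Comparison of coefficients on the Newton polygon\<close>

lemma coeff_monom_0_mult: "coeff (monom (fps_X ^ v) 0 * M) l $ n = (if n < v then 0 else coeff M l $ (n - v))"
  for M :: "'a::field fps poly"
  by (simp add: monom_0 fps_X_power_mult_nth)

text \<open>A positive supporting line at a point of the Newton polygon of \<open>H\<close> bounds all \<open>T\<^sub>l\<close> from below:
  the extreme \<open>T\<^sub>l\<close> cannot be cancelled and so contributes to the support of \<open>u H\<close>.\<close>
lemma newton_compare:
  fixes H u :: "'a::field fps poly"
  assumes H: "weierstrass H N" "N > 0" and u: "coeff u 0 $ 0 \<noteq> 0"
    and J: "finite J" and T: "\<And>l. l \<in> J \<Longrightarrow> has_lead (T l) l (w l) (\<beta> l)"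
    and eq: "monom (fps_X ^ v) 0 * (u * H) = (\<Sum>l\<in>J. T l)"
    and p: "(real i, real n) \<in> newton_polygon H"
  shows "coeff u 0 $ 0 * coeff H i $ n = (if i \<in> J \<and> w i = n + v then \<beta> i else 0)"
proof -
  obtain r where r: "r > 0" and sup: "\<And>l. coeff H l \<noteq> 0 \<Longrightarrow> real n + r * real i \<le> real (subdegree (coeff H l)) + r * real l"
    using weierstrass_supporting_line[OF H p] by auto
  have sup': "real n + r * real i \<le> real x + r * real l" if "coeff H l $ x \<noteq> 0" for l x
  proof -
    have "coeff H l \<noteq> 0" using that by auto
    moreover have "subdegree (coeff H l) \<le> x" using that by (rule subdegree_leI)
    ultimately show ?thesis using sup[of l] by linarith
  qed
  have uH: "coeff (u * H) l $ x = (\<Sum>(l', x')\<in>{..l} \<times> {..x}. coeff u (l - l') $ (x - x') * coeff H l' $ x')" for l x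
  proof -
    have "coeff (u * H) l $ x = (\<Sum>l'\<le>l. (coeff H l' * coeff u (l - l')) $ x)"
      by (simp add: coeff_mult fps_sum_nth mult.commute[of u])
    also have "\<dots> = (\<Sum>l'\<le>l. \<Sum>x'\<le>x. coeff u (l - l') $ (x - x') * coeff H l' $ x')"
      by (simp add: fps_mult_nth atLeast0AtMost mult.commute)
    finally show ?thesis by (simp add: sum.cartesian_product)
  qed
  have Tsum: "coeff (\<Sum>l\<in>J. T l) l' $ x = (\<Sum>l\<in>J. coeff (T l) l' $ x)" for l' x
    by (simp add: coeff_sum fps_sum_nth)
  \<comment> \<open>If no lead point lies below the line of slope -r through (l', x), then
    \<open>T l\<close> reaches this point only by leading there: it is divisible by y^l x^(w l), and
    r > 0 excludes l < l'.\<close>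
  have Tc: "coeff (\<Sum>l\<in>J. T l) l' $ x = (if l' \<in> J \<and> w l' = x then \<beta> l' else 0)"
    if tight: "\<And>l. l \<in> J \<Longrightarrow> real x + r * real l' \<le> real (w l) + r * real l" for l' x
  proof -
    have c: "coeff (T l) l' $ x = (if l = l' \<and> w l' = x then \<beta> l' else 0)" if l: "l \<in> J" for l
    proof (cases "coeff (T l) l' $ x = 0")
      case True
      thus ?thesis using has_lead_coeff[OF T[OF l]] has_lead_nonzero[OF T[OF l]] by auto
    next
      case False
      note sp = has_lead_support[OF T[OF l] False]
      have "r * real l' \<le> r * real l" using tight[OF l] sp(2) by linarith
      hence "l' \<le> l" using r by simp
      hence ll: "l = l'" using sp(1) by simp
      moreover have "w l' = x" using tight[OF l] sp(2) ll by simp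
      ultimately show ?thesis using has_lead_coeff[OF T[OF l]] by simp
    qed
    have "coeff (\<Sum>l\<in>J. T l) l' $ x = (\<Sum>l\<in>J. if l = l' then if w l' = x then \<beta> l' else 0 else 0)"
      unfolding Tsum by (rule sum.cong) (auto simp: c)
    thus ?thesis using J by simp
  qed
  \<comment> \<open>A lead point of least height survives in the sum. It therefore comes from the
    support of x^v u H, which lies above the line of \<open>H\<close> raised by v because
    \<open>u\<close> only adds nonnegative exponents.\<close>
  have bound: "real (n + v) + r * real i \<le> real (w l) + r * real l" if l: "l \<in> J" for l
  proof -
    define ht where "ht l = real (w l) + r * real l" for l
    define l0 where "l0 = arg_min_on ht J"
    have ne: "J \<noteq> {}" using l by auto
    have l0: "l0 \<in> J" unfolding l0_def by (rule arg_min_if_finite(1)[OF J ne])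
    have lmin: "ht l0 \<le> ht l'" if "l' \<in> J" for l'
      using arg_min_if_finite(2)[OF J ne] that unfolding l0_def by (meson not_less)
    have "coeff (\<Sum>l\<in>J. T l) l0 $ w l0 = \<beta> l0"
      using Tc[of "w l0" l0] lmin l0 by (simp add: ht_def)
    hence "coeff (\<Sum>l\<in>J. T l) l0 $ w l0 \<noteq> 0" using has_lead_nonzero[OF T[OF l0]] by simp
    hence vw: "v \<le> w l0" and "coeff (u * H) l0 $ (w l0 - v) \<noteq> 0"
      unfolding eq[symmetric] coeff_monom_0_mult by (auto split: if_splits)
    then obtain y where "y \<in> {..l0} \<times> {..w l0 - v}"
      "(case y of (l', x') \<Rightarrow> coeff u (l0 - l') $ (w l0 - v - x') * coeff H l' $ x') \<noteq> 0"
      unfolding uH using sum.not_neutral_contains_not_neutral by meson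
    then obtain l' x' where lx: "l' \<le> l0" "x' \<le> w l0 - v" "coeff H l' $ x' \<noteq> 0"
      by (cases y) auto
    have "real n + r * real i \<le> real x' + r * real l'" by (rule sup'[OF lx(3)])
    also have "\<dots> \<le> real (w l0 - v) + r * real l0"
      using lx r by (intro add_mono mult_left_mono) auto
    finally have "real (n + v) + r * real i \<le> ht l0" using vw by (simp add: ht_def of_nat_diff)
    thus ?thesis using lmin[OF l] by (simp add: ht_def)
  qed
  have "coeff (u * H) i $ n = (\<Sum>y\<in>{(i, n)}. case y of (l', x') \<Rightarrow> coeff u (i - l') $ (n - x') * coeff H l' $ x')"
    unfolding uH
  proof (rule sum.mono_neutral_right)
    show "\<forall>y\<in>{..i} \<times> {..n} - {(i, n)}. (case y of (l', x') \<Rightarrow> coeff u (i - l') $ (n - x') * coeff H l' $ x') = 0"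
    proof
      fix y assume "y \<in> {..i} \<times> {..n} - {(i, n)}"
      then obtain l' x' where y: "y = (l', x')" "l' \<le> i" "x' \<le> n" "(l', x') \<noteq> (i, n)" by (cases y) auto
      have "coeff H l' $ x' = 0"
      proof (rule ccontr)
        assume "coeff H l' $ x' \<noteq> 0"
        note s = sup'[OF this]
        have "r * real i \<le> r * real l'" using s y(3) by linarith
        hence "l' = i" using r y(2) by simp
        with s y(3,4) show False by simp
      qed
      thus "(case y of (l', x') \<Rightarrow> coeff u (i - l') $ (n - x') * coeff H l' $ x') = 0" using y(1) by simp
    qed
  qed auto
  hence "coeff u 0 $ 0 * coeff H i $ n = coeff (u * H) i $ n" by simp
  also have "\<dots> = coeff (\<Sum>l\<in>J. T l) i $ (n + v)"
    unfolding eq[symmetric] coeff_monom_0_mult by simp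
  also have "\<dots> = (if i \<in> J \<and> w i = n + v then \<beta> i else 0)"
    by (rule Tc) (rule bound)
  finally show ?thesis .
qed

lemma valx_monom_mult:
  fixes M :: "'a::field fps poly"
  assumes "coeff M i $ 0 \<noteq> 0"
  shows "valx (monom (fps_X ^ v) 0 * M) = v"
  unfolding valx_def
proof (rule Min_eqI)
  let ?A = "monom (fps_X ^ v) 0 * M"
  show "finite {subdegree (coeff ?A i) |i. coeff ?A i \<noteq> 0}"
    by (rule finite_subset[of _ "(\<lambda>l. subdegree (coeff ?A l)) ` {..degree ?A}"]) (auto intro: le_degree)
  show "v \<le> y" if "y \<in> {subdegree (coeff ?A i) |i. coeff ?A i \<noteq> 0}" for y
    using that by (auto intro!: subdegree_geI simp: coeff_monom_0_mult)
  have c: "coeff ?A i $ v \<noteq> 0" using assms by (simp add: coeff_monom_0_mult)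
  hence "subdegree (coeff ?A i) = v" by (rule subdegreeI) (simp add: coeff_monom_0_mult)
  moreover have "coeff ?A i \<noteq> 0" using c by auto
  ultimately show "v \<in> {subdegree (coeff ?A i) |i. coeff ?A i \<noteq> 0}"
    unfolding mem_Collect_eq by (intro exI[of _ i] conjI) simp_all
qed

lemma newton_polygon_degree_point:
  fixes H :: "'a::field fps poly"
  assumes "lead_coeff H = 1"
  shows "(real (degree H), 0) \<in> newton_polygon H"
proof -
  have "(real (degree H), real (subdegree (coeff H (degree H)))) \<in> np_points H"
    unfolding np_points_def using assms by (auto intro!: exI[of _ "degree H"])
  hence 1: "(real (degree H), 0) \<in> convex hull (np_points H)" using assms by (simp add: hull_inc)
  have "0 \<le> snd x + 0 * fst x" if "x \<in> convex hull (np_points H)" for x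
    by (rule convex_hull_halfplane[OF _ that]) (auto simp: np_points_def)
  thus ?thesis using 1 by (auto simp: newton_polygon_def)
qed

lemma newton_polygon_snd_nonneg:
  fixes H :: "'a::field fps poly"
  assumes "x \<in> newton_polygon H"
  shows "0 \<le> snd x"
proof -
  have "x \<in> convex hull (np_points H)" using assms by (simp add: newton_polygon_def)
  hence "0 \<le> snd x + 0 * fst x"
    by (rule convex_hull_halfplane[rotated]) (auto simp: np_points_def)
  thus ?thesis by simp
qed

text \<open>The i-th term has degree in the interval from i D up to, but excluding, (i + 1) D. These
  intervals are disjoint, so the largest index fixes \<open>degree F\<close>; with degree n D and
  leading coefficient 1 its digit must be 1.\<close>

lemma monic_expansion_top:
  fixes g :: "'b::idom poly"
  assumes J: "finite J" and g: "degree g = D" "D > 0" "lead_coeff g = 1"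
    and a: "\<And>i. i \<in> J \<Longrightarrow> a i \<noteq> 0 \<and> degree (a i) < D"
    and F: "F = (\<Sum>i\<in>J. a i * g ^ i)" "lead_coeff F = 1" "degree F = n * D"
  shows "n \<in> J" "a n = 1"
proof -
  have g0: "g \<noteq> 0" using g by auto
  have "J \<noteq> {}" using F by auto
  define M where "M = Max J"
  have M: "M \<in> J" unfolding M_def using J \<open>J \<noteq> {}\<close> by (rule Max_in)
  have dt: "degree (a i * g ^ i) = degree (a i) + i * D" if "i \<in> J" for i
    using a[OF that] g0 g(1) by (simp add: degree_mult_eq degree_power_eq)
  define R where "R = (\<Sum>i\<in>J - {M}. a i * g ^ i)"
  have FR: "F = a M * g ^ M + R" unfolding R_def F(1) by (rule sum.remove[OF J M])
  have dR: "R = 0 \<or> degree R < M * D"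
  proof (cases "J - {M} = {}")
    case True
    thus ?thesis by (simp only: R_def sum.empty) simp
  next
    case False
    have "degree (a i * g ^ i) < M * D" if "i \<in> J - {M}" for i
    proof -
      have "i < M" using that J unfolding M_def by (metis DiffE Max_ge insertI1 order_le_less)
      hence "(i + 1) * D \<le> M * D" by (intro mult_le_mono1) simp
      thus ?thesis using dt[of i] a[of i] that by simp
    qed
    moreover have "M > 0"
    proof (rule ccontr)
      assume "\<not> M > 0"
      with False J have "\<exists>i\<in>J. i > Max J" unfolding M_def by (metis DiffE equals0I gr0I insertI1)
      thus False using J by (metis Max_ge not_le)
    qed
    ultimately show ?thesis unfolding R_def using J g(2)
      by (intro disjI2 degree_sum_less) auto
  qed
  have dM: "degree (a M * g ^ M) = degree (a M) + M * D" by (rule dt[OF M])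
  have dF: "degree F = degree (a M) + M * D"
    unfolding FR using dR dM by (cases "R = 0") (auto simp: degree_add_eq_left)
  hence "n * D = degree (a M) + M * D" using F(3) by simp
  moreover have "degree (a M) < D" using a[OF M] by simp
  ultimately have nM: "n = M" 
    by (metis add.commute div_less div_mult_self1_is_m div_mult_self3 add_0 g(2) nat_neq_iff)
  hence d0: "degree (a M) = 0" using \<open>n * D = _\<close> by simp
  have "coeff F (degree F) = coeff (a M * g ^ M) (degree (a M * g ^ M)) + coeff R (M * D)"
    unfolding FR[symmetric] by (metis FR coeff_add dF dM d0 add_0)
  also have "coeff R (M * D) = 0" using dR by (auto intro: coeff_eq_0)
  finally have "lead_coeff (a M * g ^ M) = 1" using F(2) by simp
  hence "lead_coeff (a M) = 1" using g(3) by (simp only: lead_coeff_mult lead_coeff_power power_one mult_1_right)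
  with d0 have "a M = 1" by (metis degree_eq_zeroE lead_coeff_pCons(2) one_pCons)
  thus "n \<in> J" "a n = 1" using M nM by auto
qed

text \<open>A mixed radix count: deg phi_j = f_j e_j is the place value, and digits below q \<ell>
  cannot reach the next place.\<close>

lemma (in substitution_tower) degree_mon:
  "j \<le> k \<Longrightarrow> B \<in> box0 j \<Longrightarrow> mon j B \<noteq> 0 \<and> degree (mon j B) < ff j * ee j"
proof (induction j arbitrary: B)
  case 0
  thus ?case by (simp add: mon_def)
next
  case (Suc j)
  define D where "D = ff j * ee j"
  obtain B' i where B: "B = B'(Suc j := i)" "B' \<in> box0 j" "i < q (Suc j) * ell (Suc j)"
    using Suc.prems(2) unfolding box0_Suc(1) by auto
  have IH: "mon j B' \<noteq> 0" "degree (mon j B') < D" using Suc.IH[OF _ B(2)] Suc.prems(1) by (auto simp: D_def)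
  have dphi: "degree (phi j) = D" using phi_degree[of j] invar[of j] Suc.prems(1) by (simp add: D_def)
  have "lead_coeff (phi j) = 1" using phi_props(2)[of j] Suc.prems(1) by simp
  hence p0: "phi j \<noteq> 0" by auto
  have "degree (mon (Suc j) B) = degree (mon j B') + i * D"
    using IH p0 dphi unfolding B(1) mon_Suc by (simp add: degree_mult_eq degree_power_eq)
  also have "\<dots> < (i + 1) * D" using IH(2) by simp
  also have "\<dots> \<le> (q (Suc j) * ell (Suc j)) * D" using B(3) by (intro mult_le_mono1) simp
  also have "\<dots> = ff (Suc j) * ee (Suc j)" by (simp add: D_def mult_ac)
  finally show ?case using IH p0 unfolding B(1) mon_Suc by simp
qed

section \<open>The expansion of F grouped by powers of phi_k\<close>

locale expanded_tower = substitution_tower K F k H U G q N t a m s P z c phi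
  for K :: "'a::field set" and F :: "'a fps poly" and k :: nat
    and H U G :: "nat \<Rightarrow> 'a fps poly" and q N t a :: "nat \<Rightarrow> nat" and m s :: "nat \<Rightarrow> int"
    and P :: "nat \<Rightarrow> 'a poly" and z :: "nat \<Rightarrow> 'a" and c :: "nat \<Rightarrow> 'a fps"
    and phi :: "nat \<Rightarrow> 'a fps poly" +
  fixes f :: "(nat \<Rightarrow> nat) \<Rightarrow> 'a"
  assumes f: "phi_expansion K k q P phi F f"
begin

text \<open>Index vectors are split as \<open>B(0 := n, Suc k := i)\<close> with \<open>B \<in> box0 k\<close>: \<open>gf\<close> collects the
  \<open>f\<close>-values along \<open>n\<close> into a power series, \<open>FF i\<close> is the coefficient of \<open>\<phi>\<^sub>k\<^sup>i\<close> in \<open>F\<close>, and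
  \<open>up\<close> reinserts the least \<open>n\<close> with nonzero value.\<close>
definition gf where "gf B = Abs_fps (\<lambda>n. f (B(0 := n)))"
definition XX where "XX i = {B \<in> box0 k. gf (B(Suc k := i)) \<noteq> 0}"
definition II where "II = {i. XX i \<noteq> {}}"
definition FF where "FF i = (\<Sum>B\<in>XX i. [:gf (B(Suc k := i)):] * mon k B)"
definition up where "up i B = B(0 := subdegree (gf (B(Suc k := i))))"
definition w0 where "w0 i = Min ((\<lambda>B. wt k (up i B)) ` XX i)"
definition b0 where
  "b0 i = (\<Sum>B\<in>{B\<in>XX i. wt k (up i B) = w0 i}. gf (B(Suc k := i)) $ subdegree (gf (B(Suc k := i))) * lam k (up i B))"
definition VK where "VK = VV k (Suc k)"
definition LK where "LK = LL k (Suc k)"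

lemma gf_nonzero: "gf B \<noteq> 0 \<longleftrightarrow> (\<exists>n. f (B(0 := n)) \<noteq> 0)"
  by (auto simp: gf_def fps_eq_iff)

lemma f_K: "f B \<in> K" and f_Bset: "f B \<noteq> 0 \<Longrightarrow> B \<in> Bset k q P"
  using f by (auto simp: phi_expansion_def)

lemma gf_over: "gf B \<in> fps_over K"
  by (simp add: gf_def fps_over_def f_K)

lemma Bset_cut: "B \<in> Bset k q P \<Longrightarrow> B(0 := 0, Suc k := 0) \<in> box0 k"
  by (auto simp: Bset_def box0_def ibox_def ell_def)

lemma finite_XX: "finite (XX i)"
  by (simp add: XX_def finite_box0)

lemma XX_box0: "XX i \<subseteq> box0 k"
  by (auto simp: XX_def)

lemma support_eq:
  "{B'. B' 0 = 0 \<and> (\<exists>n. f (B'(0 := n)) \<noteq> 0)} = (\<lambda>(i, B). B(Suc k := i)) ` (SIGMA i:II. XX i)"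
    (is "?S = ?T")
proof (intro equalityI subsetI)
  fix B' assume "B' \<in> ?S"
  then obtain n where n: "B' 0 = 0" "f (B'(0 := n)) \<noteq> 0" by auto
  define B where "B = B'(Suc k := 0)"
  have B': "B' = B(Suc k := B' (Suc k))" by (auto simp: B_def)
  have "(B'(0 := n))(0 := 0, Suc k := 0) = B" using n(1) by (auto simp: B_def)
  hence "B \<in> box0 k" using Bset_cut[OF f_Bset[OF n(2)]] by simp
  moreover have "gf (B(Suc k := B' (Suc k))) \<noteq> 0" using n(2) B' unfolding gf_nonzero by metis
  ultimately have "B \<in> XX (B' (Suc k))" by (simp add: XX_def)
  thus "B' \<in> ?T" using B' by (intro image_eqI[of _ _ "(B' (Suc k), B)"]) (auto simp: II_def)
next
  fix B' assume "B' \<in> ?T"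
  then obtain i B where B: "B' = B(Suc k := i)" "B \<in> XX i" by auto
  have "B 0 = 0" using B(2) by (simp add: XX_def box0_def)
  thus "B' \<in> ?S" using B gf_nonzero by (auto simp: XX_def)
qed

lemma inj_join: "inj_on (\<lambda>(i, B). B(Suc k := i)) (SIGMA i:II. XX i)"
proof (rule inj_on_inverseI[of _ "\<lambda>B. (B (Suc k), B(Suc k := 0))"])
  fix x assume "x \<in> (SIGMA i:II. XX i)"
  then obtain i B where x: "x = (i, B)" "B \<in> box0 k" using XX_box0 by blast
  hence "B (Suc k) = 0" by (simp add: box0_def ibox_def)
  thus "(\<lambda>B. (B (Suc k), B(Suc k := 0))) (case x of (i, B) \<Rightarrow> B(Suc k := i)) = x"
    using x(1) by auto
qed

lemma finite_II: "finite II"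
proof -
  have "finite {B'. B' 0 = 0 \<and> (\<exists>n. f (B'(0 := n)) \<noteq> 0)}" using f by (simp add: phi_expansion_def)
  hence "finite (SIGMA i:II. XX i)" unfolding support_eq using inj_join by (rule finite_imageD)
  hence "finite (fst ` (SIGMA i:II. XX i))" by (rule finite_imageI)
  moreover have "fst ` (SIGMA i:II. XX i) = II" by (auto simp: II_def image_iff)
  ultimately show ?thesis by simp
qed

lemma F_sum: "F = (\<Sum>i\<in>II. FF i * phi k ^ i)"
proof -
  have "F = (\<Sum>B' \<in> {B'. B' 0 = 0 \<and> (\<exists>n. f (B'(0 := n)) \<noteq> 0)}. [:gf B':] * mon (Suc k) B')"
    using f unfolding phi_expansion_def gf_def mon_def by blast
  also have "\<dots> = (\<Sum>(i, B)\<in>(SIGMA i:II. XX i). [:gf (B(Suc k := i)):] * (mon k B * phi k ^ i))"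
    unfolding support_eq by (subst sum.reindex[OF inj_join]) (simp add: case_prod_unfold mon_Suc)
  also have "\<dots> = (\<Sum>i\<in>II. \<Sum>B\<in>XX i. [:gf (B(Suc k := i)):] * (mon k B * phi k ^ i))"
    by (rule sum.Sigma[symmetric]) (simp_all add: finite_II finite_XX)
  also have "\<dots> = (\<Sum>i\<in>II. FF i * phi k ^ i)"
    unfolding FF_def sum_distrib_right by (simp only: mult.assoc)
  finally show ?thesis .
qed

lemma lead_FF:
  assumes "i \<in> II"
  shows "has_lead (subs (FF i) (pj k)) 0 (w0 i) (b0 i)"
  unfolding FF_def w0_def b0_def up_def
proof (rule has_lead_expansion[OF order_refl _ _ finite_XX XX_box0])
  show "indep k" "low_leads k" using invar[OF order_refl] by (simp_all add: invar_def)
  show "XX i \<noteq> {}" using assms by (simp add: II_def)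
  show "gf (B(Suc k := i)) \<in> fps_over K \<and> gf (B(Suc k := i)) \<noteq> 0" if "B \<in> XX i" for B
    using that by (simp add: gf_over XX_def)
qed

lemma lead_term:
  assumes "i \<in> II"
  shows "has_lead (subs (FF i * phi k ^ i) (pj k)) i (w0 i + i * VK) (b0 i * LK ^ i)"
proof -
  have f0: "fst (pj k) $ 0 = 0" by (rule fst_pj_0) simp
  have "has_lead (subs (phi k) (pj k)) 1 VK LK"
    using phi_lead'[OF order_refl invar[OF order_refl]] by (simp add: VK_def LK_def Phi_vec_def)
  from has_lead_mult[OF lead_FF[OF assms] has_lead_power[OF this, of i]]
  show ?thesis by (simp add: subs_mult[OF f0] subs_power[OF f0])
qed

lemma LK_nonzero: "LK \<noteq> 0"
  using has_lead_nonzero[OF phi_lead'[OF order_refl invar[OF order_refl]]] by (simp add: LK_def)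

lemma FF_top: "N k \<in> II" "FF (N k) = 1"
proof -
  define D where "D = ff k * ee k"
  have D: "degree (phi k) = D" "D > 0"
    using phi_degree[OF order_refl invar[OF order_refl]] ff_pos[of k] ee_pos[of k] by (simp_all add: D_def)
  have fi: "FF i \<noteq> 0 \<and> degree (FF i) < D" if "i \<in> II" for i
  proof
    \<comment> \<open>The digit is nonzero because it has a leading form, so uniqueness of
      expansions is not presupposed.\<close>
    show "FF i \<noteq> 0"
      using has_lead_coeff[OF lead_FF[OF that]] has_lead_nonzero[OF lead_FF[OF that]] by auto
    have "degree (FF i) \<le> D - 1"
      unfolding FF_def
    proof (rule degree_sum_le[OF finite_XX])
      fix B assume "B \<in> XX i"
      hence "degree (mon k B) < D" using degree_mon[OF order_refl] XX_box0 by (auto simp: D_def)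
      thus "degree ([:gf (B(Suc k := i)):] * mon k B) \<le> D - 1"
        using degree_smult_le[of "gf (B(Suc k := i))" "mon k B"] by simp
    qed
    thus "degree (FF i) < D" using D(2) by linarith
  qed
  have "degree F = N k * D" using degree_F[of k] by (simp add: D_def)
  from monic_expansion_top[OF finite_II D phi_props(2)[OF order_refl] fi F_sum F(2) this]
  show "N k \<in> II" "FF (N k) = 1" by auto
qed

lemma b0_top: "b0 (N k) = 1"
  using has_lead_unique(3)[OF lead_FF[OF FF_top(1)], of 0 0 1] has_lead_1 by (simp add: FF_top(2))

text \<open>For k > 0 this is \<open>newton_compare\<close>. For k = 0 the pullbacks of the terms
  are monomials in y and H_0 is exactly their sum. In both cases the point (N_k, 0) identifies the
  unknown unit as \<open>LK ^ N k\<close>.\<close>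

lemma newton_coefficient:
  assumes p: "(real i, real n) \<in> newton_polygon (H k)"
  shows "LK ^ N k * coeff (H k) i $ n =
    (if i \<in> II \<and> w0 i + i * VK = n + valx (subs F (pj k)) then b0 i * LK ^ i else 0)"
proof -
  have Hk: "degree (H k) = N k" "lead_coeff (H k) = 1" "k > 0 \<longrightarrow> weierstrass (H k) (N k)"
    using H_monic[of k] by auto
  define T where "T i = subs (FF i * phi k ^ i) (pj k)" for i
  have T: "has_lead (T i) i (w0 i + i * VK) (b0 i * LK ^ i)" if "i \<in> II" for i
    unfolding T_def by (rule lead_term[OF that])
  have FT: "subs F (pj k) = (\<Sum>i\<in>II. T i)"
    unfolding T_def by (subst F_sum) (rule subs_sum)
  obtain A v b where A: "subs F (pj k) = A * H k" "has_lead A 0 v b" "k = 0 \<longrightarrow> A = 1"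
    using F_factor[OF order_refl] by (elim exE conjE)
  obtain u where u: "A = monom (fps_X ^ v) 0 * u" "coeff u 0 $ 0 = b" and b: "b \<noteq> 0"
    using A(2) unfolding has_lead_def by (elim exE conjE)
  have eq: "monom (fps_X ^ v) 0 * (u * H k) = (\<Sum>i\<in>II. T i)"
    using A(1) FT u(1) by (simp add: mult.assoc)
  have A0: "v = 0 \<and> u = 1 \<and> b = 1" if "k = 0"
  proof -
    have A1: "A = 1" using A(3) that by simp
    hence "v = 0" using has_lead_unique(2)[OF A(2)[unfolded A1] has_lead_1] by simp
    moreover from this have "u = 1" using u(1) A1 by (simp add: monom_0)
    ultimately show ?thesis using u(2) by simp
  qed
  have key: "b * coeff (H k) i $ n = (if i \<in> II \<and> w0 i + i * VK = n + v then b0 i * LK ^ i else 0)"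
    if p: "(real i, real n) \<in> newton_polygon (H k)" for i n
  proof (cases "k = 0")
    case False
    hence "weierstrass (H k) (N k)" using Hk by simp
    from newton_compare[OF this _ _ finite_II T eq p] show ?thesis using Nk u(2) b by simp
  next
    case True
    \<comment> \<open>At level 0 the digits involve x only and phi_0 pulls back to y, so different
      terms occupy different powers of y.\<close>
    have exact: "coeff (T l) i = (if l = i then coeff (T i) i else 0)" if "l \<in> II" for l i
    proof -
      obtain h where h: "FF l = [:h:]"
      proof -
        have "mon k B = 1" for B unfolding mon_def using True by simp
        hence "FF l = (\<Sum>B\<in>XX l. [:gf (B(Suc k := l)):])" unfolding FF_def by simp
        also have "\<dots> = [:\<Sum>B\<in>XX l. gf (B(Suc k := l)):]"
          by (induction "XX l" rule: infinite_finite_induct) (rule poly_eqI, simp add: coeff_sum coeff_pCons split: nat.splits)+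
        finally show ?thesis by (rule that)
      qed
      have f0: "fst (pj 0) $ 0 = 0" by (rule fst_pj_0) simp
      have "T l = [:h oo fst (pj 0):] * [:0, 1:] ^ l"
        unfolding T_def h unfolding True subs_mult[OF f0] subs_power[OF f0] phi_0 subs_const ..
      also have "\<dots> = monom (h oo fst (pj 0)) l" by (simp add: monom_altdef)
      finally show ?thesis by (cases "l = i") auto
    qed
    have Hk': "H k = (\<Sum>i\<in>II. T i)" using A0[OF True] A(1) FT u(1) by (simp add: monom_0)
    have ci: "coeff (H k) i = (if i \<in> II then coeff (T i) i else 0)"
    proof -
      have "coeff (H k) i = (\<Sum>l\<in>II. if l = i then coeff (T i) i else 0)"
        unfolding Hk' coeff_sum by (rule sum.cong) (use exact in auto)
      thus ?thesis using finite_II by simp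
    qed
    show ?thesis
    proof (cases "i \<in> II")
      case False
      thus ?thesis using ci by simp
    next
      case i: True
      note Ti = T[OF i]
      have nz: "coeff (T i) i $ (w0 i + i * VK) \<noteq> 0"
        using has_lead_coeff[OF Ti] has_lead_nonzero[OF Ti] by simp
      have "coeff (H k) i \<noteq> 0" using nz ci i by auto
      from newton_polygon_le[OF p this] have "n \<le> subdegree (coeff (T i) i)" using ci i by simp
      also have "\<dots> \<le> w0 i + i * VK" using nz by (rule subdegree_leI)
      finally have le: "n \<le> w0 i + i * VK" .
      show ?thesis
      proof (cases "n = w0 i + i * VK")
        case True
        thus ?thesis using has_lead_coeff[OF Ti] ci i A0[OF \<open>k = 0\<close>] by simp
      next
        case False
        hence "coeff (T i) i $ n = 0" using le has_lead_support(2)[OF Ti, of i n] by force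
        thus ?thesis using False ci i A0[OF \<open>k = 0\<close>] by simp
      qed
    qed
  qed
  have top: "(real (N k), real 0) \<in> newton_polygon (H k)"
    using newton_polygon_degree_point[OF Hk(2)] Hk(1) by simp
  have "b * coeff (H k) (N k) $ 0 = b" using Hk(1,2) by simp
  hence bL: "b = LK ^ N k" using key[OF top] b b0_top by (auto split: if_splits)
  have "valx (subs F (pj k)) = v"
    unfolding A(1) u(1) mult.assoc
  proof (rule valx_monom_mult)
    show "coeff (u * H k) (N k) $ 0 \<noteq> 0"
    proof (cases "k = 0")
      case True
      thus ?thesis using A0 Hk by simp
    next
      case False
      hence low: "coeff (H k) l $ 0 = 0" if "l < N k" for l using Hk(3) that by (simp add: weierstrass_def)
      have "coeff (u * H k) (N k) $ 0 = (\<Sum>l\<le>N k. coeff u (N k - l) $ 0 * coeff (H k) l $ 0)"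
        by (subst mult.commute, subst coeff_mult) (simp add: fps_sum_nth mult.commute)
      \<comment> \<open>Modulo x, H_k is a power of y, so at y^(N_k) x^0 only the constant term of
        \<open>u\<close> remains.\<close>
      also have "\<dots> = (\<Sum>l\<in>{N k}. coeff u (N k - l) $ 0 * coeff (H k) l $ 0)"
        by (rule sum.mono_neutral_right) (use low in \<open>auto simp: le_less\<close>)
      finally show ?thesis using u(2) b Hk by simp
    qed
  qed
  thus ?thesis using key[OF p] bL by simp
qed

section \<open>Weights of index vectors and the boundary formula\<close>

definition dotV where "dotV B = (\<Sum>j\<le>Suc k. B j * VV k j)"

lemma dotV_alt: "dotV B = wt k B + B (Suc k) * VK"
  by (simp add: dotV_def wt_def VK_def)

lemma wt_cong: "(\<And>p. p \<le> k \<Longrightarrow> B p = B' p) \<Longrightarrow> wt k B = wt k B'"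
  by (simp add: wt_def)

lemma lam_cong: "(\<And>p. p \<le> k \<Longrightarrow> B p = B' p) \<Longrightarrow> lam k B = lam k B'"
  by (simp add: lam_def)

text \<open>Among vectors that differ only in the x-exponent, the weight grows strictly with it, as
  x has weight e_k > 0. So only the least exponent with a nonzero value can attain the minimal
  weight.\<close>

lemma support_minimal:
  assumes B: "f B \<noteq> 0" "B (Suc k) = i"
  defines "B1 \<equiv> B(0 := 0, Suc k := 0)"
  shows "B1 \<in> XX i" "w0 i \<le> wt k (up i B1)" "wt k (up i B1) \<le> wt k B"
    "wt k B = w0 i \<Longrightarrow> (up i B1)(Suc k := i) = B"
proof -
  have g: "gf (B1(Suc k := i)) $ B 0 = f B"
  proof -
    have "(B1(Suc k := i))(0 := B 0) = B" using B(2) by (auto simp: B1_def)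
    thus ?thesis by (simp add: gf_def)
  qed
  hence g0: "gf (B1(Suc k := i)) $ B 0 \<noteq> 0" using B(1) by simp
  show X: "B1 \<in> XX i" unfolding XX_def using Bset_cut[OF f_Bset[OF B(1)]] g0 by (auto simp: B1_def)
  show w0: "w0 i \<le> wt k (up i B1)" unfolding w0_def using X by (simp add: finite_XX)
  define n where "n = subdegree (gf (B1(Suc k := i)))"
  have n: "n \<le> B 0" unfolding n_def using g0 by (rule subdegree_leI)
  have e0: "VV k 0 > 0" using VV_0[of k] ee_pos[of k] by simp
  have 1: "wt k (up i B1) = n * VV k 0 + (\<Sum>p\<in>{1..k}. B p * VV k p)"
    unfolding up_def n_def[symmetric] wt_upd0 by (simp add: B1_def)
  have 2: "wt k B = B 0 * VV k 0 + (\<Sum>p\<in>{1..k}. B p * VV k p)"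
    using wt_upd0[of k B "B 0"] by simp
  show "wt k (up i B1) \<le> wt k B" unfolding 1 2 using n by simp
  show "(up i B1)(Suc k := i) = B" if "wt k B = w0 i"
  proof -
    have "B 0 * VV k 0 \<le> n * VV k 0" using that w0 1 2 by linarith
    hence "n = B 0" using e0 n by simp
    thus ?thesis unfolding up_def n_def[symmetric] using B(2) by (auto simp: B1_def)
  qed
qed

lemma up_props:
  assumes "B \<in> XX i"
  shows "f ((up i B)(Suc k := i)) = gf (B(Suc k := i)) $ subdegree (gf (B(Suc k := i)))"
    "f ((up i B)(Suc k := i)) \<noteq> 0" "dotV ((up i B)(Suc k := i)) = wt k (up i B) + i * VK"
    "lam k ((up i B)(Suc k := i)) = lam k (up i B)" "(up i B)(0 := 0) = B"
proof -
  have e: "(up i B)(Suc k := i) = (B(Suc k := i))(0 := subdegree (gf (B(Suc k := i))))"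
    by (auto simp: up_def)
  show 1: "f ((up i B)(Suc k := i)) = gf (B(Suc k := i)) $ subdegree (gf (B(Suc k := i)))"
    unfolding e by (simp add: gf_def)
  show "f ((up i B)(Suc k := i)) \<noteq> 0" unfolding 1 using assms by (simp add: XX_def)
  have "wt k ((up i B)(Suc k := i)) = wt k (up i B)" by (rule wt_cong) simp
  thus "dotV ((up i B)(Suc k := i)) = wt k (up i B) + i * VK" unfolding dotV_alt by simp
  show "lam k ((up i B)(Suc k := i)) = lam k (up i B)" by (rule lam_cong) simp
  have "B 0 = 0" using assms by (simp add: XX_def box0_def)
  thus "(up i B)(0 := 0) = B" by (auto simp: up_def)
qed

definition WW where "WW i = {dotV B |B. B \<in> Bset k q P \<and> B (Suc k) = i \<and> f B \<noteq> 0}"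

lemma WW_nonempty: "WW i \<noteq> {} \<longleftrightarrow> i \<in> II"
proof
  assume "WW i \<noteq> {}"
  then obtain B where "f B \<noteq> 0" "B (Suc k) = i" unfolding WW_def by blast
  from support_minimal(1)[OF this] show "i \<in> II" by (auto simp: II_def)
next
  assume "i \<in> II"
  then obtain B where B: "B \<in> XX i" by (auto simp: II_def)
  have "dotV ((up i B)(Suc k := i)) \<in> WW i"
    unfolding WW_def mem_Collect_eq
    by (intro exI[of _ "(up i B)(Suc k := i)"] conjI refl f_Bset up_props(2)[OF B]) simp
  thus "WW i \<noteq> {}" by blast
qed

lemma WW_Least:
  assumes "i \<in> II"
  shows "(LEAST x. x \<in> WW i) = w0 i + i * VK"
proof (rule Least_equality)
  have "XX i \<noteq> {}" using assms by (simp add: II_def)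
  hence "w0 i \<in> (\<lambda>B. wt k (up i B)) ` XX i" unfolding w0_def by (intro Min_in) (simp_all add: finite_XX)
  then obtain B where B: "B \<in> XX i" "w0 i = wt k (up i B)" by blast
  show "w0 i + i * VK \<in> WW i"
    unfolding WW_def mem_Collect_eq B(2)
    by (intro exI[of _ "(up i B)(Suc k := i)"] conjI f_Bset up_props(2,3)[OF B(1)] up_props(3)[OF B(1), symmetric]) simp
next
  fix y assume "y \<in> WW i"
  then obtain B where B: "y = dotV B" "f B \<noteq> 0" "B (Suc k) = i" unfolding WW_def by blast
  have "w0 i \<le> wt k B" using support_minimal(2,3)[OF B(2,3)] by (rule order_trans)
  thus "w0 i + i * VK \<le> y" unfolding B(1) dotV_alt B(3) by simp
qed

text \<open>Vectors with \<open>f B = 0\<close> contribute nothing, and the others of minimal weight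
  correspond bijectively to the summands of \<open>b0 i\<close> by reinserting the x-exponent and
  the last entry.\<close>

lemma weight_sum:
  assumes "i \<in> II"
  shows "(\<Sum>B\<in>{B \<in> Bset k q P. B (Suc k) = i \<and> dotV B = w0 i + i * VK}. f B * lam k B) = b0 i"
proof -
  define D where "D = {B \<in> Bset k q P. B (Suc k) = i \<and> dotV B = w0 i + i * VK}"
  define Y where "Y = {B\<in>XX i. wt k (up i B) = w0 i}"
  define j where "j B = (up i B)(Suc k := i)" for B
  \<comment> \<open>Finiteness matters because a sum over an infinite set is 0 by convention. The
    weight bounds the x-exponent, the only entry left unbounded.\<close>
  have "D \<subseteq> (\<lambda>(B, n). B(0 := n, Suc k := i)) ` (box0 k \<times> {..w0 i + i * VK})"
  proof
    fix B assume B: "B \<in> D"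
    have "VV k 0 > 0" using VV_0[of k] ee_pos[of k] by simp
    hence "B 0 \<le> B 0 * VV k 0" by simp
    also have "\<dots> \<le> dotV B"
      unfolding dotV_def by (rule member_le_sum[of 0]) auto
    finally have "B 0 \<le> w0 i + i * VK" using B by (simp add: D_def)
    moreover have "B(0 := 0, Suc k := 0) \<in> box0 k" using B Bset_cut by (simp add: D_def)
    moreover have "B = (B(0 := 0, Suc k := 0))(0 := B 0, Suc k := i)" using B by (auto simp: D_def)
    ultimately show "B \<in> (\<lambda>(B, n). B(0 := n, Suc k := i)) ` (box0 k \<times> {..w0 i + i * VK})"
      by (intro image_eqI[of _ _ "(B(0 := 0, Suc k := 0), B 0)"]) auto
  qed
  hence finD: "finite D" by (rule finite_subset) (simp add: finite_box0)
  have img: "{B \<in> D. f B \<noteq> 0} = j ` Y"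
  proof (intro equalityI subsetI)
    fix B assume "B \<in> {B \<in> D. f B \<noteq> 0}"
    hence B: "f B \<noteq> 0" "B (Suc k) = i" "wt k B = w0 i" by (auto simp: D_def dotV_alt)
    note sm = support_minimal[OF B(1,2)]
    have "wt k (up i (B(0 := 0, Suc k := 0))) = w0 i" using sm(2,3) B(3) by simp
    hence "B(0 := 0, Suc k := 0) \<in> Y" using sm(1) by (simp add: Y_def)
    thus "B \<in> j ` Y" unfolding j_def using sm(4)[OF B(3)] by (metis image_eqI)
  next
    fix B' assume "B' \<in> j ` Y"
    then obtain B where B: "B' = j B" "B \<in> XX i" "wt k (up i B) = w0 i" by (auto simp: Y_def)
    note up = up_props[OF B(2)]
    show "B' \<in> {B \<in> D. f B \<noteq> 0}"
      unfolding D_def B(1) j_def using up(2,3) f_Bset[OF up(2)] B(3) by simp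
  qed
  have inj: "inj_on j Y"
  proof (rule inj_on_inverseI[of _ "\<lambda>B. B(0 := 0, Suc k := 0)"])
    fix B assume "B \<in> Y"
    hence B: "B \<in> XX i" by (simp add: Y_def)
    hence "B (Suc k) = 0" by (simp add: XX_def box0_def ibox_def)
    thus "(j B)(0 := 0, Suc k := 0) = B" using up_props(5)[OF B] by (auto simp: j_def fun_eq_iff)
  qed
  have "(\<Sum>B\<in>D. f B * lam k B) = (\<Sum>B\<in>{B \<in> D. f B \<noteq> 0}. f B * lam k B)"
    by (rule sum.mono_neutral_right) (use finD in auto)
  also have "\<dots> = (\<Sum>B\<in>Y. f (j B) * lam k (j B))"
    unfolding img by (subst sum.reindex[OF inj]) simp
  also have "\<dots> = b0 i"
    unfolding b0_def Y_def[symmetric] by (rule sum.cong) (simp_all add: j_def Y_def up_props)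
  finally show ?thesis unfolding D_def .
qed

text \<open>B_0 has only its last entry nonzero, so the shift by B_0 affects the factor of phi_k
  alone.\<close>

lemma powi_prod:
  "(\<Prod>j\<le>Suc k. LL k j powi (int (B j) - (if j = Suc k then int (N k) else 0)))
    = lam k B * (LK powi (int (B (Suc k)) - int (N k)))"
proof -
  have "(\<Prod>j\<le>k. LL k j powi (int (B j) - (if j = Suc k then int (N k) else 0))) = lam k B"
    unfolding lam_def by (rule prod.cong) auto
  thus ?thesis by (simp add: LK_def)
qed

text \<open>Both sides are compared at each pair (i, n). On the polygon,
  \<open>newton_coefficient\<close> makes a coefficient nonzero only if w_i = n, so points with
  another height contribute to neither side.\<close>

lemma boundary_formula:
  "boundary_poly (newton_polygon (H k)) (H k) =
    (\<Sum>i \<in> {i. i \<le> degree (H k) \<and> WW i \<noteq> {} \<and>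
        (real i, real_of_int (int (LEAST x. x \<in> WW i) - int (valx (subs F (pj k))))) \<in> newton_polygon (H k)}.
      monom (fps_const (\<Sum>B \<in> {B \<in> Bset k q P. B (Suc k) = i \<and> dotV B =
            nat (int (LEAST x. x \<in> WW i) - int (valx (subs F (pj k))) + int (valx (subs F (pj k))))}.
          f B * (\<Prod>j\<le>Suc k. LL k j powi (int (B j) - (if j = Suc k then int (N k) else 0))))
        * fps_X ^ nat (int (LEAST x. x \<in> WW i) - int (valx (subs F (pj k))))) i)"
    (is "?L = (\<Sum>i\<in>?S. monom (fps_const (?c i) * fps_X ^ nat (?w i)) i)")
proof (rule poly_eqI, rule fps_ext)
  fix i n
  define v where "v = valx (subs F (pj k))"
  let ?NP = "newton_polygon (H k)"
  have c: "?c i = b0 i * (LK powi (int i - int (N k)))" if i: "i \<in> II" for i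
  proof -
    have "?c i = (\<Sum>B \<in> {B \<in> Bset k q P. B (Suc k) = i \<and> dotV B = w0 i + i * VK}.
        f B * lam k B * (LK powi (int i - int (N k))))"
      by (rule sum.cong) (simp_all only: powi_prod WW_Least[OF i] diff_add_cancel nat_int mult.assoc, auto)
    thus ?thesis using weight_sum[OF i] by (simp only: sum_distrib_right[symmetric])
  qed
  have fin: "finite ?S" by (rule finite_subset[of _ "{..degree (H k)}"]) auto
  have "coeff (\<Sum>i\<in>?S. monom (fps_const (?c i) * fps_X ^ nat (?w i)) i) i
      = (\<Sum>l\<in>?S. if l = i then fps_const (?c i) * fps_X ^ nat (?w i) else 0)"
    unfolding coeff_sum coeff_monom by (rule sum.cong) auto
  also have "\<dots> = (if i \<in> ?S then fps_const (?c i) * fps_X ^ nat (?w i) else 0)"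
    using fin by (rule sum.delta)
  finally have R: "coeff (\<Sum>i\<in>?S. monom (fps_const (?c i) * fps_X ^ nat (?w i)) i) i $ n
      = (if i \<in> ?S \<and> n = nat (?w i) then ?c i else 0)"
    by (simp add: fps_X_power_nth)
  have L: "coeff ?L i $ n = (if i \<le> degree (H k) \<and> (real i, real n) \<in> ?NP then coeff (H k) i $ n else 0)"
    by (rule coeff_boundary_poly)
  have LN: "LK ^ N k \<noteq> 0" using LK_nonzero by simp
  show "coeff ?L i $ n = coeff (\<Sum>i\<in>?S. monom (fps_const (?c i) * fps_X ^ nat (?w i)) i) i $ n"
  proof (cases "i \<in> ?S \<and> n = nat (?w i)")
    case True
    hence iI: "i \<in> II" and np: "(real i, real_of_int (?w i)) \<in> ?NP" and id: "i \<le> degree (H k)"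
      using WW_nonempty[of i] by auto
    \<comment> \<open>Points of the polygon have nonnegative height, so \<open>nat\<close> loses
      nothing on the indices that are summed.\<close>
    have "0 \<le> ?w i" using newton_polygon_snd_nonneg[OF np] by simp
    hence nw: "int n = ?w i" using True by simp
    hence "real n = real_of_int (?w i)" by (metis of_int_of_nat_eq)
    hence np': "(real i, real n) \<in> ?NP" using np by simp
    have "int n = int (w0 i + i * VK) - int v" using nw by (simp only: WW_Least[OF iI] v_def)
    hence "w0 i + i * VK = n + v" by linarith
    hence "LK ^ N k * coeff (H k) i $ n = b0 i * LK ^ i"
      using newton_coefficient[OF np'] iI by (simp add: v_def)
    hence "coeff (H k) i $ n = b0 i * LK ^ i / LK ^ N k" using LN by (simp add: field_simps)
    also have "\<dots> = ?c i" unfolding c[OF iI] using LK_nonzero by (simp add: power_int_diff)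
    finally show ?thesis by (simp only: L R if_P[OF True] np' id simp_thms if_True)
  next
    case False
    have "coeff ?L i $ n = 0"
    proof (rule ccontr)
      assume "coeff ?L i $ n \<noteq> 0"
      hence id: "i \<le> degree (H k)" and np: "(real i, real n) \<in> ?NP" and nz: "coeff (H k) i $ n \<noteq> 0"
        unfolding L by (auto split: if_splits)
      have "LK ^ N k * coeff (H k) i $ n \<noteq> 0" using LN nz by simp
      hence iI: "i \<in> II" and w: "w0 i + i * VK = n + v"
        unfolding newton_coefficient[OF np] by (auto simp: v_def split: if_splits)
      have "?w i = int n" unfolding WW_Least[OF iI] w by (simp add: v_def)
      hence weq: "?w i = int n" .
      have "i \<in> ?S"
        unfolding mem_Collect_eq weq using id np iI WW_nonempty[of i] by simp
      moreover have "n = nat (?w i)" unfolding weq by simp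
      ultimately show False using False by blast
    qed
    thus ?thesis by (simp only: R if_not_P[OF False])
  qed
qed

end

theorem theorem6:
  fixes K :: "'a::field set" and F :: "'a fps poly" and k :: nat
    and H U G :: "nat \<Rightarrow> 'a fps poly" and q N t a :: "nat \<Rightarrow> nat" and m s :: "nat \<Rightarrow> int"
    and P :: "nat \<Rightarrow> 'a poly" and z :: "nat \<Rightarrow> 'a" and c :: "nat \<Rightarrow> 'a fps"
    and phi :: "nat \<Rightarrow> 'a fps poly" and f :: "(nat \<Rightarrow> nat) \<Rightarrow> 'a"
  assumes K: "is_subfield K" "perfect_subfield K"
    and F: "F \<in> ps_poly_ring K" "lead_coeff F = 1"
    and char: "CHAR('a) = 0 \<or> CHAR('a) > degree F"
    and proc: "procedure_upto K F k H q m P N z s t a U G c"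
    and Nk: "N k > 1"
    and phi: "\<forall>i\<le>k. phi i \<in> ps_poly_ring K \<and> lead_coeff (phi i) = 1 \<and>
                irreducible_in (ps_poly_ring K) (phi i) \<and>
                poly (map_poly (\<lambda>h. h oo fst (the_pi q m z s t c i)) (phi i))
                     (coeff (snd (the_pi q m z s t c i)) 0) = 0"
    and f: "phi_expansion K k q P phi F f"
  shows "let \<pi> = the_pi q m z s t c k;
             vk = (\<lambda>h. valx (subs h \<pi>));
             lamk = (\<lambda>h. trail_lc (subs h \<pi>));
             dotV = (\<lambda>B. \<Sum>j\<le>Suc k. B j * vk (Phi_vec phi j));
             W = (\<lambda>i. {dotV B | B. B \<in> Bset k q P \<and> B (Suc k) = i \<and> f B \<noteq> 0});
             w = (\<lambda>i. int (LEAST x. x \<in> W i) - int (vk F));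
             Bw = (\<lambda>i x. {B \<in> Bset k q P. B (Suc k) = i \<and> dotV B = x})
         in boundary_poly (newton_polygon (H k)) (H k) =
            (\<Sum>i \<in> {i. i \<le> degree (H k) \<and> W i \<noteq> {} \<and>
                       (real i, real_of_int (w i)) \<in> newton_polygon (H k)}.
               monom (fps_const (\<Sum>B \<in> Bw i (nat (w i + int (vk F))).
                        f B * (\<Prod>j\<le>Suc k. lamk (Phi_vec phi j) powi
                               (int (B j) - (if j = Suc k then int (N k) else 0))))
                      * fps_X ^ nat (w i)) i)"
proof -
  interpret expanded_tower K F k H U G q N t a m s P z c phi f
    by unfold_locales (fact K(1) F char proc Nk phi f)+
  show ?thesis
    unfolding Let_def
    using boundary_formula unfolding WW_def dotV_def VV_def LL_def pj_def .
qed

end
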